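(* Let $D_{1:n}$ be drawn by pure stratified randomization, and let $a:\mathcal W\to\mathbb R^{d_a}$ be measurable with $E|a(W)|_2^2<\infty$. Let $X_n=\sqrt n\,\mathbb E_n[H_ia(W_i)]$ and $\mathcal F_n=\sigma(W_{1:n},\pi_n)$. Then for every $t\in\mathbb R^{d_a}$, $E[e^{it'X_n}\mid\mathcal F_n]=e^{-t'Vt/2}+o_p(1)$, where $V=\sigma_D^{-2}E[\mathrm{Var}(a(W)\mid\psi)]$; i.e. $X_n\mid\mathcal F_n\rightsquigarrow N(0,V)$.
   Context: $(W_i)_{i=1}^n$ are i.i.d. with values in $\mathcal W$, $W_i=(R_i,S_i(1),S_i(0))$; $\psi=\psi(R)\in\mathbb R^{d_\psi}$. $\mathbb E_n[a_i]=n^{-1}\sum_ia_i$. Integers $1\le l<k$, $p=l/k$, $\sigma_D^2=p(1-p)$, $H_i=(D_i-p)/\sigma_D^2$; $n$ a multiple of $k$. Pure stratified randomization: (1) partition $\{1,\dots,n\}$ into disjoint groups $s$ with $|s|=k$, the partition being a function of $(\psi_1,\dots,\psi_n)$ and auxiliary randomness $\pi_n$ independent of $W_{1:n}$, such that $n^{-1}\sum_s\sum_{i,j\in s}|\psi_i-\psi_j|_2^2=o_p(1)$; (2) independently across groups, set $D_i=1$ for exactly $l$ of the $k$ units of each group, chosen uniformly at random, and $D_i=0$ otherwise. *)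

theory Defs
  imports "HOL-Probability.Probability"
begin

text \<open>Treatment share p = l/k and sigma_D^2 = p(1-p).\<close>
definition sigD2 :: "nat \<Rightarrow> nat \<Rightarrow> real" where
  "sigD2 l k = (real l / real k) * (1 - real l / real k)"

definition Hval :: "nat \<Rightarrow> nat \<Rightarrow> bool \<Rightarrow> real" where
  "Hval l k b = (of_bool b - real l / real k) / sigD2 l k"

definition gen_sigma :: "'m measure \<Rightarrow> 'm set set \<Rightarrow> 'm measure" where
  "gen_sigma M G = sigma (space M) G"

definition rv_events :: "'m measure \<Rightarrow> 'b measure \<Rightarrow> ('m \<Rightarrow> 'b) \<Rightarrow> 'm set set" where
  "rv_events M N X = {X -` B \<inter> space M | B. B \<in> sets N}"

definition valid_assignment :: "nat \<Rightarrow> nat set set \<Rightarrow> (nat \<Rightarrow> bool) \<Rightarrow> bool" where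
  "valid_assignment l P d \<longleftrightarrow> (\<forall>s\<in>P. card {i\<in>s. d i} = l)"

definition exp_cond_var :: "'m measure \<Rightarrow> 'm measure \<Rightarrow> ('m \<Rightarrow> real ^ 'a) \<Rightarrow> real ^ 'a ^ 'a" where
  "exp_cond_var M G Y = (\<chi> j k. \<integral>\<omega>. real_cond_exp M G
      (\<lambda>\<omega>. (Y \<omega> $ j - real_cond_exp M G (\<lambda>\<omega>'. Y \<omega>' $ j) \<omega>)
           * (Y \<omega> $ k - real_cond_exp M G (\<lambda>\<omega>'. Y \<omega>' $ k) \<omega>)) \<omega> \<partial>M)"

end

theory Submission
  imports Defs
begin

text \<open>Write \<open>Y\<^sub>i = t \<bullet> a (W\<^sub>i)\<close>. Conditionally on \<open>F\<^sub>n\<close> the groups are independent and the weights of a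
  group sum to zero, so the conditional characteristic function is a product over the groups, and a
  second-order expansion of the factors gives \<open>exp (- v\<^sub>n / 2)\<close> with \<open>v\<^sub>n\<close> a multiple of the
  within-group dispersion \<open>Q\<^sub>n(Y) = (1/n) \<Sum>\<^sub>s \<Sum>\<^sub>i\<^sub>j (Y\<^sub>i - Y\<^sub>j)\<^sup>2\<close>; the error is controlled by \<open>max |Y\<^sub>i| / sqrt n\<close>,
  which vanishes in probability as \<open>Y\<close> is square integrable.

  To find the limit of \<open>Q\<^sub>n(Y)\<close>, split \<open>Y = u + h(\<psi>) + r\<close> with \<open>u\<close> bounded and centred given \<open>\<psi>\<close>, \<open>h\<close> Lipschitz
  and \<open>r\<close> small in mean square. The second term is negligible because the groups are tight in \<open>\<psi>\<close>. In
  \<open>Q\<^sub>n(u)\<close> the cross terms within groups are orthogonal, because the partition depends on the sample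
  only through \<open>\<psi>\<close> and \<open>\<pi>\<close>; what remains is the law of large numbers for \<open>u\<^sup>2\<close>.\<close>

section \<open>Random treatment of a group\<close>

definition subsets_of_card :: "nat \<Rightarrow> 'a set \<Rightarrow> 'a set set" where
  "subsets_of_card l s = {T. T \<subseteq> s \<and> card T = l}"

lemma finite_subsets_of_card [simp]: "finite s \<Longrightarrow> finite (subsets_of_card l s)"
  by (simp add: subsets_of_card_def)

lemma card_subsets_of_card: "finite s \<Longrightarrow> card (subsets_of_card l s) = card s choose l"
  by (simp add: subsets_of_card_def n_subsets)

lemma card_subsets_containing:
  assumes "finite s" "i \<in> s" "1 \<le> l"
  shows "card {T \<in> subsets_of_card l s. i \<in> T} = (card s - 1) choose (l - 1)"
proof -
  have "bij_betw (insert i) (subsets_of_card (l - 1) (s - {i})) {T \<in> subsets_of_card l s. i \<in> T}"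
  proof (rule bij_betw_byWitness[where f' = "\<lambda>T. T - {i}"])
    show "insert i ` subsets_of_card (l - 1) (s - {i}) \<subseteq> {T \<in> subsets_of_card l s. i \<in> T}"
    proof
      fix T assume "T \<in> insert i ` subsets_of_card (l - 1) (s - {i})"
      then obtain U where U: "T = insert i U" "U \<subseteq> s - {i}" "card U = l - 1"
        by (auto simp: subsets_of_card_def)
      moreover have "finite U" using U assms finite_subset by blast
      moreover have "i \<notin> U" using U by auto
      ultimately show "T \<in> {T \<in> subsets_of_card l s. i \<in> T}"
        using assms by (auto simp: subsets_of_card_def)
    qed
  qed (use assms in \<open>auto simp: subsets_of_card_def card_Diff_singleton\<close>)
  then have "card {T \<in> subsets_of_card l s. i \<in> T} = card (subsets_of_card (l - 1) (s - {i}))"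
    by (simp add: bij_betw_same_card)
  then show ?thesis using assms by (simp add: card_subsets_of_card)
qed

lemma card_subsets_separating:
  assumes "finite s" "i \<in> s" "j \<in> s" "i \<noteq> j" "1 \<le> l"
  shows "card {T \<in> subsets_of_card l s. i \<in> T \<and> j \<notin> T} = (card s - 2) choose (l - 1)"
proof -
  have "{T \<in> subsets_of_card l s. i \<in> T \<and> j \<notin> T} = {T \<in> subsets_of_card l (s - {j}). i \<in> T}"
    by (auto simp: subsets_of_card_def)
  moreover have "card (s - {j}) - 1 = card s - 2"
    using assms by (simp add: card_Diff_singleton)
  ultimately show ?thesis
    using card_subsets_containing[of "s - {j}" i l] assms by simp
qed

lemma sigD2_pos:
  assumes "1 \<le> l" "l < k" shows "sigD2 l k > 0"
  using assms by (simp add: sigD2_def)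

lemma sum_Hval_units:
  assumes "finite s" "T \<in> subsets_of_card l s" "card s = k" "0 < k"
  shows "(\<Sum>i\<in>s. Hval l k (i \<in> T)) = 0"
proof -
  have "(\<Sum>i\<in>s. of_bool (i \<in> T) :: real) = real l"
  proof -
    have "(\<Sum>i\<in>s. of_bool (i \<in> T) :: real) = (\<Sum>i\<in>{i\<in>s. i \<in> T}. 1)"
      using assms by (intro sum.mono_neutral_cong_right) auto
    also have "{i\<in>s. i \<in> T} = T" using assms by (auto simp: subsets_of_card_def)
    finally show ?thesis using assms by (simp add: subsets_of_card_def)
  qed
  then have "(\<Sum>i\<in>s. of_bool (i \<in> T) - real l / real k) = 0"
    using assms by (simp add: sum_subtractf)
  then show ?thesis unfolding Hval_def by (simp flip: sum_divide_distrib)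
qed

lemma sum_of_bool_containing:
  assumes "finite s" "i \<in> s" "1 \<le> l" "card s = k"
  shows "(\<Sum>T\<in>subsets_of_card l s. of_bool (i \<in> T) :: real) = real (k choose l) * (real l / real k)"
proof -
  have k: "0 < k" using assms card_gt_0_iff by blast
  have "(\<Sum>T\<in>subsets_of_card l s. of_bool (i \<in> T) :: real) = (\<Sum>T\<in>{T \<in> subsets_of_card l s. i \<in> T}. 1)"
    using assms by (intro sum.mono_neutral_cong_right) auto
  also have "\<dots> = real ((k - 1) choose (l - 1))"
    using assms by (simp add: card_subsets_containing)
  also have "\<dots> = real (k choose l) * (real l / real k)"
  proof -
    have "l * (k choose l) = k * ((k - 1) choose (l - 1))"
      using assms by (intro times_binomial_minus1_eq) auto
    then have "real l * real (k choose l) = real k * real ((k - 1) choose (l - 1))"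
      by (metis of_nat_mult)
    then show ?thesis using k by (simp add: field_simps)
  qed
  finally show ?thesis .
qed

lemma sum_of_bool_separating:
  assumes "finite s" "i \<in> s" "j \<in> s" "i \<noteq> j" "1 \<le> l" "l < k" "card s = k"
  shows "(\<Sum>T\<in>subsets_of_card l s. of_bool (i \<in> T \<and> j \<notin> T) :: real)
    = real (k choose l) * sigD2 l k * (real k / (real k - 1))"
proof -
  have "(\<Sum>T\<in>subsets_of_card l s. of_bool (i \<in> T \<and> j \<notin> T) :: real)
      = (\<Sum>T\<in>{T \<in> subsets_of_card l s. i \<in> T \<and> j \<notin> T}. 1)"
    using assms by (intro sum.mono_neutral_cong_right) auto
  also have "\<dots> = real ((k - 2) choose (l - 1))"
    using assms by (simp add: card_subsets_separating)
  also have "\<dots> = real (k choose l) * sigD2 l k * (real k / (real k - 1))"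
  proof -
    have "l * (k choose l) = k * ((k - 1) choose (l - 1))"
      using assms by (intro times_binomial_minus1_eq) auto
    then have 1: "real l * real (k choose l) = real k * real ((k - 1) choose (l - 1))"
      by (metis of_nat_mult)
    have "(k - 1 - (l - 1)) * ((k - 1) choose (l - 1)) = (k - 1) * ((k - 1 - 1) choose (l - 1))"
      by (rule binomial_absorb_comp)
    moreover have "k - 1 - (l - 1) = k - l" "k - 1 - 1 = k - 2" using assms by auto
    ultimately have "real (k - l) * real ((k - 1) choose (l - 1)) = real (k - 1) * real ((k - 2) choose (l - 1))"
      by (metis of_nat_mult)
    then have 2: "(real k - real l) * real ((k - 1) choose (l - 1)) = (real k - 1) * real ((k - 2) choose (l - 1))"
      using assms by (simp add: of_nat_diff)
    have k: "real k > 1" using assms by simp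
    have "real ((k - 2) choose (l - 1)) = (real k - real l) * real ((k - 1) choose (l - 1)) / (real k - 1)"
      using 2 k by (simp add: field_simps)
    moreover have "real ((k - 1) choose (l - 1)) = real l * real (k choose l) / real k"
      using 1 k by (simp add: field_simps)
    ultimately have "real ((k - 2) choose (l - 1)) = (real k - real l) * (real l * real (k choose l) / real k) / (real k - 1)"
      by simp
    also have "\<dots> = real (k choose l) * sigD2 l k * (real k / (real k - 1))"
      using k unfolding sigD2_def by (simp add: field_simps)
    finally show ?thesis .
  qed
  finally show ?thesis .
qed

lemma sum_Hval_subsets:
  assumes "finite s" "i \<in> s" "1 \<le> l" "card s = k"
  shows "(\<Sum>T\<in>subsets_of_card l s. Hval l k (i \<in> T)) = 0"
proof -
  have "(\<Sum>T\<in>subsets_of_card l s. of_bool (i \<in> T) - real l / real k) = 0"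
    unfolding sum_subtractf sum_of_bool_containing[OF assms] using assms by (simp add: card_subsets_of_card)
  then show ?thesis unfolding Hval_def by (simp flip: sum_divide_distrib)
qed

lemma sum_Hval_mult_subsets:
  assumes "finite s" "i \<in> s" "j \<in> s" "i \<noteq> j" "1 \<le> l" "l < k" "card s = k"
  shows "(\<Sum>T\<in>subsets_of_card l s. Hval l k (i \<in> T) * Hval l k (j \<in> T))
    = - real (k choose l) / (sigD2 l k * (real k - 1))"
proof -
  define p where "p = real l / real k"
  define N where "N = real (k choose l)"
  have sig: "sigD2 l k = p * (1 - p)" by (simp add: sigD2_def p_def)
  have sp: "sigD2 l k > 0" using assms sigD2_pos by blast
  have k: "real k > 1" using assms by simp
  have eq: "(of_bool (i \<in> T) - p) * (of_bool (j \<in> T) - p)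
     = of_bool (i \<in> T) * (1 - p) - of_bool (i \<in> T \<and> j \<notin> T) - p * of_bool (j \<in> T) + p * p" for T
    by (auto simp: algebra_simps)
  have "(\<Sum>T\<in>subsets_of_card l s. (of_bool (i \<in> T) - p) * (of_bool (j \<in> T) - p))
      = N * p * (1 - p) - N * sigD2 l k * (real k / (real k - 1)) - p * (N * p) + N * (p * p)"
    unfolding eq sum.distrib sum_subtractf
    unfolding sum_distrib_left[symmetric] sum_distrib_right[symmetric]
      sum_of_bool_separating[OF assms] sum_of_bool_containing[OF assms(1,2,5,7)] sum_of_bool_containing[OF assms(1,3,5,7)]
    using assms by (simp add: card_subsets_of_card N_def p_def)
  also have "\<dots> = N * sigD2 l k * (1 - real k / (real k - 1))"
    unfolding sig by (simp add: algebra_simps)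
  also have "\<dots> = - N * sigD2 l k / (real k - 1)"
    using k by (simp add: field_simps)
  finally have *: "(\<Sum>T\<in>subsets_of_card l s. (of_bool (i \<in> T) - p) * (of_bool (j \<in> T) - p))
      = - N * sigD2 l k / (real k - 1)" .
  have "(\<Sum>T\<in>subsets_of_card l s. Hval l k (i \<in> T) * Hval l k (j \<in> T))
     = (\<Sum>T\<in>subsets_of_card l s. (of_bool (i \<in> T) - p) * (of_bool (j \<in> T) - p)) / (sigD2 l k * sigD2 l k)"
    unfolding Hval_def p_def by (simp add: sum_divide_distrib)
  also have "\<dots> = - N / (sigD2 l k * (real k - 1))"
    unfolding * using sp k by (simp add: field_simps)
  finally show ?thesis by (simp add: N_def)
qed

text \<open>Reduces the variance of a group sum to the covariances of distinct units.\<close>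

lemma square_sum_zero_weights:
  fixes h y :: "'a \<Rightarrow> real"
  assumes "(\<Sum>i\<in>s. h i) = 0"
  shows "(\<Sum>i\<in>s. h i * y i)\<^sup>2 = - (1/2) * (\<Sum>i\<in>s. \<Sum>j\<in>s. h i * h j * (y i - y j)\<^sup>2)"
proof -
  have eq: "h i * h j * (y i - y j)\<^sup>2 = h j * (h i * (y i)\<^sup>2) + h i * (h j * (y j)\<^sup>2) - 2 * ((h i * y i) * (h j * y j))" for i j
    by (simp add: power2_eq_square algebra_simps)
  have "(\<Sum>i\<in>s. \<Sum>j\<in>s. h i * h j * (y i - y j)\<^sup>2)
     = (\<Sum>i\<in>s. h i * (y i)\<^sup>2) * (\<Sum>j\<in>s. h j) + (\<Sum>i\<in>s. h i) * (\<Sum>j\<in>s. h j * (y j)\<^sup>2)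
        - 2 * ((\<Sum>i\<in>s. h i * y i) * (\<Sum>j\<in>s. h j * y j))"
    unfolding eq sum.distrib sum_subtractf sum_distrib_left[symmetric] sum_distrib_right[symmetric]
    by (simp add: mult_ac)
  then show ?thesis using assms by (simp add: power2_eq_square)
qed

lemma sum_square_Hval_subsets:
  fixes y :: "'a \<Rightarrow> real"
  assumes "finite s" "1 \<le> l" "l < k" "card s = k"
  shows "(\<Sum>T\<in>subsets_of_card l s. (\<Sum>i\<in>s. Hval l k (i \<in> T) * y i)\<^sup>2)
    = real (k choose l) * (\<Sum>i\<in>s. \<Sum>j\<in>s. (y i - y j)\<^sup>2) / (2 * sigD2 l k * (real k - 1))"
proof -
  have "(\<Sum>T\<in>subsets_of_card l s. (\<Sum>i\<in>s. Hval l k (i \<in> T) * y i)\<^sup>2)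
    = (\<Sum>T\<in>subsets_of_card l s. - (1/2) * (\<Sum>i\<in>s. \<Sum>j\<in>s. Hval l k (i \<in> T) * Hval l k (j \<in> T) * (y i - y j)\<^sup>2))"
    using assms by (intro sum.cong refl square_sum_zero_weights sum_Hval_units) auto
  also have "\<dots> = - (1/2) * (\<Sum>i\<in>s. \<Sum>j\<in>s. (\<Sum>T\<in>subsets_of_card l s. Hval l k (i \<in> T) * Hval l k (j \<in> T)) * (y i - y j)\<^sup>2)"
    unfolding sum_distrib_left[symmetric] sum_distrib_right
    by (subst sum.swap, rule arg_cong[where f="\<lambda>x. _ * x"], rule sum.cong[OF refl], rule sum.swap)
  also have "\<dots> = - (1/2) * (\<Sum>i\<in>s. \<Sum>j\<in>s. - real (k choose l) / (sigD2 l k * (real k - 1)) * (y i - y j)\<^sup>2)"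
  proof (intro arg_cong[where f="\<lambda>x. _ * x"] sum.cong refl)
    fix i j assume "i \<in> s" "j \<in> s"
    then show "(\<Sum>T\<in>subsets_of_card l s. Hval l k (i \<in> T) * Hval l k (j \<in> T)) * (y i - y j)\<^sup>2
      = - real (k choose l) / (sigD2 l k * (real k - 1)) * (y i - y j)\<^sup>2"
      using assms by (cases "i = j") (auto simp: sum_Hval_mult_subsets)
  qed
  also have "\<dots> = real (k choose l) * (\<Sum>i\<in>s. \<Sum>j\<in>s. (y i - y j)\<^sup>2) / (2 * sigD2 l k * (real k - 1))"
    unfolding sum_distrib_left[symmetric] by (simp add: mult_ac)
  finally show ?thesis .
qed

lemma abs_Hval_le:
  assumes "1 \<le> l" "l < k"
  shows "\<bar>Hval l k b\<bar> \<le> 1 / sigD2 l k"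
  using assms sigD2_pos[OF assms] by (cases b) (auto simp: Hval_def abs_divide divide_right_mono field_simps)

lemma exp_minus_linear_bound:
  fixes x :: real
  assumes "0 \<le> x" shows "\<bar>exp (- x) - (1 - x)\<bar> \<le> x\<^sup>2 / 2"
proof -
  have lower: "1 - x \<le> exp (- x)" using exp_ge_add_one_self[of "- x"] by simp
  have q: "1 + x + x\<^sup>2 / 2 \<le> exp x" by (rule exp_lower_Taylor_quadratic[OF assms])
  have pos: "1 + x + x\<^sup>2 / 2 > 0" using assms by (simp add: add_pos_nonneg)
  have "exp (- x) \<le> 1 / (1 + x + x\<^sup>2 / 2)"
    using q pos by (simp add: exp_minus inverse_eq_divide frac_le)
  also have "\<dots> \<le> 1 - x + x\<^sup>2 / 2"
  proof -
    have "1 \<le> 1 + x ^ 4 / 4" by simp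
    also have "\<dots> = (1 - x + x\<^sup>2 / 2) * (1 + x + x\<^sup>2 / 2)"
      by (simp add: algebra_simps power2_eq_square power4_eq_xxxx)
    finally show ?thesis using pos by (simp add: divide_le_eq)
  qed
  finally show ?thesis using lower by simp
qed

lemma cis_quadratic_bound:
  "cmod (cis x - (1 + \<i> * of_real x - of_real (x\<^sup>2) / 2)) \<le> \<bar>x\<bar> ^ 3 / 6"
proof -
  have "(\<Sum>k\<le>2. (\<i> * of_real x)^k / fact k) = 1 + \<i> * of_real x - of_real (x\<^sup>2) / 2"
    by (simp add: numeral_2_eq_2 complex_eq_iff)
  moreover have "fact (Suc 2) = (6::real)" by (simp add: numeral_2_eq_2)
  ultimately show ?thesis
    using iexp_approx1[of x 2] by (simp add: cis_conv_exp numeral_3_eq_3 numeral_2_eq_2)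
qed

lemma average_cis_bound:
  fixes z :: "'a \<Rightarrow> real"
  assumes "finite I" "I \<noteq> {}" and zero: "(\<Sum>i\<in>I. z i) = 0" and B: "\<And>i. i \<in> I \<Longrightarrow> \<bar>z i\<bar> \<le> B"
  defines "v \<equiv> (\<Sum>i\<in>I. (z i)\<^sup>2) / real (card I)"
  shows "cmod ((\<Sum>i\<in>I. cis (z i)) / of_nat (card I) - of_real (exp (- v / 2))) \<le> (B / 6 + B\<^sup>2 / 8) * v"
proof -
  have N: "real (card I) > 0" using assms by (simp add: card_gt_0_iff)
  have v0: "v \<ge> 0" unfolding v_def by (simp add: sum_nonneg)
  have B0: "B \<ge> 0" using B assms(2) by fastforce
  have vB: "v \<le> B\<^sup>2"
  proof -
    have "(\<Sum>i\<in>I. (z i)\<^sup>2) \<le> (\<Sum>i\<in>I. B\<^sup>2)"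
      using B by (intro sum_mono) (metis abs_ge_zero power2_abs power_mono)
    then show ?thesis using N by (simp add: v_def divide_le_eq mult.commute)
  qed
  have "(\<Sum>i\<in>I. 1 + \<i> * of_real (z i) - of_real ((z i)\<^sup>2) / 2)
      = of_nat (card I) + \<i> * of_real (\<Sum>i\<in>I. z i) - of_real (\<Sum>i\<in>I. (z i)\<^sup>2) / 2"
    by (simp add: sum.distrib sum_subtractf sum_distrib_left sum_divide_distrib)
  also have "\<dots> = of_nat (card I) * (1 - of_real v / 2)"
    using N unfolding zero by (simp add: v_def field_simps)
  finally have S: "(\<Sum>i\<in>I. 1 + \<i> * of_real (z i) - of_real ((z i)\<^sup>2) / 2) = of_nat (card I) * (1 - of_real v / 2)" .
  have "cmod ((\<Sum>i\<in>I. cis (z i)) - of_nat (card I) * (1 - of_real v / 2))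
     = cmod (\<Sum>i\<in>I. cis (z i) - (1 + \<i> * of_real (z i) - of_real ((z i)\<^sup>2) / 2))"
    by (subst S[symmetric]) (simp only: sum_subtractf)
  also have "\<dots> \<le> (\<Sum>i\<in>I. \<bar>z i\<bar> ^ 3 / 6)"
    by (rule sum_norm_le[OF cis_quadratic_bound])
  also have "\<dots> \<le> (\<Sum>i\<in>I. B / 6 * (z i)\<^sup>2)"
  proof (rule sum_mono)
    fix i assume "i \<in> I"
    have "\<bar>z i\<bar> ^ 3 = \<bar>z i\<bar> * (z i)\<^sup>2" by (simp add: power3_eq_cube power2_eq_square)
    also have "\<dots> \<le> B * (z i)\<^sup>2" by (rule mult_right_mono) (use B \<open>i \<in> I\<close> in auto)
    finally show "\<bar>z i\<bar> ^ 3 / 6 \<le> B / 6 * (z i)\<^sup>2" by simp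
  qed
  also have "\<dots> = real (card I) * (B / 6 * v)"
    unfolding sum_distrib_left[symmetric] using N by (simp add: v_def)
  finally have A: "cmod ((\<Sum>i\<in>I. cis (z i)) - of_nat (card I) * (1 - of_real v / 2)) \<le> real (card I) * (B / 6 * v)" .
  have "(\<Sum>i\<in>I. cis (z i)) / of_nat (card I) - (1 - of_real v / 2)
     = ((\<Sum>i\<in>I. cis (z i)) - of_nat (card I) * (1 - of_real v / 2)) / of_nat (card I)"
    using N by (simp add: field_simps)
  then have A': "cmod ((\<Sum>i\<in>I. cis (z i)) / of_nat (card I) - (1 - of_real v / 2)) \<le> B / 6 * v"
    using A N by (simp add: norm_divide divide_le_eq mult.commute)
  have "\<bar>exp (- (v / 2)) - (1 - v / 2)\<bar> \<le> (v / 2)\<^sup>2 / 2"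
    using v0 by (intro exp_minus_linear_bound) auto
  also have "\<dots> \<le> B\<^sup>2 / 8 * v"
    using mult_right_mono[OF vB v0] by (simp add: power2_eq_square)
  finally have "\<bar>(1 - v / 2) - exp (- v / 2)\<bar> \<le> B\<^sup>2 / 8 * v" by (simp add: abs_minus_commute)
  moreover have "cmod ((1 - of_real v / 2) - of_real (exp (- v / 2))) = \<bar>(1 - v / 2) - exp (- v / 2)\<bar>"
  proof -
    have "(1 - of_real v / 2) - of_real (exp (- v / 2)) = complex_of_real ((1 - v / 2) - exp (- v / 2))"
      by simp
    then show ?thesis by (simp only: norm_of_real)
  qed
  ultimately have C: "cmod ((1 - of_real v / 2) - of_real (exp (- v / 2))) \<le> B\<^sup>2 / 8 * v" by simp
  show ?thesis using norm_triangle_le[OF add_mono[OF A' C]] by (simp add: algebra_simps)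
qed

lemma prod_group_cis_bound:
  fixes y :: "'a \<Rightarrow> real" and c b :: real
  assumes "finite P" and fin: "\<And>s. s \<in> P \<Longrightarrow> finite s \<and> card s = k" and lk: "1 \<le> l" "l < k"
    and c: "c \<ge> 0" and b: "\<And>s i. s \<in> P \<Longrightarrow> i \<in> s \<Longrightarrow> \<bar>y i\<bar> \<le> b" "0 \<le> b"
  defines "B \<equiv> c * (real k * (b / sigD2 l k))"
    and "v \<equiv> c\<^sup>2 * (\<Sum>s\<in>P. \<Sum>i\<in>s. \<Sum>j\<in>s. (y i - y j)\<^sup>2) / (2 * sigD2 l k * (real k - 1))"
  shows "cmod ((\<Prod>s\<in>P. (\<Sum>T\<in>subsets_of_card l s. cis (c * (\<Sum>i\<in>s. Hval l k (i \<in> T) * y i))) / of_nat (k choose l))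
      - of_real (exp (- v / 2))) \<le> (B / 6 + B\<^sup>2 / 8) * v"
proof -
  define f where "f s = (\<Sum>T\<in>subsets_of_card l s. cis (c * (\<Sum>i\<in>s. Hval l k (i \<in> T) * y i))) / of_nat (k choose l)" for s
  define w where "w s = c\<^sup>2 * (\<Sum>i\<in>s. \<Sum>j\<in>s. (y i - y j)\<^sup>2) / (2 * sigD2 l k * (real k - 1))" for s
  have sp: "sigD2 l k > 0" using lk sigD2_pos by blast
  have kl: "real (k choose l) > 0" using lk by (simp add: zero_less_binomial)
  have w0: "w s \<ge> 0" for s
    unfolding w_def using sp lk by (intro divide_nonneg_nonneg mult_nonneg_nonneg sum_nonneg) auto
  have v: "v = (\<Sum>s\<in>P. w s)" unfolding v_def w_def by (simp add: sum_distrib_left sum_divide_distrib)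
  have bd: "cmod (f s - of_real (exp (- w s / 2))) \<le> (B / 6 + B\<^sup>2 / 8) * w s" if s: "s \<in> P" for s
  proof -
    have fs: "finite s" "card s = k" using fin s by auto
    have ne: "subsets_of_card l s \<noteq> {}"
      using card_subsets_of_card[OF fs(1), of l] fs kl by auto
    have zero: "(\<Sum>T\<in>subsets_of_card l s. c * (\<Sum>i\<in>s. Hval l k (i \<in> T) * y i)) = 0"
    proof -
      have "(\<Sum>T\<in>subsets_of_card l s. \<Sum>i\<in>s. Hval l k (i \<in> T) * y i)
         = (\<Sum>i\<in>s. (\<Sum>T\<in>subsets_of_card l s. Hval l k (i \<in> T)) * y i)"
        unfolding sum_distrib_right by (rule sum.swap)
      also have "\<dots> = 0" using fs lk by (intro sum.neutral) (simp add: sum_Hval_subsets)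
      finally show ?thesis by (simp flip: sum_distrib_left)
    qed
    have Bs: "\<bar>c * (\<Sum>i\<in>s. Hval l k (i \<in> T) * y i)\<bar> \<le> B" for T
    proof -
      have "\<bar>\<Sum>i\<in>s. Hval l k (i \<in> T) * y i\<bar> \<le> (\<Sum>i\<in>s. 1 / sigD2 l k * b)"
        unfolding abs_mult using b s sp
        by (intro order_trans[OF sum_abs] sum_mono) (auto simp only: abs_mult intro!: mult_mono abs_Hval_le lk, auto)
      also have "\<dots> = real k * (b / sigD2 l k)" using fs by simp
      finally have "\<bar>\<Sum>i\<in>s. Hval l k (i \<in> T) * y i\<bar> \<le> real k * (b / sigD2 l k)" .
      from mult_left_mono[OF this c] show ?thesis using c by (simp add: B_def abs_mult)
    qed
    have "(\<Sum>T\<in>subsets_of_card l s. (c * (\<Sum>i\<in>s. Hval l k (i \<in> T) * y i))\<^sup>2) / real (card (subsets_of_card l s)) = w s"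
      using sum_square_Hval_subsets[OF fs(1) lk fs(2), of y] fs kl
      by (simp add: power_mult_distrib sum_distrib_left[symmetric] card_subsets_of_card w_def)
    then show ?thesis
      using average_cis_bound[OF _ ne zero Bs] fs by (simp add: f_def card_subsets_of_card)
  qed
  have nf: "cmod (f s) \<le> 1" if s: "s \<in> P" for s
  proof -
    have fs: "finite s" "card s = k" using fin s by auto
    have "cmod (\<Sum>T\<in>subsets_of_card l s. cis (c * (\<Sum>i\<in>s. Hval l k (i \<in> T) * y i))) \<le> (\<Sum>T\<in>subsets_of_card l s. 1)"
      by (rule sum_norm_le) simp
    then show ?thesis using fs kl by (simp add: f_def card_subsets_of_card norm_divide divide_le_eq)
  qed
  have e: "of_real (exp (- v / 2)) = (\<Prod>s\<in>P. complex_of_real (exp (- w s / 2)))"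
  proof -
    have "exp (- v / 2) = exp (\<Sum>s\<in>P. - w s / 2)"
      unfolding v by (simp add: sum_negf sum_divide_distrib)
    then show ?thesis using \<open>finite P\<close> by (simp add: exp_sum)
  qed
  have "cmod ((\<Prod>s\<in>P. f s) - of_real (exp (- v / 2))) \<le> (\<Sum>s\<in>P. cmod (f s - of_real (exp (- w s / 2))))"
    unfolding e using nf w0 by (intro norm_prod_diff) auto
  also have "\<dots> \<le> (\<Sum>s\<in>P. (B / 6 + B\<^sup>2 / 8) * w s)" by (rule sum_mono[OF bd])
  also have "\<dots> = (B / 6 + B\<^sup>2 / 8) * v" by (simp add: v sum_distrib_left)
  finally show ?thesis by (simp add: f_def)
qed

lemma sum_partition_on:
  assumes "partition_on A P" "finite A"
  shows "(\<Sum>s\<in>P. \<Sum>i\<in>s. g i) = (\<Sum>i\<in>A. g i)"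
proof -
  have "A = \<Union>P" using assms partition_onD1 by blast
  moreover have "\<forall>s\<in>P. finite s" using assms \<open>A = \<Union>P\<close> by (meson Union_upper finite_subset)
  moreover have "\<forall>s\<in>P. \<forall>s'\<in>P. s \<noteq> s' \<longrightarrow> s \<inter> s' = {}"
    using partition_onD2[OF assms(1)] by (auto simp: disjoint_def)
  ultimately show ?thesis by (simp add: sum.Union_disjoint)
qed

lemma sum_cis_partition:
  fixes y :: "'a \<Rightarrow> real" and H :: "bool \<Rightarrow> real"
  assumes P: "partition_on A P" "finite A"
  shows "(\<Sum>T | T \<subseteq> A \<and> (\<forall>s\<in>P. card (T \<inter> s) = l). cis (c * (\<Sum>i\<in>A. H (i \<in> T) * y i)))
    = (\<Prod>s\<in>P. \<Sum>T\<in>subsets_of_card l s. cis (c * (\<Sum>i\<in>s. H (i \<in> T) * y i)))"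
proof -
  have A: "A = \<Union>P" using P partition_onD1 by blast
  have finP: "finite P" using P finite_elements by blast
  have fin: "finite s" if "s \<in> P" for s using that A P(2) by (meson Union_upper finite_subset)
  have disj: "s = s'" if "s \<in> P" "s' \<in> P" "i \<in> s" "i \<in> s'" for s s' i
    using partition_onD2[OF P(1)] that by (auto simp: disjoint_def)
  define f where "f s T = cis (c * (\<Sum>i\<in>s. H (i \<in> T) * y i))" for s T
  have "(\<Prod>s\<in>P. \<Sum>T\<in>subsets_of_card l s. f s T) = (\<Sum>g\<in>PiE P (subsets_of_card l). \<Prod>s\<in>P. f s (g s))"
    using finP fin by (intro prod_sum_PiE) auto
  also have "\<dots> = (\<Sum>T | T \<subseteq> A \<and> (\<forall>s\<in>P. card (T \<inter> s) = l). cis (c * (\<Sum>i\<in>A. H (i \<in> T) * y i)))"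
  proof (rule sum.reindex_bij_witness[where i = "\<lambda>T. \<lambda>s\<in>P. T \<inter> s" and j = "\<lambda>g. \<Union>s\<in>P. g s"])
    fix g assume g: "g \<in> PiE P (subsets_of_card l)"
    have gs: "g s \<subseteq> s" "card (g s) = l" if "s \<in> P" for s
      using g that by (auto simp: subsets_of_card_def PiE_def Pi_def)
    have I: "(\<Union>s\<in>P. g s) \<inter> s = g s" if "s \<in> P" for s
      using gs that disj by blast
    show "(\<lambda>s\<in>P. (\<Union>s\<in>P. g s) \<inter> s) = g"
      using g I by (auto simp: fun_eq_iff PiE_def extensional_def)
    show "(\<Union>s\<in>P. g s) \<in> {T. T \<subseteq> A \<and> (\<forall>s\<in>P. card (T \<inter> s) = l)}"
      using I gs A by auto
    have "cis (c * (\<Sum>i\<in>A. H (i \<in> (\<Union>s\<in>P. g s)) * y i)) = cis (\<Sum>s\<in>P. c * (\<Sum>i\<in>s. H (i \<in> (\<Union>s\<in>P. g s)) * y i))"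
      by (simp add: sum_partition_on[OF P] flip: sum_distrib_left)
    also have "(\<Sum>s\<in>P. c * (\<Sum>i\<in>s. H (i \<in> (\<Union>s\<in>P. g s)) * y i)) = (\<Sum>s\<in>P. c * (\<Sum>i\<in>s. H (i \<in> g s) * y i))"
    proof (intro sum.cong refl arg_cong[where f="\<lambda>x. c * x"])
      fix s i assume "s \<in> P" "i \<in> s"
      then have "i \<in> (\<Union>s\<in>P. g s) \<longleftrightarrow> i \<in> g s" using I by blast
      then show "H (i \<in> (\<Union>s\<in>P. g s)) * y i = H (i \<in> g s) * y i" by simp
    qed
    also have "cis \<dots> = (\<Prod>s\<in>P. f s (g s))"
      unfolding f_def using finP by (simp add: cis_conv_exp exp_sum sum_distrib_left)
    finally show "cis (c * (\<Sum>i\<in>A. H (i \<in> (\<Union>s\<in>P. g s)) * y i)) = (\<Prod>s\<in>P. f s (g s))" .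
  next
    fix T assume T: "T \<in> {T. T \<subseteq> A \<and> (\<forall>s\<in>P. card (T \<inter> s) = l)}"
    show "(\<lambda>s\<in>P. T \<inter> s) \<in> PiE P (subsets_of_card l)"
      using T by (auto simp: subsets_of_card_def)
    show "(\<Union>s\<in>P. (\<lambda>s\<in>P. T \<inter> s) s) = T" using T A by auto
  qed
  finally show ?thesis by (simp add: f_def)
qed

section \<open>Density of Lipschitz functions\<close>

lemma cond_exp_square_le:
  fixes f :: "'a \<Rightarrow> real"
  assumes "prob_space M" "subalgebra M G" and [measurable]: "f \<in> borel_measurable M"
    and f2: "integrable M (\<lambda>x. (f x)\<^sup>2)"
  shows "integrable M f" "integrable M (\<lambda>x. (real_cond_exp M G f x)\<^sup>2)"
    "(\<integral>x. (real_cond_exp M G f x)\<^sup>2 \<partial>M) \<le> (\<integral>x. (f x)\<^sup>2 \<partial>M)"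
proof -
  interpret prob_space M by fact
  interpret finite_measure_subalgebra M G
    using assms by (simp add: finite_measure_subalgebra_def finite_measure_subalgebra_axioms_def finite_measure_axioms)
  show f: "integrable M f" using f2 by (rule square_integrable_imp_integrable[rotated]) measurable
  have conv: "convex_on UNIV (\<lambda>x::real. x\<^sup>2)" by (rule convex_power2)
  have J: "AE x in M. (real_cond_exp M G f x)\<^sup>2 \<le> real_cond_exp M G (\<lambda>x. (f x)\<^sup>2) x"
    by (rule real_cond_exp_jensens_inequality(2)[OF f _ _ f2 conv, of 0 0]) auto
  have I: "integrable M (real_cond_exp M G (\<lambda>x. (f x)\<^sup>2))" "(\<integral>x. real_cond_exp M G (\<lambda>x. (f x)\<^sup>2) x \<partial>M) = (\<integral>x. (f x)\<^sup>2 \<partial>M)"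
    using real_cond_exp_int[OF f2] by auto
  show i2: "integrable M (\<lambda>x. (real_cond_exp M G f x)\<^sup>2)"
    by (rule Bochner_Integration.integrable_bound[OF I(1)]) (use J in auto)
  show "(\<integral>x. (real_cond_exp M G f x)\<^sup>2 \<partial>M) \<le> (\<integral>x. (f x)\<^sup>2 \<partial>M)"
    using integral_mono_AE[OF i2 I(1) J] I(2) by simp
qed

lemma integrable_mult_of_squares:
  fixes f g :: "'a \<Rightarrow> real"
  assumes [measurable]: "f \<in> borel_measurable M" "g \<in> borel_measurable M"
    and "integrable M (\<lambda>x. (f x)\<^sup>2)" "integrable M (\<lambda>x. (g x)\<^sup>2)"
  shows "integrable M (\<lambda>x. f x * g x)"
proof (rule Bochner_Integration.integrable_bound[OF Bochner_Integration.integrable_add[OF assms(3,4)]])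
  show "AE x in M. norm (f x * g x) \<le> norm ((f x)\<^sup>2 + (g x)\<^sup>2)"
  proof (rule AE_I2)
    fix x
    have "2 * (\<bar>f x\<bar> * \<bar>g x\<bar>) \<le> (f x)\<^sup>2 + (g x)\<^sup>2"
      using sum_squares_bound[of "\<bar>f x\<bar>" "\<bar>g x\<bar>"] by (simp add: power2_abs)
    moreover have "0 \<le> \<bar>f x\<bar> * \<bar>g x\<bar>" by simp
    ultimately show "norm (f x * g x) \<le> norm ((f x)\<^sup>2 + (g x)\<^sup>2)"
      unfolding real_norm_def abs_mult by linarith
  qed
qed simp

lemma integrable_add_square:
  fixes f g :: "'a \<Rightarrow> real"
  assumes [measurable]: "f \<in> borel_measurable M" "g \<in> borel_measurable M"
    and "integrable M (\<lambda>x. (f x)\<^sup>2)" "integrable M (\<lambda>x. (g x)\<^sup>2)"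
  shows "integrable M (\<lambda>x. (f x + g x)\<^sup>2)"
proof -
  have "integrable M (\<lambda>x. (f x)\<^sup>2 + (g x)\<^sup>2 + 2 * (f x * g x))"
    using assms integrable_mult_of_squares[OF assms] by (intro Bochner_Integration.integrable_add integrable_mult_right)
  then show ?thesis by (simp add: power2_sum mult.assoc)
qed

lemma integrable_diff_square:
  fixes f g :: "'a \<Rightarrow> real"
  assumes [measurable]: "f \<in> borel_measurable M" "g \<in> borel_measurable M"
    and "integrable M (\<lambda>x. (f x)\<^sup>2)" "integrable M (\<lambda>x. (g x)\<^sup>2)"
  shows "integrable M (\<lambda>x. (f x - g x)\<^sup>2)"
  using integrable_add_square[of f M "\<lambda>x. - g x"] assms by simp

lemma square_add_le: "(a + b)\<^sup>2 \<le> 2 * a\<^sup>2 + 2 * (b::real)\<^sup>2"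
  using sum_squares_bound[of a b] by (simp add: power2_sum)

lemma abs_square_add_diff_le:
  fixes y e \<eta> :: real
  assumes "\<eta> > 0"
  shows "\<bar>(y + e)\<^sup>2 - y\<^sup>2\<bar> \<le> \<eta> * y\<^sup>2 + (1 + 1 / \<eta>) * e\<^sup>2"
proof -
  define r where "r = sqrt \<eta>"
  have r: "r > 0" "\<eta> = r\<^sup>2" using assms by (auto simp: r_def)
  have "2 * \<bar>r * y\<bar> * \<bar>e / r\<bar> \<le> (r * y)\<^sup>2 + (e / r)\<^sup>2"
    using sum_squares_bound[of "\<bar>r * y\<bar>" "\<bar>e / r\<bar>"] by (simp only: power2_abs)
  then have "2 * \<bar>y * e\<bar> \<le> \<eta> * y\<^sup>2 + e\<^sup>2 / \<eta>"
    using r by (simp add: abs_mult power_mult_distrib power_divide)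
  moreover have "\<bar>(y + e)\<^sup>2 - y\<^sup>2\<bar> \<le> 2 * \<bar>y * e\<bar> + e\<^sup>2"
  proof -
    have "(y + e)\<^sup>2 - y\<^sup>2 = 2 * (y * e) + e\<^sup>2" by (simp add: power2_sum)
    then show ?thesis using abs_triangle_ineq[of "2 * (y * e)" "e\<^sup>2"] by (simp add: abs_mult)
  qed
  ultimately show ?thesis by (simp add: algebra_simps)
qed

definition lipschitz_approximable :: "'a measure \<Rightarrow> ('a \<Rightarrow> 'b::metric_space) \<Rightarrow> ('a \<Rightarrow> real) \<Rightarrow> bool" where
  "lipschitz_approximable M Z f \<longleftrightarrow> (\<forall>\<delta>>0. \<exists>h L. (\<forall>x y. \<bar>h x - h y\<bar> \<le> L * dist x y) \<and>
     integrable M (\<lambda>\<omega>. (f \<omega> - h (Z \<omega>))\<^sup>2) \<and> (\<integral>\<omega>. (f \<omega> - h (Z \<omega>))\<^sup>2 \<partial>M) \<le> \<delta>)"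

lemma borel_measurable_of_lipschitz:
  fixes h :: "'b::metric_space \<Rightarrow> real"
  assumes "\<And>x y. \<bar>h x - h y\<bar> \<le> L * dist x y"
  shows "h \<in> borel_measurable borel"
proof (rule borel_measurable_continuous_onI)
  have "(max L 0)-lipschitz_on UNIV h"
  proof (rule lipschitz_onI)
    fix x y :: 'b
    have "\<bar>h x - h y\<bar> \<le> L * dist x y" by (rule assms)
    also have "\<dots> \<le> max L 0 * dist x y" by (rule mult_right_mono) auto
    finally show "dist (h x) (h y) \<le> max L 0 * dist x y" by (simp add: dist_real_def)
  qed simp
  then show "continuous_on UNIV h" by (rule lipschitz_on_continuous_on)
qed

lemma (in prob_space) lipschitz_approximable_trans:
  fixes Z :: "'a \<Rightarrow> 'b::metric_space"
  assumes Z[measurable]: "Z \<in> borel_measurable M" and [measurable]: "f \<in> borel_measurable M"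
    and approx: "\<And>\<delta>. \<delta> > 0 \<Longrightarrow> \<exists>g. g \<in> borel_measurable M \<and> integrable M (\<lambda>\<omega>. (f \<omega> - g \<omega>)\<^sup>2)
      \<and> (\<integral>\<omega>. (f \<omega> - g \<omega>)\<^sup>2 \<partial>M) \<le> \<delta> \<and> lipschitz_approximable M Z g"
  shows "lipschitz_approximable M Z f"
  unfolding lipschitz_approximable_def
proof (intro allI impI)
  fix \<delta> :: real assume "\<delta> > 0"
  obtain g where g: "g \<in> borel_measurable M" "integrable M (\<lambda>\<omega>. (f \<omega> - g \<omega>)\<^sup>2)"
      "(\<integral>\<omega>. (f \<omega> - g \<omega>)\<^sup>2 \<partial>M) \<le> \<delta> / 4" "lipschitz_approximable M Z g"
    using approx[of "\<delta> / 4"] \<open>\<delta> > 0\<close> by auto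
  note [measurable] = g(1)
  obtain h L where h: "\<And>x y. \<bar>h x - h y\<bar> \<le> L * dist x y" "integrable M (\<lambda>\<omega>. (g \<omega> - h (Z \<omega>))\<^sup>2)"
      "(\<integral>\<omega>. (g \<omega> - h (Z \<omega>))\<^sup>2 \<partial>M) \<le> \<delta> / 4"
    using g(4) \<open>\<delta> > 0\<close> unfolding lipschitz_approximable_def by (meson divide_pos_pos zero_less_numeral)
  have [measurable]: "h \<in> borel_measurable borel" using h(1) by (rule borel_measurable_of_lipschitz)
  have eq: "f \<omega> - h (Z \<omega>) = (f \<omega> - g \<omega>) + (g \<omega> - h (Z \<omega>))" for \<omega> by simp
  have I: "integrable M (\<lambda>\<omega>. (f \<omega> - h (Z \<omega>))\<^sup>2)"
    unfolding eq by (rule integrable_add_square) (use g h in auto)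
  have "(\<integral>\<omega>. (f \<omega> - h (Z \<omega>))\<^sup>2 \<partial>M) \<le> (\<integral>\<omega>. 2 * (f \<omega> - g \<omega>)\<^sup>2 + 2 * (g \<omega> - h (Z \<omega>))\<^sup>2 \<partial>M)"
    unfolding eq
    by (rule integral_mono[OF I[unfolded eq] _ square_add_le])
       (use g h in \<open>intro Bochner_Integration.integrable_add integrable_mult_right\<close>)
  also have "\<dots> \<le> \<delta>" using g h by simp
  finally show "\<exists>h L. (\<forall>x y. \<bar>h x - h y\<bar> \<le> L * dist x y) \<and>
     integrable M (\<lambda>\<omega>. (f \<omega> - h (Z \<omega>))\<^sup>2) \<and> (\<integral>\<omega>. (f \<omega> - h (Z \<omega>))\<^sup>2 \<partial>M) \<le> \<delta>"
    using h(1) I by blast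
qed

lemma (in prob_space) lipschitz_approximable_limit:
  fixes Z :: "'a \<Rightarrow> 'b::metric_space"
  assumes Z[measurable]: "Z \<in> borel_measurable M" and f[measurable]: "f \<in> borel_measurable M"
    and g[measurable]: "\<And>i. g i \<in> borel_measurable M"
    and lim: "\<And>\<omega>. \<omega> \<in> space M \<Longrightarrow> (\<lambda>i. g i \<omega>) \<longlonglongrightarrow> f \<omega>"
    and bound: "\<And>i \<omega>. \<omega> \<in> space M \<Longrightarrow> \<bar>f \<omega> - g i \<omega>\<bar> \<le> w \<omega>" and w: "integrable M (\<lambda>\<omega>. (w \<omega>)\<^sup>2)"
    and approx: "\<And>i. lipschitz_approximable M Z (g i)"
  shows "lipschitz_approximable M Z f"
proof (rule lipschitz_approximable_trans[OF Z f])
  fix \<delta> :: real assume "\<delta> > 0"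
  have b: "norm ((f \<omega> - g i \<omega>)\<^sup>2) \<le> (w \<omega>)\<^sup>2" if "\<omega> \<in> space M" for i \<omega>
    using bound[OF that, of i] power_mono[of "\<bar>f \<omega> - g i \<omega>\<bar>" "w \<omega>" 2] by (simp add: power2_abs)
  have I: "integrable M (\<lambda>\<omega>. (f \<omega> - g i \<omega>)\<^sup>2)" for i
    by (rule Bochner_Integration.integrable_bound[OF w]) (use b in auto)
  have "(\<lambda>i. \<integral>\<omega>. (f \<omega> - g i \<omega>)\<^sup>2 \<partial>M) \<longlonglongrightarrow> (\<integral>\<omega>. 0 \<partial>M)"
  proof (rule integral_dominated_convergence[OF _ _ w])
    show "AE \<omega> in M. (\<lambda>i. (f \<omega> - g i \<omega>)\<^sup>2) \<longlonglongrightarrow> 0"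
    proof (rule AE_I2)
      fix \<omega> assume "\<omega> \<in> space M"
      then have "(\<lambda>i. (f \<omega> - g i \<omega>)\<^sup>2) \<longlonglongrightarrow> (f \<omega> - f \<omega>)\<^sup>2"
        by (intro tendsto_intros lim)
      then show "(\<lambda>i. (f \<omega> - g i \<omega>)\<^sup>2) \<longlonglongrightarrow> 0" by simp
    qed
  qed (use b in auto)
  then have "eventually (\<lambda>i. (\<integral>\<omega>. (f \<omega> - g i \<omega>)\<^sup>2 \<partial>M) < \<delta>) sequentially"
    using \<open>\<delta> > 0\<close> by (auto dest: order_tendstoD(2))
  then obtain i where "(\<integral>\<omega>. (f \<omega> - g i \<omega>)\<^sup>2 \<partial>M) < \<delta>"
    using eventually_happens'[OF sequentially_bot] by blast
  then show "\<exists>g. g \<in> borel_measurable M \<and> integrable M (\<lambda>\<omega>. (f \<omega> - g \<omega>)\<^sup>2)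
      \<and> (\<integral>\<omega>. (f \<omega> - g \<omega>)\<^sup>2 \<partial>M) \<le> \<delta> \<and> lipschitz_approximable M Z g"
    using I[of i] g[of i] approx[of i] by (intro exI[of _ "g i"]) auto
qed

lemma lipschitz_approximable_lipschitz:
  assumes "\<And>x y. \<bar>h x - h y\<bar> \<le> L * dist x y"
  shows "lipschitz_approximable M Z (\<lambda>\<omega>. h (Z \<omega>))"
  unfolding lipschitz_approximable_def using assms by (intro allI impI exI[of _ h] exI[of _ L]) auto

lemma (in prob_space) lipschitz_approximable_add:
  fixes Z :: "'a \<Rightarrow> 'b::metric_space"
  assumes Z[measurable]: "Z \<in> borel_measurable M" and [measurable]: "f \<in> borel_measurable M" "g \<in> borel_measurable M"
    and f: "lipschitz_approximable M Z f" and g: "lipschitz_approximable M Z g"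
  shows "lipschitz_approximable M Z (\<lambda>\<omega>. f \<omega> + g \<omega>)"
  unfolding lipschitz_approximable_def
proof (intro allI impI)
  fix \<delta> :: real assume "\<delta> > 0"
  obtain h L where h: "\<And>x y. \<bar>h x - h y\<bar> \<le> L * dist x y" "integrable M (\<lambda>\<omega>. (f \<omega> - h (Z \<omega>))\<^sup>2)"
      "(\<integral>\<omega>. (f \<omega> - h (Z \<omega>))\<^sup>2 \<partial>M) \<le> \<delta> / 4"
    using f \<open>\<delta> > 0\<close> unfolding lipschitz_approximable_def by (meson divide_pos_pos zero_less_numeral)
  obtain h' L' where h': "\<And>x y. \<bar>h' x - h' y\<bar> \<le> L' * dist x y" "integrable M (\<lambda>\<omega>. (g \<omega> - h' (Z \<omega>))\<^sup>2)"
      "(\<integral>\<omega>. (g \<omega> - h' (Z \<omega>))\<^sup>2 \<partial>M) \<le> \<delta> / 4"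
    using g \<open>\<delta> > 0\<close> unfolding lipschitz_approximable_def by (meson divide_pos_pos zero_less_numeral)
  have [measurable]: "h \<in> borel_measurable borel" "h' \<in> borel_measurable borel"
    by (rule borel_measurable_of_lipschitz[OF h(1)], rule borel_measurable_of_lipschitz[OF h'(1)])
  have eq: "f \<omega> + g \<omega> - (h (Z \<omega>) + h' (Z \<omega>)) = (f \<omega> - h (Z \<omega>)) + (g \<omega> - h' (Z \<omega>))" for \<omega> by simp
  have I: "integrable M (\<lambda>\<omega>. (f \<omega> + g \<omega> - (h (Z \<omega>) + h' (Z \<omega>)))\<^sup>2)"
    unfolding eq by (rule integrable_add_square) (use h h' in auto)
  have "(\<integral>\<omega>. (f \<omega> + g \<omega> - (h (Z \<omega>) + h' (Z \<omega>)))\<^sup>2 \<partial>M) \<le> (\<integral>\<omega>. 2 * (f \<omega> - h (Z \<omega>))\<^sup>2 + 2 * (g \<omega> - h' (Z \<omega>))\<^sup>2 \<partial>M)"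
    unfolding eq
    by (rule integral_mono[OF I[unfolded eq] _ square_add_le])
       (use h h' in \<open>intro Bochner_Integration.integrable_add integrable_mult_right\<close>)
  also have "\<dots> \<le> \<delta>" using h h' by simp
  finally have "(\<integral>\<omega>. (f \<omega> + g \<omega> - (h (Z \<omega>) + h' (Z \<omega>)))\<^sup>2 \<partial>M) \<le> \<delta>" .
  moreover have "\<bar>(h x + h' x) - (h y + h' y)\<bar> \<le> (L + L') * dist x y" for x y
    using h(1)[of x y] h'(1)[of x y] by (simp add: distrib_right)
  ultimately show "\<exists>h L. (\<forall>x y. \<bar>h x - h y\<bar> \<le> L * dist x y) \<and>
     integrable M (\<lambda>\<omega>. (f \<omega> + g \<omega> - h (Z \<omega>))\<^sup>2) \<and> (\<integral>\<omega>. (f \<omega> + g \<omega> - h (Z \<omega>))\<^sup>2 \<partial>M) \<le> \<delta>"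
    using I by (intro exI[of _ "\<lambda>x. h x + h' x"] exI[of _ "L + L'"]) auto
qed

lemma lipschitz_approximable_cmult:
  assumes f: "lipschitz_approximable M Z f"
  shows "lipschitz_approximable M Z (\<lambda>\<omega>. c * f \<omega>)"
proof (cases "c = 0")
  case True
  then show ?thesis using lipschitz_approximable_lipschitz[of "\<lambda>_. 0" 0] by simp
next
  case False
  show ?thesis
    unfolding lipschitz_approximable_def
  proof (intro allI impI)
    fix \<delta> :: real assume "\<delta> > 0"
    then have "\<delta> / c\<^sup>2 > 0" using False by simp
    then obtain h L where h: "\<And>x y. \<bar>h x - h y\<bar> \<le> L * dist x y" "integrable M (\<lambda>\<omega>. (f \<omega> - h (Z \<omega>))\<^sup>2)"
      "(\<integral>\<omega>. (f \<omega> - h (Z \<omega>))\<^sup>2 \<partial>M) \<le> \<delta> / c\<^sup>2"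
      using f unfolding lipschitz_approximable_def by meson
    have eq: "(c * f \<omega> - c * h (Z \<omega>))\<^sup>2 = c\<^sup>2 * (f \<omega> - h (Z \<omega>))\<^sup>2" for \<omega>
      by (simp flip: right_diff_distrib power_mult_distrib)
    have "(\<integral>\<omega>. (c * f \<omega> - c * h (Z \<omega>))\<^sup>2 \<partial>M) \<le> \<delta>"
      unfolding eq using h(3) False by (simp add: field_simps)
    moreover have "\<bar>c * h x - c * h y\<bar> \<le> (\<bar>c\<bar> * L) * dist x y" for x y
      using mult_left_mono[OF h(1)[of x y], of "\<bar>c\<bar>"] by (simp add: mult.assoc flip: abs_mult right_diff_distrib)
    ultimately show "\<exists>h L. (\<forall>x y. \<bar>h x - h y\<bar> \<le> L * dist x y) \<and>
     integrable M (\<lambda>\<omega>. (c * f \<omega> - h (Z \<omega>))\<^sup>2) \<and> (\<integral>\<omega>. (c * f \<omega> - h (Z \<omega>))\<^sup>2 \<partial>M) \<le> \<delta>"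
      using h(2) by (intro exI[of _ "\<lambda>x. c * h x"] exI[of _ "\<bar>c\<bar> * L"]) (auto simp: eq)
  qed
qed

lemma (in prob_space) lipschitz_approximable_closed:
  fixes Z :: "'a \<Rightarrow> 'b::metric_space"
  assumes Z[measurable]: "Z \<in> borel_measurable M" and C: "closed C"
  shows "lipschitz_approximable M Z (\<lambda>\<omega>. indicator C (Z \<omega>))"
proof (cases "C = {}")
  case True
  then show ?thesis using lipschitz_approximable_lipschitz[of "\<lambda>_. 0" 0] by simp
next
  case False
  note [measurable] = borel_closed[OF C]
  define h where "h m x = max 0 (1 - real m * infdist x C)" for m x
  have lip: "\<bar>h m x - h m y\<bar> \<le> real m * dist x y" for m x y
  proof -
    have "\<bar>h m x - h m y\<bar> \<le> \<bar>real m * infdist x C - real m * infdist y C\<bar>"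
      unfolding h_def by (auto simp: max_def abs_if)
    also have "\<dots> = real m * \<bar>infdist x C - infdist y C\<bar>"
      by (simp add: abs_mult flip: right_diff_distrib)
    also have "\<dots> \<le> real m * dist x y" by (intro mult_left_mono infdist_triangle_abs) auto
    finally show ?thesis .
  qed
  have [measurable]: "h m \<in> borel_measurable borel" for m using lip by (rule borel_measurable_of_lipschitz)
  have in01: "0 \<le> h m x" "h m x \<le> 1" for m x unfolding h_def by (auto simp: infdist_nonneg)
  have lim: "(\<lambda>m. h m x) \<longlonglongrightarrow> indicator C x" for x
  proof (cases "x \<in> C")
    case True
    then show ?thesis by (simp add: h_def)
  next
    case False
    then have d: "infdist x C > 0"
      using C \<open>C \<noteq> {}\<close> by (metis in_closed_iff_infdist_zero infdist_nonneg less_eq_real_def)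
    obtain m0 :: nat where m0: "1 / infdist x C < real m0" using reals_Archimedean2 by blast
    have "eventually (\<lambda>m. h m x = 0) sequentially"
      using eventually_ge_at_top[of m0]
    proof eventually_elim
      case (elim m)
      then have "1 / infdist x C < real m" using m0 by simp
      then have "1 < real m * infdist x C" using d by (simp add: field_simps)
      then show ?case by (simp add: h_def)
    qed
    then show ?thesis using False by (simp add: tendsto_eventually)
  qed
  show ?thesis
  proof (rule lipschitz_approximable_limit[where g="\<lambda>m \<omega>. h m (Z \<omega>)" and w="\<lambda>_. 1"])
    show "\<bar>indicator C (Z \<omega>) - h i (Z \<omega>)\<bar> \<le> 1" for i \<omega>
      using in01[of i "Z \<omega>"] by (auto simp: indicator_def abs_if)
    show "lipschitz_approximable M Z (\<lambda>\<omega>. h i (Z \<omega>))" for i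
      using lip by (rule lipschitz_approximable_lipschitz)
  qed (use lim in auto)
qed

lemma (in prob_space) lipschitz_approximable_borel:
  fixes Z :: "'a \<Rightarrow> 'b::{second_countable_topology, complete_space}"
  assumes Z[measurable]: "Z \<in> borel_measurable M" and B[measurable]: "B \<in> sets borel"
  shows "lipschitz_approximable M Z (\<lambda>\<omega>. indicator B (Z \<omega>))"
proof (rule lipschitz_approximable_trans[OF Z])
  fix \<delta> :: real assume \<delta>: "\<delta> > 0"
  define N where "N = distr M borel Z"
  interpret N: prob_space N unfolding N_def by (rule prob_space_distr) simp
  have [simp]: "sets N = sets borel" by (simp add: N_def)
  have SUP: "emeasure N B = (SUP K \<in> {K. K \<subseteq> B \<and> compact K}. emeasure N K)"
    using N.emeasure_finite by (intro inner_regular) auto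
  have "\<exists>K. K \<subseteq> B \<and> compact K \<and> N.prob B - \<delta> < N.prob K"
  proof (cases "N.prob B - \<delta> < 0")
    case True
    then show ?thesis by (intro exI[of _ "{}"]) auto
  next
    case False
    have "ennreal (N.prob B - \<delta>) < emeasure N B"
      using False \<delta> by (simp add: N.emeasure_eq_measure ennreal_less_iff)
    then obtain K where K: "K \<subseteq> B" "compact K" "ennreal (N.prob B - \<delta>) < emeasure N K"
      unfolding SUP less_SUP_iff by auto
    then show ?thesis using False by (auto simp: N.emeasure_eq_measure ennreal_less_iff)
  qed
  then obtain K where K: "K \<subseteq> B" "compact K" "N.prob B - \<delta> < N.prob K" by blast
  have cl: "closed K" using K compact_imp_closed by blast
  note [measurable] = borel_closed[OF cl]
  have eq: "(indicator B (Z \<omega>) - indicator K (Z \<omega>))\<^sup>2 = (indicator (B - K) (Z \<omega>) :: real)" for \<omega>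
    using K(1) by (auto simp: indicator_def)
  have "(\<integral>\<omega>. indicator (B - K) (Z \<omega>) \<partial>M) = (\<integral>x. indicator (B - K) x \<partial>N :: real)"
    unfolding N_def by (rule integral_distr[symmetric]) auto
  also have "\<dots> = N.prob (B - K)" by (simp add: N_def)
  also have "\<dots> = N.prob B - N.prob K" using K(1) by (intro N.finite_measure_Diff) auto
  finally have "(\<integral>\<omega>. indicator (B - K) (Z \<omega>) \<partial>M) \<le> \<delta>" using K(3) by simp
  moreover have "integrable M (\<lambda>\<omega>. indicator (B - K) (Z \<omega>) :: real)"
    by (rule integrable_const_bound[where B=1]) (auto simp: indicator_def)
  ultimately show "\<exists>g. g \<in> borel_measurable M \<and> integrable M (\<lambda>\<omega>. (indicator B (Z \<omega>) - g \<omega>)\<^sup>2)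
      \<and> (\<integral>\<omega>. (indicator B (Z \<omega>) - g \<omega>)\<^sup>2 \<partial>M) \<le> \<delta> \<and> lipschitz_approximable M Z g"
    using lipschitz_approximable_closed[OF Z cl]
    by (intro exI[of _ "\<lambda>\<omega>. indicator K (Z \<omega>)"]) (auto simp: eq)
qed simp

lemma in_sets_vimage_algebra:
  assumes "A \<in> sets (vimage_algebra X Z N)" "Z \<in> X \<rightarrow> space N"
  obtains B where "B \<in> sets N" "A = Z -` B \<inter> X"
  using assms by (auto simp: sets_vimage_algebra2)

lemma (in prob_space) lipschitz_approximable_nonneg:
  fixes Z :: "'a \<Rightarrow> 'b::{second_countable_topology, complete_space}"
  assumes Z[measurable]: "Z \<in> borel_measurable M"
    and f: "f \<in> borel_measurable (vimage_algebra (space M) Z borel)" "\<And>\<omega>. 0 \<le> f \<omega>"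
    and f2: "integrable M (\<lambda>\<omega>. (f \<omega>)\<^sup>2)"
  shows "lipschitz_approximable M Z f"
proof -
  have sub: "subalgebra M (vimage_algebra (space M) Z borel)"
    unfolding subalgebra_def by (auto simp: sets_vimage_algebra2)
  note meas = measurable_from_subalg[OF sub]
  show ?thesis using f f2
  proof (induction rule: borel_measurable_induct_real)
    case (set A)
    obtain B where B: "B \<in> sets borel" "A = Z -` B \<inter> space M"
      by (rule in_sets_vimage_algebra[OF set(1)]) auto
    have [measurable]: "A \<in> sets M" using B by auto
    have eq: "(indicator A \<omega> - indicator B (Z \<omega>))\<^sup>2 = (0::real)" if "\<omega> \<in> space M" for \<omega>
      using that B by (auto simp: indicator_def)
    note B(1)[measurable]
    show ?case
    proof (rule lipschitz_approximable_trans[OF Z])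
      fix \<delta> :: real assume "\<delta> > 0"
      have "integrable M (\<lambda>\<omega>. (indicator A \<omega> - indicator B (Z \<omega>))\<^sup>2 :: real)"
        by (subst Bochner_Integration.integrable_cong[OF refl eq]) auto
      moreover have "(\<integral>\<omega>. (indicator A \<omega> - indicator B (Z \<omega>))\<^sup>2 \<partial>M) = (0::real)"
        by (subst Bochner_Integration.integral_cong[OF refl eq]) auto
      ultimately show "\<exists>g. g \<in> borel_measurable M \<and> integrable M (\<lambda>\<omega>. (indicator A \<omega> - g \<omega>)\<^sup>2)
        \<and> (\<integral>\<omega>. (indicator A \<omega> - g \<omega>)\<^sup>2 \<partial>M) \<le> \<delta> \<and> lipschitz_approximable M Z g"
        using lipschitz_approximable_borel[OF Z B(1)] \<open>\<delta> > 0\<close>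
        by (intro exI[of _ "\<lambda>\<omega>. indicator B (Z \<omega>)"]) auto
    qed simp
  next
    case (mult u c)
    show ?case
    proof (cases "c = 0")
      case True
      then show ?thesis using lipschitz_approximable_lipschitz[of "\<lambda>_. 0" 0] by simp
    next
      case False
      have "integrable M (\<lambda>\<omega>. inverse (c\<^sup>2) * (c * u \<omega>)\<^sup>2)" using mult by (intro integrable_mult_right) auto
      then have "integrable M (\<lambda>\<omega>. (u \<omega>)\<^sup>2)" using False by (simp add: power_mult_distrib)
      then show ?thesis using mult by (intro lipschitz_approximable_cmult) auto
    qed
  next
    case (add u v)
    have [measurable]: "u \<in> borel_measurable M" "v \<in> borel_measurable M"
      by (rule meas[OF add(1)], rule meas[OF add(3)])
    have "integrable M (\<lambda>\<omega>. (u \<omega>)\<^sup>2)" "integrable M (\<lambda>\<omega>. (v \<omega>)\<^sup>2)"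
      using add by (auto intro!: Bochner_Integration.integrable_bound[OF add.prems] power_mono AE_I2)
    then show ?case using add by (intro lipschitz_approximable_add) auto
  next
    case (seq U)
    have U: "U i \<omega> \<le> f \<omega>" if "\<omega> \<in> space M" for i \<omega>
      using seq that
      by (intro LIMSEQ_le_const[of "\<lambda>i. U i \<omega>"] exI[of _ i]) (auto simp: incseq_def le_fun_def)
    have [measurable]: "U i \<in> borel_measurable M" for i by (rule meas[OF seq(1)])
    have [measurable]: "f \<in> borel_measurable M" by (rule meas[OF f(1)])
    have "integrable M (\<lambda>\<omega>. (U i \<omega>)\<^sup>2)" for i
      by (rule Bochner_Integration.integrable_bound[OF seq.prems]) (use seq U in \<open>auto intro!: power_mono AE_I2\<close>)
    then have approx: "lipschitz_approximable M Z (U i)" for i by (rule seq.IH)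
    show ?case
    proof (rule lipschitz_approximable_limit[where g=U and w=f])
      show "\<bar>f \<omega> - U i \<omega>\<bar> \<le> f \<omega>" if "\<omega> \<in> space M" for i \<omega>
        using U[OF that, of i] seq.hyps(2)[of i \<omega>] by simp
    qed (use approx seq.hyps(4) seq.prems Z in auto)
  qed
qed

lemma (in prob_space) lipschitz_dense:
  fixes Z :: "'a \<Rightarrow> 'b::{second_countable_topology, complete_space}"
  assumes Z[measurable]: "Z \<in> borel_measurable M"
    and f: "f \<in> borel_measurable (vimage_algebra (space M) Z borel)"
    and f2: "integrable M (\<lambda>\<omega>. (f \<omega>)\<^sup>2)"
  shows "lipschitz_approximable M Z f"
proof -
  have sub: "subalgebra M (vimage_algebra (space M) Z borel)"
    unfolding subalgebra_def by (auto simp: sets_vimage_algebra2)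
  have [measurable]: "f \<in> borel_measurable M" using f measurable_from_subalg[OF sub] by auto
  have i: "integrable M (\<lambda>\<omega>. (max 0 (f \<omega>))\<^sup>2)" "integrable M (\<lambda>\<omega>. (max 0 (- f \<omega>))\<^sup>2)"
    by (rule Bochner_Integration.integrable_bound[OF f2]; auto simp: max_def intro!: AE_I2)+
  have p: "lipschitz_approximable M Z (\<lambda>\<omega>. max 0 (f \<omega>))"
    by (rule lipschitz_approximable_nonneg[OF Z]) (use f i in auto)
  have m: "lipschitz_approximable M Z (\<lambda>\<omega>. max 0 (- f \<omega>))"
    by (rule lipschitz_approximable_nonneg[OF Z]) (use f i in auto)
  have "lipschitz_approximable M Z (\<lambda>\<omega>. max 0 (f \<omega>) + (-1) * max 0 (- f \<omega>))"
    by (rule lipschitz_approximable_add[OF Z _ _ p lipschitz_approximable_cmult[OF m]]) measurable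
  moreover have "(\<lambda>\<omega>. max 0 (f \<omega>) + (-1) * max 0 (- f \<omega>)) = f" by (auto simp: max_def)
  ultimately show ?thesis by simp
qed

section \<open>Within-group dispersion\<close>

definition dispersion :: "'a set set \<Rightarrow> ('a \<Rightarrow> real) \<Rightarrow> real" where
  "dispersion P y = (\<Sum>s\<in>P. \<Sum>i\<in>s. \<Sum>j\<in>s. (y i - y j)\<^sup>2)"

definition linked :: "'a set set \<Rightarrow> 'a \<Rightarrow> 'a \<Rightarrow> bool" where
  "linked P i j \<longleftrightarrow> (\<exists>s\<in>P. i \<in> s \<and> j \<in> s)"

lemma dispersion_nonneg: "dispersion P y \<ge> 0"
  unfolding dispersion_def by (intro sum_nonneg) auto

lemma dispersion_add_le: "dispersion P (\<lambda>i. y i + e i) \<le> 2 * dispersion P y + 2 * dispersion P e"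
proof -
  have "dispersion P (\<lambda>i. y i + e i) \<le> (\<Sum>s\<in>P. \<Sum>i\<in>s. \<Sum>j\<in>s. 2 * (y i - y j)\<^sup>2 + 2 * (e i - e j)\<^sup>2)"
    unfolding dispersion_def
  proof (intro sum_mono)
    fix s i j
    show "(y i + e i - (y j + e j))\<^sup>2 \<le> 2 * (y i - y j)\<^sup>2 + 2 * (e i - e j)\<^sup>2"
      using square_add_le[of "y i - y j" "e i - e j"] by (simp add: algebra_simps)
  qed
  then show ?thesis unfolding dispersion_def sum.distrib sum_distrib_left .
qed

lemma dispersion_perturb:
  assumes "\<eta> > 0"
  shows "\<bar>dispersion P (\<lambda>i. y i + e i) - dispersion P y\<bar> \<le> \<eta> * dispersion P y + (1 + 1 / \<eta>) * dispersion P e"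
proof -
  have "\<bar>dispersion P (\<lambda>i. y i + e i) - dispersion P y\<bar>
      \<le> (\<Sum>s\<in>P. \<Sum>i\<in>s. \<Sum>j\<in>s. \<bar>(y i + e i - (y j + e j))\<^sup>2 - (y i - y j)\<^sup>2\<bar>)"
    unfolding dispersion_def sum_subtractf[symmetric]
    by (rule order_trans[OF sum_abs sum_mono] order_refl | rule sum_abs)+
  also have "\<dots> \<le> (\<Sum>s\<in>P. \<Sum>i\<in>s. \<Sum>j\<in>s. \<eta> * (y i - y j)\<^sup>2 + (1 + 1 / \<eta>) * (e i - e j)\<^sup>2)"
  proof (intro sum_mono)
    fix s i j
    have "y i + e i - (y j + e j) = (y i - y j) + (e i - e j)" by simp
    then show "\<bar>(y i + e i - (y j + e j))\<^sup>2 - (y i - y j)\<^sup>2\<bar> \<le> \<eta> * (y i - y j)\<^sup>2 + (1 + 1 / \<eta>) * (e i - e j)\<^sup>2"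
      using abs_square_add_diff_le[OF assms, of "y i - y j" "e i - e j"] by (simp only:)
  qed
  finally show ?thesis unfolding dispersion_def sum.distrib sum_distrib_left .
qed

lemma dispersion_le:
  assumes P: "partition_on A P" "finite A" and card: "\<And>s. s \<in> P \<Longrightarrow> card s = k"
  shows "dispersion P y \<le> 4 * real k * (\<Sum>i\<in>A. (y i)\<^sup>2)"
proof -
  have "dispersion P y \<le> (\<Sum>s\<in>P. \<Sum>i\<in>s. \<Sum>j\<in>s. 2 * (y i)\<^sup>2 + 2 * (y j)\<^sup>2)"
    unfolding dispersion_def
  proof (intro sum_mono)
    fix s i j
    show "(y i - y j)\<^sup>2 \<le> 2 * (y i)\<^sup>2 + 2 * (y j)\<^sup>2" using square_add_le[of "y i" "- y j"] by simp
  qed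
  also have "\<dots> = (\<Sum>s\<in>P. \<Sum>i\<in>s. 4 * real k * (y i)\<^sup>2)"
    by (rule sum.cong[OF refl]) (simp add: sum.distrib card algebra_simps flip: sum_distrib_left)
  also have "\<dots> = 4 * real k * (\<Sum>i\<in>A. (y i)\<^sup>2)"
    by (simp add: sum_partition_on[OF P] sum_distrib_left)
  finally show ?thesis .
qed

lemma group_eq_linked:
  assumes "partition_on A P" "s \<in> P" "i \<in> s"
  shows "s = {j \<in> A. linked P i j}"
proof
  show "s \<subseteq> {j \<in> A. linked P i j}"
    using assms partition_onD1[OF assms(1)] by (auto simp: linked_def)
  show "{j \<in> A. linked P i j} \<subseteq> s"
    using assms partition_onD2[OF assms(1)] by (auto simp: linked_def disjoint_def)
qed

lemma sum_group_linked:
  fixes f :: "'a \<Rightarrow> real"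
  assumes "partition_on A P" "finite A" "s \<in> P" "i \<in> s"
  shows "(\<Sum>j\<in>s. f j) = (\<Sum>j\<in>A. of_bool (linked P i j) * f j)"
  using assms by (subst group_eq_linked[OF assms(1,3,4)]) (intro sum.mono_neutral_cong_left, auto)

lemma sum_linked_card:
  assumes P: "partition_on A P" "finite A" and card: "\<And>s. s \<in> P \<Longrightarrow> card s = k" and i: "i \<in> A"
  shows "(\<Sum>j\<in>A. of_bool (linked P i j)) = real k"
proof -
  obtain s where s: "s \<in> P" "i \<in> s" using partition_onD1[OF P(1)] i by auto
  show ?thesis using sum_group_linked[OF P s, of "\<lambda>_. 1"] card[OF s(1)] by simp
qed

lemma sum_symmetric_split:
  fixes f :: "nat \<Rightarrow> nat \<Rightarrow> real"
  assumes "\<And>i j. f i j = f j i"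
  shows "(\<Sum>i<n. \<Sum>j<n. f i j) = (\<Sum>i<n. f i i) + 2 * (\<Sum>j<n. \<Sum>i<j. f i j)"
proof (induction n)
  case (Suc n)
  have "(\<Sum>i<n. f i n) = (\<Sum>i<n. f n i)" using assms by simp
  then show ?case using Suc by (simp add: sum.distrib)
qed simp

lemma dispersion_expand:
  fixes n :: nat
  assumes P: "partition_on {..<n} P" and card: "\<And>s. s \<in> P \<Longrightarrow> card s = k"
  shows "dispersion P u = 2 * (real k - 1) * (\<Sum>i<n. (u i)\<^sup>2)
    - 4 * (\<Sum>j<n. u j * (\<Sum>i<j. of_bool (linked P i j) * u i))"
proof -
  let ?c = "\<lambda>i j. of_bool (linked P i j) :: real"
  have fin: "finite {..<n}" by simp
  have refl: "linked P i i" if "i < n" for i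
  proof -
    have "i \<in> \<Union>P" using partition_onD1[OF P] that by blast
    then show ?thesis by (auto simp: linked_def)
  qed
  have sym: "linked P i j = linked P j i" for i j by (auto simp: linked_def)
  have "dispersion P u = (\<Sum>s\<in>P. \<Sum>i\<in>s. \<Sum>j\<in>s. (u i)\<^sup>2 + (u j)\<^sup>2 - 2 * (u i * u j))"
    unfolding dispersion_def by (simp add: power2_diff mult.assoc)
  also have "\<dots> = (\<Sum>s\<in>P. \<Sum>i\<in>s. 2 * real k * (u i)\<^sup>2) - 2 * (\<Sum>s\<in>P. \<Sum>i\<in>s. \<Sum>j\<in>s. u i * u j)"
    unfolding sum_distrib_left[of 2 _ P] sum_subtractf[symmetric]
    by (rule sum.cong[OF HOL.refl]) (simp add: sum.distrib sum_subtractf card algebra_simps flip: sum_distrib_left sum_distrib_right)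
  also have "(\<Sum>s\<in>P. \<Sum>i\<in>s. \<Sum>j\<in>s. u i * u j) = (\<Sum>s\<in>P. \<Sum>i\<in>s. \<Sum>j<n. ?c i j * (u i * u j))"
    by (intro sum.cong HOL.refl sum_group_linked[OF P fin])
  also have "\<dots> = (\<Sum>i<n. \<Sum>j<n. ?c i j * (u i * u j))" by (rule sum_partition_on[OF P fin])
  also have "\<dots> = (\<Sum>i<n. ?c i i * (u i * u i)) + 2 * (\<Sum>j<n. \<Sum>i<j. ?c i j * (u i * u j))"
    by (rule sum_symmetric_split) (simp add: sym mult_ac)
  also have "(\<Sum>i<n. ?c i i * (u i * u i)) = (\<Sum>i<n. (u i)\<^sup>2)"
    by (intro sum.cong) (auto simp: refl power2_eq_square)
  also have "(\<Sum>j<n. \<Sum>i<j. ?c i j * (u i * u j)) = (\<Sum>j<n. u j * (\<Sum>i<j. ?c i j * u i))"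
    unfolding sum_distrib_left by (intro sum.cong HOL.refl) (simp only: mult_ac)
  also have "(\<Sum>s\<in>P. \<Sum>i\<in>s. 2 * real k * (u i)\<^sup>2) = 2 * real k * (\<Sum>i<n. (u i)\<^sup>2)"
    by (simp add: sum_partition_on[OF P fin] sum_distrib_left)
  finally show ?thesis by (simp add: algebra_simps)
qed

lemma (in prob_space) orthogonal_average_prob_le:
  fixes X :: "nat \<Rightarrow> 'a \<Rightarrow> real"
  assumes X: "\<And>i. i < n \<Longrightarrow> X i \<in> borel_measurable M"
    and K: "\<And>i \<omega>. i < n \<Longrightarrow> \<omega> \<in> space M \<Longrightarrow> \<bar>X i \<omega>\<bar> \<le> K"
    and orth: "\<And>i j. i < j \<Longrightarrow> j < n \<Longrightarrow> (\<integral>\<omega>. X j \<omega> * X i \<omega> \<partial>M) = 0"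
    and "\<epsilon> > 0" "n > 0"
  shows "prob {\<omega> \<in> space M. \<bar>(\<Sum>i<n. X i \<omega>) / real n\<bar> \<ge> \<epsilon>} \<le> K\<^sup>2 / (real n * \<epsilon>\<^sup>2)"
proof -
  have n: "0 < n" using assms by simp
  obtain \<omega>0 where "\<omega>0 \<in> space M" using not_empty by blast
  then have K0: "K \<ge> 0" using K[of 0 \<omega>0] n by linarith
  have bXX: "\<bar>X i \<omega> * X j \<omega>\<bar> \<le> K\<^sup>2" if "i < n" "j < n" "\<omega> \<in> space M" for i j \<omega>
    unfolding abs_mult power2_eq_square using that K0 by (intro mult_mono K) auto
  have XX: "integrable M (\<lambda>\<omega>. X i \<omega> * X j \<omega>)" if "i < n" "j < n" for i j
    by (rule integrable_const_bound[where B="K\<^sup>2"]) (use bXX X that in \<open>auto intro!: AE_I2\<close>)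
  have eq: "(\<Sum>i<n. X i \<omega>)\<^sup>2 = (\<Sum>i<n. \<Sum>j<n. X i \<omega> * X j \<omega>)" for \<omega>
    by (simp add: power2_eq_square sum_product)
  have I: "integrable M (\<lambda>\<omega>. (\<Sum>i<n. X i \<omega>)\<^sup>2)"
    unfolding eq using XX by (intro Bochner_Integration.integrable_sum) auto
  have "(\<integral>\<omega>. (\<Sum>i<n. X i \<omega>)\<^sup>2 \<partial>M) = (\<Sum>i<n. \<Sum>j<n. \<integral>\<omega>. X i \<omega> * X j \<omega> \<partial>M)"
    unfolding eq using XX
    by (subst Bochner_Integration.integral_sum, force, intro sum.cong refl, subst Bochner_Integration.integral_sum) auto
  also have "\<dots> = (\<Sum>i<n. \<integral>\<omega>. X i \<omega> * X i \<omega> \<partial>M)"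
  proof (rule sum.cong[OF refl])
    fix i assume i: "i \<in> {..<n}"
    have "(\<Sum>j<n. \<integral>\<omega>. X i \<omega> * X j \<omega> \<partial>M) = (\<Sum>j\<in>{i}. \<integral>\<omega>. X i \<omega> * X j \<omega> \<partial>M)"
    proof (rule sum.mono_neutral_right)
      show "\<forall>j\<in>{..<n} - {i}. (\<integral>\<omega>. X i \<omega> * X j \<omega> \<partial>M) = 0"
      proof
        fix j assume "j \<in> {..<n} - {i}"
        then consider "i < j" "j < n" | "j < i" "i < n" using i by force
        then show "(\<integral>\<omega>. X i \<omega> * X j \<omega> \<partial>M) = 0"
          by cases (use orth[of i j] orth[of j i] in \<open>auto simp: mult.commute\<close>)
      qed
    qed (use i in auto)
    then show "(\<Sum>j<n. \<integral>\<omega>. X i \<omega> * X j \<omega> \<partial>M) = (\<integral>\<omega>. X i \<omega> * X i \<omega> \<partial>M)" by simp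
  qed
  also have "\<dots> \<le> (\<Sum>i<n. K\<^sup>2)"
  proof (rule sum_mono)
    fix i assume i: "i \<in> {..<n}"
    have "(\<integral>\<omega>. X i \<omega> * X i \<omega> \<partial>M) \<le> (\<integral>\<omega>. K\<^sup>2 \<partial>M)"
      by (rule integral_mono) (use XX i abs_le_D1[OF bXX] in auto)
    then show "(\<integral>\<omega>. X i \<omega> * X i \<omega> \<partial>M) \<le> K\<^sup>2" by (simp add: prob_space)
  qed
  finally have E: "(\<integral>\<omega>. (\<Sum>i<n. X i \<omega>)\<^sup>2 \<partial>M) \<le> real n * K\<^sup>2" by simp
  have "prob {\<omega> \<in> space M. \<bar>(\<Sum>i<n. X i \<omega>) / real n\<bar> \<ge> \<epsilon>} \<le> (\<integral>\<omega>. ((\<Sum>i<n. X i \<omega>) / real n)\<^sup>2 \<partial>M) / \<epsilon>\<^sup>2"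
    by (rule second_moment_method) (use X I \<open>\<epsilon> > 0\<close> in \<open>auto simp: power_divide\<close>)
  also have "\<dots> = (\<integral>\<omega>. (\<Sum>i<n. X i \<omega>)\<^sup>2 \<partial>M) / (real n)\<^sup>2 / \<epsilon>\<^sup>2"
    by (simp add: power_divide)
  also have "\<dots> \<le> real n * K\<^sup>2 / (real n)\<^sup>2 / \<epsilon>\<^sup>2"
    by (intro divide_right_mono E) auto
  also have "\<dots> = K\<^sup>2 / (real n * \<epsilon>\<^sup>2)" using n by (simp add: power2_eq_square)
  finally show ?thesis .
qed

lemma abs_clamp_le: "0 \<le> c \<Longrightarrow> \<bar>max (- c) (min c x)\<bar> \<le> (c::real)"
  by (auto simp: max_def min_def)

lemma (in prob_space) centred_lipschitz_decomposition:
  fixes Z :: "'a \<Rightarrow> 'b::{second_countable_topology, complete_space}" and b :: "'a \<Rightarrow> real"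
  assumes Z[measurable]: "Z \<in> borel_measurable M" and b[measurable]: "b \<in> borel_measurable M"
    and b2: "integrable M (\<lambda>\<omega>. (b \<omega>)\<^sup>2)" and \<delta>: "\<delta> > 0"
  defines "G \<equiv> vimage_algebra (space M) Z borel"
  shows "\<exists>u K h L. u \<in> borel_measurable M \<and> (\<forall>\<omega>. \<bar>u \<omega>\<bar> \<le> K)
    \<and> (\<forall>B\<in>sets borel. (\<integral>\<omega>. u \<omega> * indicator B (Z \<omega>) \<partial>M) = 0)
    \<and> (\<forall>x y. \<bar>h x - h y\<bar> \<le> L * dist x y)
    \<and> integrable M (\<lambda>\<omega>. (b \<omega> - u \<omega> - h (Z \<omega>))\<^sup>2) \<and> (\<integral>\<omega>. (b \<omega> - u \<omega> - h (Z \<omega>))\<^sup>2 \<partial>M) \<le> 4 * \<delta>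
    \<and> integrable M (\<lambda>\<omega>. (u \<omega> - (b \<omega> - real_cond_exp M G b \<omega>))\<^sup>2)
    \<and> (\<integral>\<omega>. (u \<omega> - (b \<omega> - real_cond_exp M G b \<omega>))\<^sup>2 \<partial>M) \<le> 4 * \<delta>"
proof -
  have sub: "subalgebra M G"
    unfolding subalgebra_def G_def by (auto simp: sets_vimage_algebra2)
  interpret finite_measure_subalgebra M G
    using sub by (simp add: finite_measure_subalgebra_def finite_measure_subalgebra_axioms_def finite_measure_axioms)
  define cl where "cl c x = max (- c) (min c x)" for c x :: real
  have cl_meas[measurable]: "cl c \<in> borel_measurable borel" for c unfolding cl_def by measurable
  have bint: "integrable M b" by (rule cond_exp_square_le(1)[OF prob_space_axioms sub b b2])
  have "(\<lambda>i. \<integral>\<omega>. (b \<omega> - cl (real i) (b \<omega>))\<^sup>2 \<partial>M) \<longlonglongrightarrow> (\<integral>\<omega>. 0 \<partial>M)"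
  proof (rule integral_dominated_convergence[OF _ _ b2])
    show "AE \<omega> in M. (\<lambda>i. (b \<omega> - cl (real i) (b \<omega>))\<^sup>2) \<longlonglongrightarrow> 0"
    proof (rule AE_I2)
      fix \<omega>
      obtain m0 :: nat where m0: "\<bar>b \<omega>\<bar> < real m0" using reals_Archimedean2 by blast
      have "eventually (\<lambda>i. (b \<omega> - cl (real i) (b \<omega>))\<^sup>2 = 0) sequentially"
        using eventually_ge_at_top[of m0] by eventually_elim (use m0 in \<open>auto simp: cl_def max_def min_def\<close>)
      then show "(\<lambda>i. (b \<omega> - cl (real i) (b \<omega>))\<^sup>2) \<longlonglongrightarrow> 0" by (rule tendsto_eventually)
    qed
    show "AE \<omega> in M. norm ((b \<omega> - cl (real i) (b \<omega>))\<^sup>2) \<le> (b \<omega>)\<^sup>2" for i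
    proof (rule AE_I2)
      fix \<omega>
      have "\<bar>b \<omega> - cl (real i) (b \<omega>)\<bar> \<le> \<bar>b \<omega>\<bar>" by (auto simp: cl_def max_def min_def)
      then show "norm ((b \<omega> - cl (real i) (b \<omega>))\<^sup>2) \<le> (b \<omega>)\<^sup>2" by (simp add: abs_le_square_iff)
    qed
  qed auto
  then have "eventually (\<lambda>i. (\<integral>\<omega>. (b \<omega> - cl (real i) (b \<omega>))\<^sup>2 \<partial>M) < \<delta>) sequentially"
    using \<delta> by (auto dest: order_tendstoD(2))
  then obtain i where i: "(\<integral>\<omega>. (b \<omega> - cl (real i) (b \<omega>))\<^sup>2 \<partial>M) < \<delta>"
    using eventually_happens'[OF sequentially_bot] by blast
  define c where "c = real i"
  have c0: "c \<ge> 0" by (simp add: c_def)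
  have clb: "\<bar>cl c x\<bar> \<le> c" for x unfolding cl_def by (rule abs_clamp_le[OF c0])
  define bc where "bc \<omega> = cl c (b \<omega>)" for \<omega>
  have [measurable]: "bc \<in> borel_measurable M" unfolding bc_def by measurable
  have bcb: "\<bar>bc \<omega>\<bar> \<le> c" for \<omega> unfolding bc_def by (rule clb)
  have bc2: "integrable M (\<lambda>\<omega>. (bc \<omega>)\<^sup>2)"
    by (rule integrable_const_bound[where B="c\<^sup>2"]) (use bcb c0 in \<open>auto intro!: AE_I2 simp: abs_le_square_iff[symmetric]\<close>)
  have bcint: "integrable M bc"
    by (rule integrable_const_bound[where B=c]) (use bcb in auto)
  define d where "d \<omega> = b \<omega> - bc \<omega>" for \<omega>
  have [measurable]: "d \<in> borel_measurable M" unfolding d_def by measurable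
  have d2: "integrable M (\<lambda>\<omega>. (d \<omega>)\<^sup>2)" unfolding d_def by (rule integrable_diff_square) (use b2 bc2 in auto)
  have dd: "(\<integral>\<omega>. (d \<omega>)\<^sup>2 \<partial>M) \<le> \<delta>" using i by (simp add: d_def bc_def c_def)
  define g' where "g' \<omega> = cl c (real_cond_exp M G bc \<omega>)" for \<omega>
  have g'G: "g' \<in> borel_measurable G" unfolding g'_def by measurable
  then have [measurable]: "g' \<in> borel_measurable M" by (rule measurable_from_subalg[OF sub])
  have g'b: "\<bar>g' \<omega>\<bar> \<le> c" for \<omega> unfolding g'_def by (rule clb)
  have g'2: "integrable M (\<lambda>\<omega>. (g' \<omega>)\<^sup>2)"
    by (rule integrable_const_bound[where B="c\<^sup>2"]) (use g'b c0 in \<open>auto intro!: AE_I2 simp: abs_le_square_iff[symmetric]\<close>)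
  have g'int: "integrable M g'"
    by (rule integrable_const_bound[where B=c]) (use g'b in auto)
  have g'_eq: "AE \<omega> in M. g' \<omega> = real_cond_exp M G bc \<omega>"
  proof -
    have "AE \<omega> in M. real_cond_exp M G bc \<omega> \<ge> - c"
      by (rule real_cond_exp_ge_c[OF bcint]) (use bcb in \<open>auto simp: abs_le_iff minus_le_iff\<close>)
    moreover have "AE \<omega> in M. real_cond_exp M G bc \<omega> \<le> c"
      by (rule real_cond_exp_le_c[OF bcint]) (use bcb in \<open>auto simp: abs_le_iff\<close>)
    ultimately show ?thesis by eventually_elim (auto simp: g'_def cl_def)
  qed
  define u where "u \<omega> = bc \<omega> - g' \<omega>" for \<omega>
  have [measurable]: "u \<in> borel_measurable M" unfolding u_def by measurable
  have ub: "\<bar>u \<omega>\<bar> \<le> 2 * c" for \<omega> using bcb[of \<omega>] g'b[of \<omega>] by (simp add: u_def abs_le_iff)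
  have u0: "(\<integral>\<omega>. u \<omega> * indicator B (Z \<omega>) \<partial>M) = 0" if B: "B \<in> sets borel" for B
  proof -
    define A where "A = Z -` B \<inter> space M"
    have A: "A \<in> sets G" using B unfolding A_def G_def by (auto intro: in_vimage_algebra)
    then have [measurable]: "A \<in> sets M" using sub by (auto simp: subalgebra_def)
    have 1: "(\<integral>\<omega>\<in>A. bc \<omega> \<partial>M) = (\<integral>\<omega>\<in>A. g' \<omega> \<partial>M)"
      apply (rule trans[OF real_cond_exp_intA[OF bcint A]])
      unfolding set_lebesgue_integral_def
      by (rule integral_cong_AE) (use g'_eq in \<open>auto elim!: eventually_mono\<close>)
    have "(\<integral>\<omega>. u \<omega> * indicator B (Z \<omega>) \<partial>M) = (\<integral>\<omega>. indicator A \<omega> *\<^sub>R bc \<omega> - indicator A \<omega> *\<^sub>R g' \<omega> \<partial>M)"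
      by (rule Bochner_Integration.integral_cong) (auto simp: A_def u_def indicator_def)
    also have "\<dots> = (\<integral>\<omega>\<in>A. bc \<omega> \<partial>M) - (\<integral>\<omega>\<in>A. g' \<omega> \<partial>M)"
      unfolding set_lebesgue_integral_def
      by (rule Bochner_Integration.integral_diff)
         (rule integrable_mult_indicator[OF _ bcint] integrable_mult_indicator[OF _ g'int]; simp)+
    finally show ?thesis using 1 by simp
  qed
  have "lipschitz_approximable M Z g'" using g'G g'2 unfolding G_def by (rule lipschitz_dense[OF Z])
  then obtain h L where h: "\<And>x y. \<bar>h x - h y\<bar> \<le> L * dist x y" "integrable M (\<lambda>\<omega>. (g' \<omega> - h (Z \<omega>))\<^sup>2)"
      "(\<integral>\<omega>. (g' \<omega> - h (Z \<omega>))\<^sup>2 \<partial>M) \<le> \<delta>"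
    using \<delta> unfolding lipschitz_approximable_def by meson
  have [measurable]: "h \<in> borel_measurable borel" by (rule borel_measurable_of_lipschitz[OF h(1)])
  have req: "b \<omega> - u \<omega> - h (Z \<omega>) = d \<omega> + (g' \<omega> - h (Z \<omega>))" for \<omega> by (simp add: d_def u_def)
  have r2: "integrable M (\<lambda>\<omega>. (b \<omega> - u \<omega> - h (Z \<omega>))\<^sup>2)"
    unfolding req by (rule integrable_add_square) (use d2 h in auto)
  have "(\<integral>\<omega>. (b \<omega> - u \<omega> - h (Z \<omega>))\<^sup>2 \<partial>M) \<le> (\<integral>\<omega>. 2 * (d \<omega>)\<^sup>2 + 2 * (g' \<omega> - h (Z \<omega>))\<^sup>2 \<partial>M)"
    unfolding req by (rule integral_mono[OF r2[unfolded req] _ square_add_le])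
       (use d2 h in \<open>intro Bochner_Integration.integrable_add integrable_mult_right\<close>)
  also have "\<dots> \<le> 4 * \<delta>" using d2 h dd by simp
  finally have r4: "(\<integral>\<omega>. (b \<omega> - u \<omega> - h (Z \<omega>))\<^sup>2 \<partial>M) \<le> 4 * \<delta>" .
  note E = cond_exp_square_le[OF prob_space_axioms sub _ d2]
  have ediff: "AE \<omega> in M. u \<omega> - (b \<omega> - real_cond_exp M G b \<omega>) = real_cond_exp M G d \<omega> - d \<omega>"
    using real_cond_exp_diff[OF bint bcint] g'_eq
  proof eventually_elim
    case (elim \<omega>)
    have "real_cond_exp M G d = real_cond_exp M G (\<lambda>\<omega>. b \<omega> - bc \<omega>)" by (simp add: d_def[abs_def])
    then show ?case using elim by (simp add: u_def d_def)
  qed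
  have e2: "integrable M (\<lambda>\<omega>. (real_cond_exp M G d \<omega> - d \<omega>)\<^sup>2)"
    by (rule integrable_diff_square) (use E d2 in auto)
  have e2': "integrable M (\<lambda>\<omega>. (u \<omega> - (b \<omega> - real_cond_exp M G b \<omega>))\<^sup>2)"
    by (rule integrable_cong_AE_imp[OF e2]) (use ediff in \<open>auto elim!: eventually_mono\<close>)
  have "(\<integral>\<omega>. (u \<omega> - (b \<omega> - real_cond_exp M G b \<omega>))\<^sup>2 \<partial>M) = (\<integral>\<omega>. (real_cond_exp M G d \<omega> - d \<omega>)\<^sup>2 \<partial>M)"
    by (rule integral_cong_AE) (use ediff in \<open>auto elim!: eventually_mono\<close>)
  also have "\<dots> \<le> (\<integral>\<omega>. 2 * (real_cond_exp M G d \<omega>)\<^sup>2 + 2 * (d \<omega>)\<^sup>2 \<partial>M)"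
  proof (rule integral_mono[OF e2])
    show "integrable M (\<lambda>\<omega>. 2 * (real_cond_exp M G d \<omega>)\<^sup>2 + 2 * (d \<omega>)\<^sup>2)" using E d2 by simp
    show "(real_cond_exp M G d \<omega> - d \<omega>)\<^sup>2 \<le> 2 * (real_cond_exp M G d \<omega>)\<^sup>2 + 2 * (d \<omega>)\<^sup>2" for \<omega>
      using square_add_le[of "real_cond_exp M G d \<omega>" "- d \<omega>"] by simp
  qed
  also have "\<dots> \<le> 4 * \<delta>" using E d2 dd by simp
  finally have e4: "(\<integral>\<omega>. (u \<omega> - (b \<omega> - real_cond_exp M G b \<omega>))\<^sup>2 \<partial>M) \<le> 4 * \<delta>" .
  show ?thesis
    using ub u0 h(1) r2 r4 e2' e4 by (intro exI[of _ u] exI[of _ "2 * c"] exI[of _ h] exI[of _ L]) auto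
qed

section \<open>Samples grouped by a covariate\<close>

definition dispersion_metric :: "'a set set \<Rightarrow> ('a \<Rightarrow> 'b::metric_space) \<Rightarrow> real" where
  "dispersion_metric P z = (\<Sum>s\<in>P. \<Sum>i\<in>s. \<Sum>j\<in>s. (dist (z i) (z j))\<^sup>2)"

lemma dispersion_lipschitz_le:
  fixes h :: "'b::metric_space \<Rightarrow> real"
  assumes "\<And>x y. \<bar>h x - h y\<bar> \<le> L * dist x y"
  shows "dispersion P (\<lambda>i. h (z i)) \<le> L\<^sup>2 * dispersion_metric P z"
  unfolding dispersion_def dispersion_metric_def sum_distrib_left
proof (intro sum_mono)
  fix s i j
  show "(h (z i) - h (z j))\<^sup>2 \<le> L\<^sup>2 * (dist (z i) (z j))\<^sup>2"
    using power_mono[OF assms[of "z i" "z j"], of 2] by (simp add: power_mult_distrib)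
qed

lemma sigma_sets_rv_events:
  assumes "X \<in> measurable M N"
  shows "sigma_sets (space M) (rv_events M N X) = rv_events M N X"
  using sets_vimage_algebra[of "space M" X N] sets_vimage_algebra2[of X "space M" N] measurable_space[OF assms]
  by (auto simp: rv_events_def)

lemma sigma_sets_compose_rv_events:
  assumes X: "X \<in> measurable M N" and f: "f \<in> measurable N S"
  shows "sigma_sets (space M) {(\<lambda>\<omega>. f (X \<omega>)) -` A \<inter> space M |A. A \<in> sets S} \<subseteq> rv_events M N X"
proof -
  have "(\<lambda>\<omega>. f (X \<omega>)) -` A \<inter> space M \<in> rv_events M N X" if "A \<in> sets S" for A
  proof -
    have "(\<lambda>\<omega>. f (X \<omega>)) -` A \<inter> space M = X -` (f -` A \<inter> space N) \<inter> space M"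
      using measurable_space[OF X] by auto
    then show ?thesis using measurable_sets[OF f that] unfolding rv_events_def by blast
  qed
  then have "{(\<lambda>\<omega>. f (X \<omega>)) -` A \<inter> space M |A. A \<in> sets S} \<subseteq> rv_events M N X" by blast
  from sigma_sets_mono'[OF this, of "space M"] show ?thesis by (simp add: sigma_sets_rv_events[OF X])
qed

lemma (in prob_space) indep_var_compose_rv_events:
  assumes X: "X \<in> measurable M N1" and Y: "Y \<in> measurable M N2"
    and indep: "indep_set (rv_events M N1 X) (rv_events M N2 Y)"
    and f: "f \<in> measurable N1 S" and g: "g \<in> measurable N2 S"
  shows "indep_var S (\<lambda>\<omega>. f (X \<omega>)) S (\<lambda>\<omega>. g (Y \<omega>))"
proof -
  have "indep_set (sigma_sets (space M) {(\<lambda>\<omega>. f (X \<omega>)) -` A \<inter> space M |A. A \<in> sets S})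
     (sigma_sets (space M) {(\<lambda>\<omega>. g (Y \<omega>)) -` A \<inter> space M |A. A \<in> sets S})"
    using indep unfolding indep_set_def
    by (rule indep_sets_mono_sets) (use sigma_sets_compose_rv_events[OF X f] sigma_sets_compose_rv_events[OF Y g] in \<open>auto split: bool.split\<close>)
  then show ?thesis
    unfolding indep_var_eq using measurable_compose[OF X f] measurable_compose[OF Y g] by simp
qed

locale grouped_sample = prob_space M for M :: "'m measure" +
  fixes MW :: "'w measure" and W :: "nat \<Rightarrow> 'm \<Rightarrow> 'w"
    and Z :: "'w \<Rightarrow> 'z::{second_countable_topology, complete_space}"
    and Mp :: "'p measure" and \<pi> :: "nat \<Rightarrow> 'm \<Rightarrow> 'p"
    and part :: "nat \<Rightarrow> 'm \<Rightarrow> nat set set" and k :: nat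
  assumes k2: "2 \<le> k"
    and W_indep: "indep_vars (\<lambda>_. MW) W UNIV"
    and W_ident: "\<And>i. distr M MW (W i) = distr M MW (W 0)"
    and Z_meas[measurable]: "Z \<in> borel_measurable MW"
    and \<pi>_meas[measurable]: "\<And>n. \<pi> n \<in> measurable M Mp"
    and \<pi>_indep: "\<And>n. k dvd n \<Longrightarrow> indep_set (rv_events M Mp (\<pi> n))
       (rv_events M (\<Pi>\<^sub>M i\<in>{..<n}. MW) (\<lambda>\<omega>. restrict (\<lambda>i. W i \<omega>) {..<n}))"
    and part_partition: "\<And>n \<omega>. k dvd n \<Longrightarrow> \<omega> \<in> space M \<Longrightarrow>
       partition_on {..<n} (part n \<omega>) \<and> (\<forall>s\<in>part n \<omega>. card s = k)"
    and part_meas: "\<And>n P. k dvd n \<Longrightarrow> {\<omega>\<in>space M. part n \<omega> = P} \<in>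
       sets (gen_sigma M ((\<Union>i<n. rv_events M borel (\<lambda>\<omega>. Z (W i \<omega>))) \<union> rv_events M Mp (\<pi> n)))"
begin

lemma W_meas[measurable]: "W i \<in> measurable M MW"
  using W_indep by (auto simp: indep_vars_def)

definition \<nu> :: "'w measure" where "\<nu> = distr M MW (W 0)"

lemma sets_nu[simp, measurable_cong]: "sets \<nu> = sets MW" by (simp add: \<nu>_def)
lemma space_nu[simp]: "space \<nu> = space MW" by (simp add: \<nu>_def)

sublocale nu: prob_space \<nu> unfolding \<nu>_def by (rule prob_space_distr) simp

lemma measure_nu_space[simp]: "measure \<nu> (space MW) = 1" using nu.prob_space by simp

lemma integral_W:
  fixes f :: "'w \<Rightarrow> real"
  assumes [measurable]: "f \<in> borel_measurable MW"
  shows "(\<integral>\<omega>. f (W i \<omega>) \<partial>M) = (\<integral>w. f w \<partial>\<nu>)"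
  unfolding \<nu>_def W_ident[of i, symmetric] by (rule integral_distr[symmetric]) auto

lemma integrable_W:
  fixes f :: "'w \<Rightarrow> real"
  assumes [measurable]: "f \<in> borel_measurable MW" and "integrable \<nu> f"
  shows "integrable M (\<lambda>\<omega>. f (W i \<omega>))"
  using assms(2) unfolding \<nu>_def W_ident[of i, symmetric] by (subst (asm) integrable_distr_eq) auto

definition cylinders :: "nat \<Rightarrow> nat \<Rightarrow> 'm set set" where
  "cylinders n i = {{\<omega>\<in>space M. Z (W i \<omega>) \<in> B \<and> (\<forall>j\<in>{..<n} - {i}. W j \<omega> \<in> C j) \<and> \<pi> n \<omega> \<in> E} | B C E.
     B \<in> sets borel \<and> (\<forall>j. C j \<in> sets MW) \<and> E \<in> sets Mp}"

text \<open>The information about the whole sample except that unit i is only known through Z.\<close>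

definition others :: "nat \<Rightarrow> nat \<Rightarrow> 'm measure" where
  "others n i = sigma (space M) (cylinders n i)"

lemma cylindersI:
  "B \<in> sets borel \<Longrightarrow> (\<And>j. C j \<in> sets MW) \<Longrightarrow> E \<in> sets Mp \<Longrightarrow>
   {\<omega>\<in>space M. Z (W i \<omega>) \<in> B \<and> (\<forall>j\<in>{..<n} - {i}. W j \<omega> \<in> C j) \<and> \<pi> n \<omega> \<in> E} \<in> cylinders n i"
  unfolding cylinders_def by blast

lemma cylinders_Pow: "cylinders n i \<subseteq> Pow (space M)"
  unfolding cylinders_def by auto

lemma cylinders_sets: "cylinders n i \<subseteq> sets M"
  unfolding cylinders_def by (auto intro!: sets.sets_Collect_conj sets.sets_Collect_finite_All)

lemma sets_others: "sets (others n i) = sigma_sets (space M) (cylinders n i)"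
  and space_others[simp]: "space (others n i) = space M"
  unfolding others_def using cylinders_Pow by (auto simp: space_measure_of_conv)

lemma subalgebra_others: "subalgebra M (others n i)"
  unfolding subalgebra_def sets_others using cylinders_sets[of n i] by (auto simp: sets.sigma_sets_subset)

lemma cylinders_Int_stable: "Int_stable (cylinders n i)"
proof (rule Int_stableI)
  fix a b assume "a \<in> cylinders n i" "b \<in> cylinders n i"
  then obtain B C E B' C' E' where *:
    "a = {\<omega>\<in>space M. Z (W i \<omega>) \<in> B \<and> (\<forall>j\<in>{..<n} - {i}. W j \<omega> \<in> C j) \<and> \<pi> n \<omega> \<in> E}"
    "b = {\<omega>\<in>space M. Z (W i \<omega>) \<in> B' \<and> (\<forall>j\<in>{..<n} - {i}. W j \<omega> \<in> C' j) \<and> \<pi> n \<omega> \<in> E'}"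
    "B \<in> sets borel" "\<And>j. C j \<in> sets MW" "E \<in> sets Mp" "B' \<in> sets borel" "\<And>j. C' j \<in> sets MW" "E' \<in> sets Mp"
    unfolding cylinders_def by blast
  have "a \<inter> b = {\<omega>\<in>space M. Z (W i \<omega>) \<in> B \<inter> B' \<and> (\<forall>j\<in>{..<n} - {i}. W j \<omega> \<in> C j \<inter> C' j) \<and> \<pi> n \<omega> \<in> E \<inter> E'}"
    unfolding * by auto
  also have "\<dots> \<in> cylinders n i" using * by (intro cylindersI) auto
  finally show "a \<inter> b \<in> cylinders n i" .
qed

lemma W_in_space: "\<omega> \<in> space M \<Longrightarrow> W j \<omega> \<in> space MW"
  using W_meas by (rule measurable_space)

lemma pi_in_space: "\<omega> \<in> space M \<Longrightarrow> \<pi> n \<omega> \<in> space Mp"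
  using \<pi>_meas by (rule measurable_space)

lemma W_meas_others:
  assumes "j < n" "j \<noteq> i"
  shows "W j \<in> measurable (others n i) MW"
proof (rule measurableI)
  fix A assume A: "A \<in> sets MW"
  have "W j -` A \<inter> space (others n i) =
    {\<omega>\<in>space M. Z (W i \<omega>) \<in> UNIV \<and> (\<forall>j'\<in>{..<n} - {i}. W j' \<omega> \<in> (if j' = j then A else space MW)) \<and> \<pi> n \<omega> \<in> space Mp}"
    using assms by (auto simp: W_in_space pi_in_space)
  also have "\<dots> \<in> cylinders n i" using A by (intro cylindersI) auto
  finally show "W j -` A \<inter> space (others n i) \<in> sets (others n i)" by (simp add: sets_others)
qed (simp add: W_in_space)

lemma Z_meas_others:
  assumes "j < n"
  shows "(\<lambda>\<omega>. Z (W j \<omega>)) \<in> borel_measurable (others n i)"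
proof (cases "j = i")
  case True
  show ?thesis
  proof (rule measurableI)
    fix A :: "'z set" assume A: "A \<in> sets borel"
    have "(\<lambda>\<omega>. Z (W j \<omega>)) -` A \<inter> space (others n i) =
      {\<omega>\<in>space M. Z (W i \<omega>) \<in> A \<and> (\<forall>j'\<in>{..<n} - {i}. W j' \<omega> \<in> space MW) \<and> \<pi> n \<omega> \<in> space Mp}"
      using True by (auto simp: W_in_space pi_in_space)
    also have "\<dots> \<in> cylinders n i" using A by (intro cylindersI) auto
    finally show "(\<lambda>\<omega>. Z (W j \<omega>)) -` A \<inter> space (others n i) \<in> sets (others n i)" by (simp add: sets_others)
  qed simp
next
  case False
  note [measurable] = W_meas_others[OF assms False]
  show ?thesis by measurable
qed

lemma pi_meas_others: "\<pi> n \<in> measurable (others n i) Mp"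
proof (rule measurableI)
  fix A assume A: "A \<in> sets Mp"
  have "\<pi> n -` A \<inter> space (others n i) =
    {\<omega>\<in>space M. Z (W i \<omega>) \<in> UNIV \<and> (\<forall>j'\<in>{..<n} - {i}. W j' \<omega> \<in> space MW) \<and> \<pi> n \<omega> \<in> A}"
    by (auto simp: W_in_space)
  also have "\<dots> \<in> cylinders n i" using A by (intro cylindersI) auto
  finally show "\<pi> n -` A \<inter> space (others n i) \<in> sets (others n i)" by (simp add: sets_others)
qed (simp add: pi_in_space)

lemma part_event_others:
  assumes "k dvd n"
  shows "{\<omega>\<in>space M. part n \<omega> = P} \<in> sets (others n i)"
proof -
  let ?G = "(\<Union>i<n. rv_events M borel (\<lambda>\<omega>. Z (W i \<omega>))) \<union> rv_events M Mp (\<pi> n)"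
  have "?G \<subseteq> sets (others n i)"
    using Z_meas_others[of _ n i] pi_meas_others[of n i]
    by (auto simp: rv_events_def measurable_def)
  then have "sigma_sets (space M) ?G \<subseteq> sets (others n i)"
    using sets.sigma_sets_subset[of ?G "others n i"] by simp
  moreover have "?G \<subseteq> Pow (space M)" by (auto simp: rv_events_def)
  then have "sets (gen_sigma M ?G) = sigma_sets (space M) ?G" by (simp add: gen_sigma_def)
  ultimately show ?thesis using part_meas[OF assms, of P] by blast
qed

lemma part_meas_subalgebra:
  assumes "k dvd n" "space N = space M" "\<And>P. {\<omega>\<in>space M. part n \<omega> = P} \<in> sets N"
  shows "part n \<in> measurable N (count_space (Pow (Pow {..<n})))"
proof (subst measurable_count_space_eq2)
  have "part n \<omega> \<subseteq> Pow {..<n}" if "\<omega> \<in> space M" for \<omega>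
    using part_partition[OF assms(1) that] partition_onD1[of "{..<n}" "part n \<omega>"] by auto
  moreover have "part n -` {P} \<inter> space N = {\<omega>\<in>space M. part n \<omega> = P}" for P
    using assms by auto
  ultimately show "part n \<in> space N \<rightarrow> Pow (Pow {..<n}) \<and>
      (\<forall>a\<in>Pow (Pow {..<n}). part n -` {a} \<inter> space N \<in> sets N)"
    using assms by auto
qed simp

lemma part_meas_others: "k dvd n \<Longrightarrow> part n \<in> measurable (others n i) (count_space (Pow (Pow {..<n})))"
  by (rule part_meas_subalgebra) (auto simp: part_event_others)

lemma part_meas_M: "k dvd n \<Longrightarrow> part n \<in> measurable M (count_space (Pow (Pow {..<n})))"
  using part_meas_others[of n 0] by (rule measurable_from_subalg[OF subalgebra_others])

lemma measurable_part_compose: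
  assumes "part n \<in> measurable N (count_space (Pow (Pow {..<n})))"
    and "\<And>P. P \<subseteq> Pow {..<n} \<Longrightarrow> f P \<in> measurable N N'"
  shows "(\<lambda>\<omega>. f (part n \<omega>) \<omega>) \<in> measurable N N'"
  by (rule measurable_compose_countable'[OF _ assms(1)]) (use assms(2) in \<open>auto intro: countable_finite\<close>)

lemma expectation_cylinder:
  fixes u :: "'w \<Rightarrow> real"
  assumes n: "k dvd n" "i < n" and u[measurable]: "u \<in> borel_measurable MW" and K: "\<And>w. \<bar>u w\<bar> \<le> K"
    and u0: "\<And>B. B \<in> sets borel \<Longrightarrow> (\<integral>w. u w * indicator B (Z w) \<partial>\<nu>) = 0"
    and A: "A \<in> cylinders n i"
  shows "(\<integral>\<omega>. u (W i \<omega>) * indicator A \<omega> \<partial>M) = 0"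
proof -
  obtain B C E where A_eq: "A = {\<omega>\<in>space M. Z (W i \<omega>) \<in> B \<and> (\<forall>j\<in>{..<n} - {i}. W j \<omega> \<in> C j) \<and> \<pi> n \<omega> \<in> E}"
    and BCE[measurable]: "B \<in> sets borel" "\<And>j. C j \<in> sets MW" "E \<in> sets Mp"
    using A unfolding cylinders_def by blast
  define f where "f j w = (if j = i then u w * indicator B (Z w) else indicator (C j) w)" for j w
  have f[measurable]: "f j \<in> borel_measurable MW" for j unfolding f_def by (cases "j = i") auto
  have fb: "\<bar>f j w\<bar> \<le> max K 1" for j w
    using K[of w] by (auto simp: f_def indicator_def)
  let ?Wn = "\<lambda>\<omega>. restrict (\<lambda>j. W j \<omega>) {..<n}"
  have Wn[measurable]: "?Wn \<in> measurable M (\<Pi>\<^sub>M j\<in>{..<n}. MW)" by (rule measurable_restrict) simp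
  have prod_meas: "(\<lambda>x. \<Prod>j<n. f j (x j)) \<in> borel_measurable (\<Pi>\<^sub>M j\<in>{..<n}. MW)"
    by (rule borel_measurable_prod) measurable
  have iv: "indep_var borel (\<lambda>\<omega>. indicat_real E (\<pi> n \<omega>)) borel (\<lambda>\<omega>. \<Prod>j<n. f j (?Wn \<omega> j))"
    by (rule indep_var_compose_rv_events[OF \<pi>_meas Wn \<pi>_indep[OF n(1)] _ prod_meas]) simp
  have "indep_vars (\<lambda>_. MW) W {..<n}" by (rule indep_vars_subset[OF W_indep]) simp
  then have ivs: "indep_vars (\<lambda>_. borel) (\<lambda>j \<omega>. f j (W j \<omega>)) {..<n}"
    by (rule indep_vars_compose2) simp
  have int: "integrable M (\<lambda>\<omega>. f j (W j \<omega>))" for j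
    by (rule integrable_const_bound[where B="max K 1"]) (use fb in auto)
  have "(\<integral>\<omega>. f i (W i \<omega>) \<partial>M) = (\<integral>w. f i w \<partial>\<nu>)" by (rule integral_W) simp
  also have "\<dots> = 0" using u0[OF BCE(1)] by (simp add: f_def)
  finally have "(\<integral>\<omega>. (\<Prod>j<n. f j (W j \<omega>)) \<partial>M) = 0"
    using n(2) by (subst indep_vars_lebesgue_integral[OF _ ivs int]) auto
  moreover have "integrable M (\<lambda>\<omega>. \<Prod>j<n. f j (W j \<omega>))"
    by (rule indep_vars_integrable[OF _ ivs int]) simp
  moreover have "integrable M (\<lambda>\<omega>. indicat_real E (\<pi> n \<omega>))"
    by (rule integrable_const_bound[where B=1]) (auto simp: indicator_def)
  ultimately have "(\<integral>\<omega>. indicat_real E (\<pi> n \<omega>) * (\<Prod>j<n. f j (W j \<omega>)) \<partial>M) = 0"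
    using indep_var_lebesgue_integral[OF iv] by simp
  moreover have "indicat_real E (\<pi> n \<omega>) * (\<Prod>j<n. f j (W j \<omega>)) = u (W i \<omega>) * indicator A \<omega>" if "\<omega> \<in> space M" for \<omega>
  proof -
    have "(\<Prod>j<n. f j (W j \<omega>)) = f i (W i \<omega>) * (\<Prod>j\<in>{..<n} - {i}. f j (W j \<omega>))"
      using n(2) by (subst prod.remove[of _ i]) auto
    also have "(\<Prod>j\<in>{..<n} - {i}. f j (W j \<omega>)) = (\<Prod>j\<in>{..<n} - {i}. indicator (C j) (W j \<omega>))"
      by (rule prod.cong) (auto simp: f_def)
    also have "\<dots> = of_bool (\<forall>j\<in>{..<n} - {i}. W j \<omega> \<in> C j)"
    proof (cases "\<forall>j\<in>{..<n} - {i}. W j \<omega> \<in> C j")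
      case True
      have "(\<Prod>j\<in>{..<n} - {i}. indicator (C j) (W j \<omega>)) = (\<Prod>j\<in>{..<n} - {i}. 1::real)"
        by (rule prod.cong) (use True in auto)
      with True show ?thesis by simp
    next
      case False
      then obtain j where "j \<in> {..<n} - {i}" "W j \<omega> \<notin> C j" by blast
      then have "(\<Prod>j\<in>{..<n} - {i}. indicator (C j) (W j \<omega>)) = (0::real)"
        by (intro prod_zero bexI[of _ j]) auto
      then show ?thesis using False by simp
    qed
    finally show ?thesis using that by (auto simp: f_def A_eq indicator_def)
  qed
  ultimately show ?thesis by (simp cong: Bochner_Integration.integral_cong)
qed

lemma expectation_others_event:
  fixes u :: "'w \<Rightarrow> real"
  assumes n: "k dvd n" "i < n" and u[measurable]: "u \<in> borel_measurable MW" and K: "\<And>w. \<bar>u w\<bar> \<le> K"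
    and u0: "\<And>B. B \<in> sets borel \<Longrightarrow> (\<integral>w. u w * indicator B (Z w) \<partial>\<nu>) = 0"
    and A: "A \<in> sets (others n i)"
  shows "(\<integral>\<omega>. u (W i \<omega>) * indicator A \<omega> \<partial>M) = 0"
proof -
  have int: "integrable M (\<lambda>\<omega>. u (W i \<omega>))"
    by (rule integrable_const_bound[where B=K]) (use K in auto)
  have sub: "A \<in> sets M" if "A \<in> sigma_sets (space M) (cylinders n i)" for A
    using that subalgebra_others[of n i] by (auto simp: subalgebra_def sets_others)
  have intA: "integrable M (\<lambda>\<omega>. u (W i \<omega>) * indicator A \<omega>)" if "A \<in> sets M" for A
    using integrable_mult_indicator[OF that int] by (simp add: mult.commute)
  have total: "(\<integral>\<omega>. u (W i \<omega>) \<partial>M) = 0"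
    using u0[of UNIV] integral_W[of u i] by simp
  show ?thesis using cylinders_Int_stable cylinders_Pow A[unfolded sets_others]
  proof (induction rule: sigma_sets_induct_disjoint)
    case (basic A)
    then show ?case by (intro expectation_cylinder[OF n u K u0])
  next
    case empty
    show ?case by simp
  next
    case (compl A)
    have "(\<integral>\<omega>. u (W i \<omega>) * indicator (space M - A) \<omega> \<partial>M)
        = (\<integral>\<omega>. u (W i \<omega>) - u (W i \<omega>) * indicator A \<omega> \<partial>M)"
      by (rule Bochner_Integration.integral_cong) (auto simp: indicator_def)
    also have "\<dots> = 0" using compl int intA[OF sub] total by simp
    finally show ?case .
  next
    case (union A)
    have Am: "A j \<in> sets M" for j using union sub by blast
    have "(LINT \<omega>:(\<Union>j. A j)|M. u (W i \<omega>)) = (\<Sum>j. LINT \<omega>:(A j)|M. u (W i \<omega>))"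
    proof (rule lebesgue_integral_countable_add)
      show "set_integrable M (\<Union>j. A j) (\<lambda>\<omega>. u (W i \<omega>))"
        unfolding set_integrable_def using Am by (intro integrable_mult_indicator int) auto
      show "A j \<inter> A l = {}" if "j \<noteq> l" for j l using union(1) that by (auto simp: disjoint_family_on_def)
    qed (rule Am)
    then show ?case using union by (simp add: set_lebesgue_integral_def mult.commute)
  qed
qed

lemma expectation_others:
  fixes u :: "'w \<Rightarrow> real"
  assumes n: "k dvd n" "i < n" and u[measurable]: "u \<in> borel_measurable MW" and K: "\<And>w. \<bar>u w\<bar> \<le> K"
    and u0: "\<And>B. B \<in> sets borel \<Longrightarrow> (\<integral>w. u w * indicator B (Z w) \<partial>\<nu>) = 0"
    and R: "R \<in> borel_measurable (others n i)" and RK: "\<And>\<omega>. \<omega> \<in> space M \<Longrightarrow> \<bar>R \<omega>\<bar> \<le> K'"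
  shows "(\<integral>\<omega>. u (W i \<omega>) * R \<omega> \<partial>M) = 0"
proof -
  interpret S: finite_measure_subalgebra M "others n i"
    using subalgebra_others by (simp add: finite_measure_subalgebra_def finite_measure_subalgebra_axioms_def finite_measure_axioms)
  have [measurable]: "R \<in> borel_measurable M" using R by (rule measurable_from_subalg[OF subalgebra_others])
  have int: "integrable M (\<lambda>\<omega>. u (W i \<omega>))"
    by (rule integrable_const_bound[where B=K]) (use K in auto)
  have intR: "integrable M (\<lambda>\<omega>. R \<omega> * u (W i \<omega>))"
  proof (rule integrable_const_bound[where B="K' * K"])
    show "AE \<omega> in M. norm (R \<omega> * u (W i \<omega>)) \<le> K' * K"
    proof (rule AE_I2)
      fix \<omega> assume \<omega>: "\<omega> \<in> space M"
      have "0 \<le> K'" using RK[OF \<omega>] by linarith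
      then show "norm (R \<omega> * u (W i \<omega>)) \<le> K' * K"
        unfolding real_norm_def abs_mult by (intro mult_mono RK[OF \<omega>] K) auto
    qed
  qed simp
  have "AE \<omega> in M. real_cond_exp M (others n i) (\<lambda>\<omega>. u (W i \<omega>)) \<omega> = 0"
  proof (rule S.real_cond_exp_charact)
    fix A assume "A \<in> sets (others n i)"
    then show "(LINT \<omega>:A|M. u (W i \<omega>)) = (LINT \<omega>:A|M. 0)"
      using expectation_others_event[OF n u K u0] by (simp add: set_lebesgue_integral_def mult.commute)
  qed (use int in auto)
  then have "(\<integral>\<omega>. R \<omega> * real_cond_exp M (others n i) (\<lambda>\<omega>. u (W i \<omega>)) \<omega> \<partial>M) = 0"
    by (intro integral_eq_zero_AE) (auto elim!: eventually_mono)
  then show ?thesis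
    using S.real_cond_exp_intg(2)[OF intR R] by (simp add: mult.commute)
qed

end

section \<open>Limit of the dispersion\<close>

lemma tendsto_0_of_eventually_le:
  fixes p :: "nat \<Rightarrow> real"
  assumes "\<And>m. 0 \<le> p m" "\<And>\<kappa>. \<kappa> > 0 \<Longrightarrow> eventually (\<lambda>m. p m \<le> \<kappa>) sequentially"
  shows "p \<longlonglongrightarrow> 0"
proof (rule tendstoI)
  fix e :: real assume "e > 0"
  then have "eventually (\<lambda>m. p m \<le> e / 2) sequentially" using assms(2)[of "e/2"] by simp
  then show "eventually (\<lambda>m. dist (p m) 0 < e) sequentially"
    by eventually_elim (use \<open>e > 0\<close> assms(1) in \<open>auto simp: abs_of_nonneg\<close>)
qed

context grouped_sample begin

lemma dispersion_meas:
  assumes "k dvd n" "\<And>i. y i \<in> borel_measurable M"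
  shows "(\<lambda>\<omega>. dispersion (part n \<omega>) (\<lambda>i. y i \<omega>)) \<in> borel_measurable M"
  unfolding dispersion_def
  by (rule measurable_part_compose[OF part_meas_M[OF assms(1)]]) (use assms(2) in measurable)

lemma dispersion_metric_meas:
  assumes "k dvd n"
  shows "(\<lambda>\<omega>. dispersion_metric (part n \<omega>) (\<lambda>i. Z (W i \<omega>))) \<in> borel_measurable M"
  unfolding dispersion_metric_def
  by (rule measurable_part_compose[OF part_meas_M[OF assms(1)]]) measurable

lemma expectation_mult_indep:
  fixes f :: "'w \<Rightarrow> real"
  assumes f[measurable]: "f \<in> borel_measurable MW" and "integrable \<nu> f" "(\<integral>w. f w \<partial>\<nu>) = 0" "i \<noteq> j"
  shows "(\<integral>\<omega>. f (W j \<omega>) * f (W i \<omega>) \<partial>M) = 0"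
proof -
  have "indep_vars (\<lambda>_. MW) W {i, j}" by (rule indep_vars_subset[OF W_indep]) simp
  then have "indep_vars (\<lambda>_. borel) (\<lambda>i \<omega>. f (W i \<omega>)) {i, j}"
    by (rule indep_vars_compose2) simp
  then have "(\<integral>\<omega>. (\<Prod>l\<in>{i,j}. f (W l \<omega>)) \<partial>M) = (\<Prod>l\<in>{i,j}. \<integral>\<omega>. f (W l \<omega>) \<partial>M)"
    by (intro indep_vars_lebesgue_integral) (use integrable_W[OF f assms(2)] in auto)
  then show ?thesis using assms integral_W[OF f] by (simp add: mult.commute)
qed

lemma dispersion_centred_limit:
  fixes u :: "'w \<Rightarrow> real"
  assumes u[measurable]: "u \<in> borel_measurable MW" and K: "\<And>w. \<bar>u w\<bar> \<le> K"
    and u0: "\<And>B. B \<in> sets borel \<Longrightarrow> (\<integral>w. u w * indicator B (Z w) \<partial>\<nu>) = 0" and \<epsilon>: "\<epsilon> > 0"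
  shows "(\<lambda>m. prob {\<omega>\<in>space M. \<bar>dispersion (part (k * m) \<omega>) (\<lambda>i. u (W i \<omega>)) / real (k * m)
      - 2 * (real k - 1) * (\<integral>w. (u w)\<^sup>2 \<partial>\<nu>)\<bar> > \<epsilon>}) \<longlonglongrightarrow> 0"
proof -
  define m2 where "m2 = (\<integral>w. (u w)\<^sup>2 \<partial>\<nu>)"
  define K2 where "K2 = 2 * (real k - 1)"
  have K2: "K2 > 0" using k2 by (simp add: K2_def)
  have K0: "K \<ge> 0" using K[of undefined] by linarith
  have uK: "(u w)\<^sup>2 \<le> K\<^sup>2" for w using K[of w] K0 by (simp add: abs_le_square_iff[symmetric])
  have u2int: "integrable \<nu> (\<lambda>w. (u w)\<^sup>2)"
    by (rule nu.integrable_const_bound[where B="K\<^sup>2"]) (use uK in auto)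
  have m2: "0 \<le> m2" "m2 \<le> K\<^sup>2"
    using integral_mono[OF u2int, of "\<lambda>_. K\<^sup>2"] uK by (auto simp: m2_def)
  define C where "C = (K\<^sup>2)\<^sup>2 / (\<epsilon> / (2 * K2))\<^sup>2 + (real k * K\<^sup>2)\<^sup>2 / (\<epsilon> / 8)\<^sup>2"
  have bound: "prob {\<omega>\<in>space M. \<bar>dispersion (part (k * m) \<omega>) (\<lambda>i. u (W i \<omega>)) / real (k * m) - K2 * m2\<bar> > \<epsilon>}
      \<le> C / real k / real m" if m: "m > 0" for m
  proof -
    define n where "n = k * m"
    have n: "k dvd n" "n > 0" using m k2 by (auto simp: n_def)
    define X1 where "X1 i \<omega> = (u (W i \<omega>))\<^sup>2 - m2" for i \<omega>
    define Tm where "Tm j \<omega> = (\<Sum>i<j. of_bool (linked (part n \<omega>) i j) * u (W i \<omega>))" for j \<omega>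
    define X2 where "X2 j \<omega> = u (W j \<omega>) * Tm j \<omega>" for j \<omega>
    have [measurable]: "X1 i \<in> borel_measurable M" for i unfolding X1_def by measurable
    have Tm_others: "Tm j \<in> borel_measurable (others n i)" if "j \<le> i" "i < n" for i j
      unfolding Tm_def
    proof (rule measurable_part_compose[OF part_meas_others[OF n(1)]])
      fix P :: "nat set set"
      have [measurable]: "(\<lambda>\<omega>. u (W l \<omega>)) \<in> borel_measurable (others n i)" if "l < j" for l
        using W_meas_others[of l n i] that \<open>j \<le> i\<close> \<open>i < n\<close> by (intro measurable_compose[OF _ u]) auto
      show "(\<lambda>\<omega>. \<Sum>l<j. of_bool (linked P l j) * u (W l \<omega>)) \<in> borel_measurable (others n i)"
        by (rule borel_measurable_sum) auto
    qed
    have Tm_meas: "Tm j \<in> borel_measurable M" if "j < n" for j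
      using Tm_others[of j j] that by (intro measurable_from_subalg[OF subalgebra_others]) auto
    have X2_meas: "X2 j \<in> borel_measurable M" if "j < n" for j
      unfolding X2_def using Tm_meas[OF that] by measurable
    have Tb: "\<bar>Tm j \<omega>\<bar> \<le> real k * K" if "j < n" "\<omega> \<in> space M" for j \<omega>
    proof -
      note P = part_partition[OF n(1) that(2)]
      have "\<bar>Tm j \<omega>\<bar> \<le> (\<Sum>i<j. of_bool (linked (part n \<omega>) j i) * K)"
        unfolding Tm_def using K K0
        by (intro order_trans[OF sum_abs] sum_mono) (auto simp: abs_mult linked_def)
      also have "\<dots> \<le> (\<Sum>i<n. of_bool (linked (part n \<omega>) j i) * K)"
        using that K0 by (intro sum_mono2) auto
      also have "\<dots> = real k * K"
        using sum_linked_card[of "{..<n}" "part n \<omega>" k j] P that by (simp only: sum_distrib_right[symmetric]) auto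
      finally show ?thesis .
    qed
    have X2b: "\<bar>X2 j \<omega>\<bar> \<le> real k * K\<^sup>2" if "j < n" "\<omega> \<in> space M" for j \<omega>
    proof -
      have "\<bar>X2 j \<omega>\<bar> \<le> K * (real k * K)"
        unfolding X2_def abs_mult using K0 by (intro mult_mono K Tb that) auto
      then show ?thesis by (simp add: power2_eq_square mult_ac)
    qed
    have X1b: "\<bar>X1 j \<omega>\<bar> \<le> K\<^sup>2" for j \<omega>
      using uK[of "W j \<omega>"] m2 by (simp add: X1_def abs_le_iff) (smt (verit) zero_le_power2)
    have o1: "(\<integral>\<omega>. X1 j \<omega> * X1 i \<omega> \<partial>M) = 0" if "i < j" for i j
      unfolding X1_def using that u2int
      by (intro expectation_mult_indep) (auto simp: m2_def)
    have o2: "(\<integral>\<omega>. X2 j \<omega> * X2 i \<omega> \<partial>M) = 0" if "i < j" "j < n" for i j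
    proof -
      have "(\<integral>\<omega>. u (W j \<omega>) * (Tm j \<omega> * X2 i \<omega>) \<partial>M) = 0"
      proof (rule expectation_others[OF n(1) \<open>j < n\<close> u K u0])
        have [measurable]: "(\<lambda>\<omega>. u (W i \<omega>)) \<in> borel_measurable (others n j)"
          using W_meas_others[of i n j] that by (intro measurable_compose[OF _ u]) auto
        show "(\<lambda>\<omega>. Tm j \<omega> * X2 i \<omega>) \<in> borel_measurable (others n j)"
          unfolding X2_def using Tm_others[of j j] Tm_others[of i j] that by (intro borel_measurable_times) auto
        show "\<bar>Tm j \<omega> * X2 i \<omega>\<bar> \<le> (real k * K) * (real k * K\<^sup>2)" if "\<omega> \<in> space M" for \<omega>
          unfolding abs_mult using K0 \<open>i < j\<close> \<open>j < n\<close> that by (intro mult_mono Tb X2b) auto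
      qed
      then show ?thesis unfolding X2_def by (simp add: mult.assoc)
    qed
    have p1: "prob {\<omega> \<in> space M. \<bar>(\<Sum>i<n. X1 i \<omega>) / real n\<bar> \<ge> \<epsilon> / (2 * K2)} \<le> (K\<^sup>2)\<^sup>2 / (real n * (\<epsilon> / (2 * K2))\<^sup>2)"
      by (rule orthogonal_average_prob_le) (use X1b o1 n \<epsilon> K2 in auto)
    have p2: "prob {\<omega> \<in> space M. \<bar>(\<Sum>i<n. X2 i \<omega>) / real n\<bar> \<ge> \<epsilon> / 8} \<le> (real k * K\<^sup>2)\<^sup>2 / (real n * (\<epsilon> / 8)\<^sup>2)"
      by (rule orthogonal_average_prob_le) (use X2b X2_meas o2 n \<epsilon> in auto)
    have meas: "{\<omega> \<in> space M. \<bar>(\<Sum>i<n. X1 i \<omega>) / real n\<bar> \<ge> \<epsilon> / (2 * K2)} \<in> events"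
      "{\<omega> \<in> space M. \<bar>(\<Sum>i<n. X2 i \<omega>) / real n\<bar> \<ge> \<epsilon> / 8} \<in> events"
    proof -
      have [measurable]: "(\<lambda>\<omega>. \<Sum>i<n. X2 i \<omega>) \<in> borel_measurable M"
        using X2_meas by (intro borel_measurable_sum) auto
      show "{\<omega> \<in> space M. \<bar>(\<Sum>i<n. X1 i \<omega>) / real n\<bar> \<ge> \<epsilon> / (2 * K2)} \<in> events" by measurable
      show "{\<omega> \<in> space M. \<bar>(\<Sum>i<n. X2 i \<omega>) / real n\<bar> \<ge> \<epsilon> / 8} \<in> events" by measurable
    qed
    have "{\<omega>\<in>space M. \<bar>dispersion (part n \<omega>) (\<lambda>i. u (W i \<omega>)) / real n - K2 * m2\<bar> > \<epsilon>}
      \<subseteq> {\<omega> \<in> space M. \<bar>(\<Sum>i<n. X1 i \<omega>) / real n\<bar> \<ge> \<epsilon> / (2 * K2)} \<union> {\<omega> \<in> space M. \<bar>(\<Sum>i<n. X2 i \<omega>) / real n\<bar> \<ge> \<epsilon> / 8}"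
      (is "?L \<subseteq> ?R")
    proof (rule subsetI, rule ccontr)
      fix \<omega> assume "\<omega> \<in> ?L" and "\<omega> \<notin> ?R"
      then have \<omega>: "\<omega> \<in> space M" "\<bar>dispersion (part n \<omega>) (\<lambda>i. u (W i \<omega>)) / real n - K2 * m2\<bar> > \<epsilon>"
        and s: "\<bar>(\<Sum>i<n. X1 i \<omega>) / real n\<bar> < \<epsilon> / (2 * K2)" "\<bar>(\<Sum>i<n. X2 i \<omega>) / real n\<bar> < \<epsilon> / 8"
        by (auto simp: not_le)
      note P = part_partition[OF n(1) \<omega>(1)]
      have "dispersion (part n \<omega>) (\<lambda>i. u (W i \<omega>)) = K2 * (\<Sum>i<n. (u (W i \<omega>))\<^sup>2) - 4 * (\<Sum>i<n. X2 i \<omega>)"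
        using dispersion_expand[of n "part n \<omega>" k "\<lambda>i. u (W i \<omega>)"] P by (simp add: K2_def X2_def Tm_def)
      also have "(\<Sum>i<n. (u (W i \<omega>))\<^sup>2) = (\<Sum>i<n. X1 i \<omega>) + real n * m2"
        by (simp add: X1_def sum_subtractf)
      finally have "dispersion (part n \<omega>) (\<lambda>i. u (W i \<omega>)) / real n - K2 * m2
          = K2 * ((\<Sum>i<n. X1 i \<omega>) / real n) - 4 * ((\<Sum>i<n. X2 i \<omega>) / real n)"
        using n by (simp add: field_simps)
      also have "\<bar>\<dots>\<bar> \<le> K2 * \<bar>(\<Sum>i<n. X1 i \<omega>) / real n\<bar> + 4 * \<bar>(\<Sum>i<n. X2 i \<omega>) / real n\<bar>"
        using K2 by (intro order_trans[OF abs_triangle_ineq4]) (simp add: abs_mult)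
      also have "\<dots> < \<epsilon>"
      proof -
        have "K2 * \<bar>(\<Sum>i<n. X1 i \<omega>) / real n\<bar> < K2 * (\<epsilon> / (2 * K2))"
          using s(1) K2 by (rule mult_strict_left_mono)
        also have "\<dots> = \<epsilon> / 2" using K2 by simp
        finally show ?thesis using s(2) by linarith
      qed
      finally show False using \<omega>(2) by simp
    qed
    from order_trans[OF finite_measure_mono[OF this sets.Un[OF meas]] measure_Un_le[OF meas]]
    have "prob {\<omega>\<in>space M. \<bar>dispersion (part n \<omega>) (\<lambda>i. u (W i \<omega>)) / real n - K2 * m2\<bar> > \<epsilon>}
      \<le> (K\<^sup>2)\<^sup>2 / (real n * (\<epsilon> / (2 * K2))\<^sup>2) + (real k * K\<^sup>2)\<^sup>2 / (real n * (\<epsilon> / 8)\<^sup>2)"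
      using p1 p2 by linarith
    also have "\<dots> = C / real n" by (simp add: C_def add_divide_distrib mult.commute)
    also have "\<dots> = C / real k / real m" by (simp add: n_def)
    finally show ?thesis unfolding n_def .
  qed
  show ?thesis
    unfolding K2_def[symmetric] m2_def[symmetric]
  proof (rule tendsto_sandwich[where f="\<lambda>_. 0"])
    show "(\<lambda>m. C / real k / real m) \<longlonglongrightarrow> 0" by (rule lim_const_over_n)
  qed (use bound in \<open>auto intro!: eventually_mono[OF eventually_gt_at_top[of 0]]\<close>)
qed

lemma dispersion_limit:
  fixes b :: "'w \<Rightarrow> real"
  assumes b[measurable]: "b \<in> borel_measurable MW" and b2: "integrable \<nu> (\<lambda>w. (b w)\<^sup>2)"
    and close: "\<And>\<epsilon>. \<epsilon> > 0 \<Longrightarrow> (\<lambda>m. prob {\<omega>\<in>space M.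
       dispersion_metric (part (k * m) \<omega>) (\<lambda>i. Z (W i \<omega>)) / real (k * m) > \<epsilon>}) \<longlonglongrightarrow> 0"
    and \<epsilon>: "\<epsilon> > 0"
  defines "v0 \<equiv> (\<integral>w. (b w - real_cond_exp \<nu> (vimage_algebra (space MW) Z borel) b w)\<^sup>2 \<partial>\<nu>)"
  shows "(\<lambda>m. prob {\<omega>\<in>space M. \<bar>dispersion (part (k * m) \<omega>) (\<lambda>i. b (W i \<omega>)) / real (k * m)
      - 2 * (real k - 1) * v0\<bar> > \<epsilon>}) \<longlonglongrightarrow> 0"
proof (rule tendsto_0_of_eventually_le)
  fix \<kappa> :: real assume \<kappa>: "\<kappa> > 0"
  define G where "G = vimage_algebra (space MW) Z borel"
  define y where "y w = b w - real_cond_exp \<nu> G b w" for w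
  have sub: "subalgebra \<nu> G"
    unfolding subalgebra_def G_def by (auto simp: sets_vimage_algebra2)
  note E = cond_exp_square_le[OF nu.prob_space_axioms sub _ b2]
  have [measurable]: "y \<in> borel_measurable MW"
    using borel_measurable_cond_exp2[of \<nu> G b] unfolding y_def by measurable
  have y2: "integrable \<nu> (\<lambda>w. (y w)\<^sup>2)" unfolding y_def by (rule integrable_diff_square) (use b2 E in auto)
  have v0: "v0 = (\<integral>w. (y w)\<^sup>2 \<partial>\<nu>)" by (simp add: v0_def y_def G_def)
  have v00: "v0 \<ge> 0" unfolding v0 by simp
  define K2 where "K2 = 2 * (real k - 1)"
  have K2: "K2 > 0" using k2 by (simp add: K2_def)
  have k0: "real k > 0" using k2 by simp
  define \<eta> where "\<eta> = min 1 (\<epsilon> / (24 * K2 * (v0 + 1)))"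
  have \<eta>: "\<eta> > 0" "\<eta> \<le> 1" using \<epsilon> K2 v00 by (auto simp: \<eta>_def)
  have \<eta>v: "3 * \<eta> * K2 * v0 \<le> \<epsilon> / 8"
  proof -
    have "\<eta> * (24 * K2 * (v0 + 1)) \<le> \<epsilon>"
      using K2 v00 by (simp add: \<eta>_def min_def pos_le_divide_eq split: if_splits)
    moreover have "\<eta> * K2 * v0 \<le> \<eta> * K2 * (v0 + 1)" using \<eta> K2 by simp
    ultimately show ?thesis by (simp add: algebra_simps)
  qed
  define \<beta> where "\<beta> = 1 + 1 / \<eta>"
  have \<beta>: "\<beta> > 0" using \<eta> by (simp add: \<beta>_def add_pos_pos)
  define \<delta> where "\<delta> = min (\<epsilon> / (64 * K2 * \<beta>)) (\<kappa> * \<epsilon> / (256 * real k * \<beta>))"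
  have \<delta>: "\<delta> > 0" using \<epsilon> K2 \<beta> \<kappa> k0 by (simp add: \<delta>_def)
  have \<delta>1: "8 * K2 * \<beta> * \<delta> \<le> \<epsilon> / 8"
  proof -
    have "\<delta> \<le> \<epsilon> / (64 * K2 * \<beta>)" by (simp add: \<delta>_def)
    then show ?thesis using K2 \<beta> by (simp add: field_simps)
  qed
  have \<delta>2: "(4 * real k * (4 * \<delta>)) / (\<epsilon> / (8 * \<beta>)) \<le> \<kappa> / 2"
  proof -
    have "\<delta> \<le> \<kappa> * \<epsilon> / (256 * real k * \<beta>)" by (simp add: \<delta>_def)
    then show ?thesis using k0 \<beta> \<epsilon> by (simp add: field_simps)
  qed
  obtain u K h L where u[measurable]: "u \<in> borel_measurable \<nu>" and K: "\<And>w. \<bar>u w\<bar> \<le> K"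
    and u0: "\<And>B. B \<in> sets borel \<Longrightarrow> (\<integral>w. u w * indicator B (Z w) \<partial>\<nu>) = 0"
    and h: "\<And>x y. \<bar>h x - h y\<bar> \<le> L * dist x y"
    and r2: "integrable \<nu> (\<lambda>w. (b w - u w - h (Z w))\<^sup>2)" "(\<integral>w. (b w - u w - h (Z w))\<^sup>2 \<partial>\<nu>) \<le> 4 * \<delta>"
    and e2: "integrable \<nu> (\<lambda>w. (u w - y w)\<^sup>2)" "(\<integral>w. (u w - y w)\<^sup>2 \<partial>\<nu>) \<le> 4 * \<delta>"
  proof -
    have "Z \<in> borel_measurable \<nu>" "b \<in> borel_measurable \<nu>" by simp_all
    from nu.centred_lipschitz_decomposition[OF this b2 \<delta>]
    show thesis unfolding space_nu G_def[symmetric] y_def[symmetric] by (elim exE conjE) (rule that, auto)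
  qed
  have u'[measurable]: "u \<in> borel_measurable MW" using u by simp
  have [measurable]: "h \<in> borel_measurable borel" by (rule borel_measurable_of_lipschitz[OF h])
  define r where "r w = b w - u w - h (Z w)" for w
  have r[measurable]: "r \<in> borel_measurable MW" unfolding r_def by measurable
  define m2 where "m2 = (\<integral>w. (u w)\<^sup>2 \<partial>\<nu>)"
  have u2int: "integrable \<nu> (\<lambda>w. (u w)\<^sup>2)"
  proof (rule nu.integrable_const_bound[where B="K\<^sup>2"])
    have "(u w)\<^sup>2 \<le> K\<^sup>2" for w using power_mono[OF K[of w], of 2] by simp
    then show "AE w in \<nu>. norm ((u w)\<^sup>2) \<le> K\<^sup>2" by simp
  qed simp
  have m2v0: "\<bar>m2 - v0\<bar> \<le> \<eta> * v0 + \<beta> * (4 * \<delta>)"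
  proof -
    have "m2 - v0 = (\<integral>w. (u w)\<^sup>2 - (y w)\<^sup>2 \<partial>\<nu>)" using u2int y2 by (simp add: m2_def v0)
    also have "\<bar>\<dots>\<bar> \<le> (\<integral>w. \<bar>(u w)\<^sup>2 - (y w)\<^sup>2\<bar> \<partial>\<nu>)" by (rule integral_abs_bound)
    also have "\<dots> \<le> (\<integral>w. \<eta> * (y w)\<^sup>2 + \<beta> * (u w - y w)\<^sup>2 \<partial>\<nu>)"
    proof (rule integral_mono)
      show "\<bar>(u w)\<^sup>2 - (y w)\<^sup>2\<bar> \<le> \<eta> * (y w)\<^sup>2 + \<beta> * (u w - y w)\<^sup>2" for w
        using abs_square_add_diff_le[OF \<eta>(1), of "y w" "u w - y w"] by (simp add: \<beta>_def)
    qed (use u2int y2 e2 in auto)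
    also have "\<dots> = \<eta> * v0 + \<beta> * (\<integral>w. (u w - y w)\<^sup>2 \<partial>\<nu>)" using y2 e2 by (simp add: v0)
    also have "\<dots> \<le> \<eta> * v0 + \<beta> * (4 * \<delta>)" using e2 \<beta> by simp
    finally show ?thesis .
  qed
  have det: "\<eta> * K2 * m2 + K2 * \<bar>m2 - v0\<bar> \<le> \<epsilon> / 4"
  proof -
    have "\<eta> * K2 * m2 + K2 * \<bar>m2 - v0\<bar> \<le> \<eta> * K2 * (v0 + \<bar>m2 - v0\<bar>) + K2 * \<bar>m2 - v0\<bar>"
      using \<eta> K2 by (intro add_right_mono mult_left_mono) auto
    also have "\<dots> = \<eta> * K2 * v0 + (\<eta> + 1) * (K2 * \<bar>m2 - v0\<bar>)" by (simp add: algebra_simps)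
    also have "\<dots> \<le> \<eta> * K2 * v0 + 2 * (K2 * (\<eta> * v0 + \<beta> * (4 * \<delta>)))"
      using \<eta> K2 m2v0 by (intro add_left_mono mult_mono) auto
    also have "\<dots> = 3 * \<eta> * K2 * v0 + 8 * K2 * \<beta> * \<delta>" by (simp add: algebra_simps)
    also have "\<dots> \<le> \<epsilon> / 4" using \<eta>v \<delta>1 by simp
    finally show ?thesis .
  qed
  define Q where "Q f m \<omega> = dispersion (part (k * m) \<omega>) (\<lambda>i. f (W i \<omega>)) / real (k * m)" for f :: "'w \<Rightarrow> real" and m \<omega>
  define \<Psi> where "\<Psi> m \<omega> = dispersion_metric (part (k * m) \<omega>) (\<lambda>i. Z (W i \<omega>)) / real (k * m)" for m \<omega>
  have Q_meas: "Q f m \<in> borel_measurable M" if [measurable]: "f \<in> borel_measurable MW" for f m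
    unfolding Q_def by (intro borel_measurable_divide dispersion_meas) auto
  have [measurable]: "\<Psi> m \<in> borel_measurable M" for m
    unfolding \<Psi>_def by (intro borel_measurable_divide dispersion_metric_meas) auto
  note [measurable] = Q_meas[OF b] Q_meas[OF u'] Q_meas[OF r]
  have pr: "prob {\<omega>\<in>space M. Q r m \<omega> \<ge> \<epsilon> / (8 * \<beta>)} \<le> \<kappa> / 2" if m: "m > 0" for m
  proof -
    define n where "n = k * m"
    have n: "k dvd n" "real n > 0" using m k2 by (auto simp: n_def)
    have rint: "integrable M (\<lambda>\<omega>. (r (W i \<omega>))\<^sup>2)" for i
      by (rule integrable_W) (use r2 in \<open>auto simp: r_def\<close>)
    have Qle: "Q r m \<omega> \<le> 4 * real k * (\<Sum>i<n. (r (W i \<omega>))\<^sup>2) / real n" if "\<omega> \<in> space M" for \<omega>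
      unfolding Q_def n_def[symmetric] using part_partition[OF n(1) that] n
      by (intro divide_right_mono dispersion_le) auto
    have I: "integrable M (\<lambda>\<omega>. 4 * real k * (\<Sum>i<n. (r (W i \<omega>))\<^sup>2) / real n)"
      using rint by auto
    have "prob {\<omega>\<in>space M. Q r m \<omega> \<ge> \<epsilon> / (8 * \<beta>)}
        \<le> prob {\<omega>\<in>space M. 4 * real k * (\<Sum>i<n. (r (W i \<omega>))\<^sup>2) / real n \<ge> \<epsilon> / (8 * \<beta>)}"
      by (rule finite_measure_mono) (auto intro: order_trans[OF _ Qle])
    also have "\<dots> \<le> (\<integral>\<omega>. 4 * real k * (\<Sum>i<n. (r (W i \<omega>))\<^sup>2) / real n \<partial>M) / (\<epsilon> / (8 * \<beta>))"
      using n \<epsilon> \<beta>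
      by (intro integral_Markov_inequality_measure[OF I, where A="space M"])
         (auto intro!: AE_I2 divide_nonneg_nonneg mult_nonneg_nonneg sum_nonneg)
    also have "(\<integral>\<omega>. 4 * real k * (\<Sum>i<n. (r (W i \<omega>))\<^sup>2) / real n \<partial>M) = 4 * real k * (\<Sum>i<n. \<integral>\<omega>. (r (W i \<omega>))\<^sup>2 \<partial>M) / real n"
      using rint by simp
    also have "(\<Sum>i<n. \<integral>\<omega>. (r (W i \<omega>))\<^sup>2 \<partial>M) = real n * (\<integral>w. (r w)\<^sup>2 \<partial>\<nu>)"
      using integral_W[of "\<lambda>w. (r w)\<^sup>2"] by simp
    also have "4 * real k * (real n * (\<integral>w. (r w)\<^sup>2 \<partial>\<nu>)) / real n / (\<epsilon> / (8 * \<beta>)) \<le> (4 * real k * (4 * \<delta>)) / (\<epsilon> / (8 * \<beta>))"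
      using n r2 k0 \<epsilon> \<beta> by (intro divide_right_mono) (auto simp: r_def)
    also note \<delta>2
    finally show ?thesis .
  qed
  have key: "\<bar>Q b m \<omega> - K2 * v0\<bar> \<le> 2 * \<bar>Q u m \<omega> - K2 * m2\<bar> + \<epsilon> / 4 + 2 * \<beta> * L\<^sup>2 * \<Psi> m \<omega> + 2 * \<beta> * Q r m \<omega>" for m \<omega>
  proof -
    let ?P = "part (k * m) \<omega>"
    have beq: "b w = u w + (h (Z w) + r w)" for w by (simp add: r_def)
    have "\<bar>dispersion ?P (\<lambda>i. b (W i \<omega>)) - dispersion ?P (\<lambda>i. u (W i \<omega>))\<bar>
      \<le> \<eta> * dispersion ?P (\<lambda>i. u (W i \<omega>)) + \<beta> * dispersion ?P (\<lambda>i. h (Z (W i \<omega>)) + r (W i \<omega>))"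
      unfolding beq \<beta>_def by (rule dispersion_perturb[OF \<eta>(1)])
    also have "dispersion ?P (\<lambda>i. h (Z (W i \<omega>)) + r (W i \<omega>))
      \<le> 2 * (L\<^sup>2 * dispersion_metric ?P (\<lambda>i. Z (W i \<omega>))) + 2 * dispersion ?P (\<lambda>i. r (W i \<omega>))"
      by (rule order_trans[OF dispersion_add_le]) (use dispersion_lipschitz_le[OF h] in simp)
    finally have "\<bar>dispersion ?P (\<lambda>i. b (W i \<omega>)) - dispersion ?P (\<lambda>i. u (W i \<omega>))\<bar>
      \<le> \<eta> * dispersion ?P (\<lambda>i. u (W i \<omega>)) + \<beta> * (2 * (L\<^sup>2 * dispersion_metric ?P (\<lambda>i. Z (W i \<omega>))) + 2 * dispersion ?P (\<lambda>i. r (W i \<omega>)))"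
      using \<beta> by simp
    from divide_right_mono[OF this, of "real (k * m)"]
    have 1: "\<bar>Q b m \<omega> - Q u m \<omega>\<bar> \<le> \<eta> * Q u m \<omega> + \<beta> * (2 * (L\<^sup>2 * \<Psi> m \<omega>) + 2 * Q r m \<omega>)"
      unfolding Q_def \<Psi>_def by (simp add: distrib_left add_divide_distrib diff_divide_distrib[symmetric] abs_divide)
    have "\<eta> * Q u m \<omega> \<le> \<eta> * (\<bar>Q u m \<omega> - K2 * m2\<bar> + K2 * m2)"
      using \<eta> by (intro mult_left_mono) auto
    also have "\<dots> \<le> \<bar>Q u m \<omega> - K2 * m2\<bar> + \<eta> * K2 * m2"
      using mult_right_mono[OF \<eta>(2), of "\<bar>Q u m \<omega> - K2 * m2\<bar>"] by (simp add: algebra_simps)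
    finally have 2: "\<eta> * Q u m \<omega> \<le> \<bar>Q u m \<omega> - K2 * m2\<bar> + \<eta> * K2 * m2" .
    have 3: "\<bar>K2 * m2 - K2 * v0\<bar> = K2 * \<bar>m2 - v0\<bar>" using K2 by (simp add: abs_mult flip: right_diff_distrib)
    have "\<bar>Q b m \<omega> - K2 * v0\<bar> \<le> \<bar>Q b m \<omega> - Q u m \<omega>\<bar> + \<bar>Q u m \<omega> - K2 * m2\<bar> + \<bar>K2 * m2 - K2 * v0\<bar>" by linarith
    then show ?thesis using 1 2 det unfolding 3 by (simp add: algebra_simps)
  qed
  define \<tau> where "\<tau> = \<epsilon> / (8 * \<beta> * (L\<^sup>2 + 1))"
  have \<tau>: "\<tau> > 0" using \<epsilon> \<beta> by (simp add: \<tau>_def add_nonneg_pos)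
  have inc: "{\<omega>\<in>space M. \<bar>Q b m \<omega> - K2 * v0\<bar> > \<epsilon>} \<subseteq>
      {\<omega>\<in>space M. \<bar>Q u m \<omega> - K2 * m2\<bar> > \<epsilon> / 8} \<union> {\<omega>\<in>space M. \<Psi> m \<omega> > \<tau>} \<union> {\<omega>\<in>space M. Q r m \<omega> \<ge> \<epsilon> / (8 * \<beta>)}"
    (is "?L \<subseteq> ?R") for m
  proof (rule subsetI, rule ccontr)
    fix \<omega> assume "\<omega> \<in> ?L" and "\<omega> \<notin> ?R"
    then have \<omega>: "\<bar>Q b m \<omega> - K2 * v0\<bar> > \<epsilon>" "\<bar>Q u m \<omega> - K2 * m2\<bar> \<le> \<epsilon> / 8" "\<Psi> m \<omega> \<le> \<tau>"
        "Q r m \<omega> < \<epsilon> / (8 * \<beta>)"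
      by (auto simp: not_le not_less)
    have "2 * \<beta> * L\<^sup>2 * \<Psi> m \<omega> \<le> 2 * \<beta> * L\<^sup>2 * \<tau>" using \<omega>(3) \<beta> by (intro mult_left_mono) auto
    also have "\<dots> \<le> 2 * \<beta> * (L\<^sup>2 + 1) * \<tau>" using \<beta> \<tau> by (intro mult_right_mono) auto
    also have "\<dots> = \<epsilon> / 4"
    proof -
      have "2 * \<beta> * c * (\<epsilon> / (8 * \<beta> * c)) = \<epsilon> / 4" if "c > 0" for c using that \<beta> by simp
      from this[of "L\<^sup>2 + 1"] show ?thesis by (simp only: \<tau>_def add_nonneg_pos zero_le_power2 zero_less_one)
    qed
    finally have a: "2 * \<beta> * L\<^sup>2 * \<Psi> m \<omega> \<le> \<epsilon> / 4" .
    have "2 * \<beta> * Q r m \<omega> \<le> 2 * \<beta> * (\<epsilon> / (8 * \<beta>))" using \<omega>(4) \<beta> by (intro mult_left_mono) auto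
    also have "\<dots> = \<epsilon> / 4" using \<beta> by simp
    finally have c: "2 * \<beta> * Q r m \<omega> \<le> \<epsilon> / 4" .
    have False if "A \<le> 2 * B + \<epsilon> / 4 + C + E" "C \<le> \<epsilon> / 4" "E \<le> \<epsilon> / 4" "\<epsilon> < A" "B \<le> \<epsilon> / 8" for A B C E
      using that by linarith
    from this[OF key[of m \<omega>] a c \<omega>(1,2)] show False .
  qed
  have c1: "(\<lambda>m. prob {\<omega>\<in>space M. \<bar>Q u m \<omega> - K2 * m2\<bar> > \<epsilon> / 8}) \<longlonglongrightarrow> 0"
    unfolding Q_def K2_def m2_def by (rule dispersion_centred_limit[OF u' K u0]) (use \<epsilon> in auto)
  have c2: "(\<lambda>m. prob {\<omega>\<in>space M. \<Psi> m \<omega> > \<tau>}) \<longlonglongrightarrow> 0"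
    unfolding \<Psi>_def by (rule close[OF \<tau>])
  have "eventually (\<lambda>m. prob {\<omega>\<in>space M. \<bar>Q u m \<omega> - K2 * m2\<bar> > \<epsilon> / 8} < \<kappa> / 4) sequentially"
    "eventually (\<lambda>m. prob {\<omega>\<in>space M. \<Psi> m \<omega> > \<tau>} < \<kappa> / 4) sequentially"
    using order_tendstoD(2)[OF c1, of "\<kappa> / 4"] order_tendstoD(2)[OF c2, of "\<kappa> / 4"] \<kappa> by auto
  then have "eventually (\<lambda>m. prob {\<omega>\<in>space M. \<bar>Q b m \<omega> - K2 * v0\<bar> > \<epsilon>} \<le> \<kappa>) sequentially"
    using eventually_gt_at_top[of 0]
  proof eventually_elim
    case (elim m)
    have "prob {\<omega>\<in>space M. \<bar>Q b m \<omega> - K2 * v0\<bar> > \<epsilon>} \<le> prob {\<omega>\<in>space M. \<bar>Q u m \<omega> - K2 * m2\<bar> > \<epsilon> / 8}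
       + prob {\<omega>\<in>space M. \<Psi> m \<omega> > \<tau>} + prob {\<omega>\<in>space M. Q r m \<omega> \<ge> \<epsilon> / (8 * \<beta>)}"
      by (rule order_trans[OF finite_measure_mono[OF inc]])
         (auto intro!: order_trans[OF measure_Un_le] add_mono)
    then show ?case using elim pr[of m] by simp
  qed
  then show "eventually (\<lambda>m. prob {\<omega>\<in>space M. \<bar>dispersion (part (k * m) \<omega>) (\<lambda>i. b (W i \<omega>)) / real (k * m)
      - 2 * (real k - 1) * v0\<bar> > \<epsilon>} \<le> \<kappa>) sequentially"
    unfolding Q_def K2_def .
qed simp

lemma max_negligible:
  fixes b :: "'w \<Rightarrow> real"
  assumes b[measurable]: "b \<in> borel_measurable MW" and b2: "integrable \<nu> (\<lambda>w. (b w)\<^sup>2)" and \<eta>: "\<eta> > 0"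
  shows "(\<lambda>m. prob {\<omega>\<in>space M. \<exists>i<k * m. \<bar>b (W i \<omega>)\<bar> > \<eta> * sqrt (real (k * m))}) \<longlonglongrightarrow> 0"
proof -
  define A where "A m = {w\<in>space MW. \<bar>b w\<bar> > \<eta> * sqrt (real (k * m))}" for m
  have [measurable]: "A m \<in> sets MW" for m unfolding A_def by measurable
  have "(\<lambda>m. \<integral>w. (b w)\<^sup>2 * indicator (A m) w \<partial>\<nu>) \<longlonglongrightarrow> (\<integral>w. 0 \<partial>\<nu>)"
  proof (rule integral_dominated_convergence[OF _ _ b2])
    show "AE w in \<nu>. (\<lambda>m. (b w)\<^sup>2 * indicator (A m) w) \<longlonglongrightarrow> 0"
    proof (rule AE_I2)
      fix w
      obtain m0 :: nat where m0: "(b w / \<eta>)\<^sup>2 < real m0" using reals_Archimedean2 by blast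
      have "eventually (\<lambda>m. (b w)\<^sup>2 * indicator (A m) w = 0) sequentially"
        using eventually_ge_at_top[of m0]
      proof eventually_elim
        case (elim m)
        have "m0 \<le> k * m" using elim k2 by (metis le_trans mult.commute mult_le_mono2 nat_mult_1_right one_le_numeral)
        then have "(b w / \<eta>)\<^sup>2 \<le> real (k * m)" using m0 by linarith
        then have "\<bar>b w / \<eta>\<bar> \<le> sqrt (real (k * m))" by (simp only: real_le_rsqrt power2_abs)
        then have "\<bar>b w\<bar> \<le> \<eta> * sqrt (real (k * m))" using \<eta> by (simp add: abs_divide divide_le_eq mult.commute)
        then show ?case by (simp add: A_def indicator_def)
      qed
      then show "(\<lambda>m. (b w)\<^sup>2 * indicator (A m) w) \<longlonglongrightarrow> 0" by (rule tendsto_eventually)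
    qed
  qed (auto simp: indicator_def)
  then have lim: "(\<lambda>m. (\<integral>w. (b w)\<^sup>2 * indicator (A m) w \<partial>\<nu>) / \<eta>\<^sup>2) \<longlonglongrightarrow> 0"
    using tendsto_divide[of _ 0 sequentially "\<lambda>_. \<eta>\<^sup>2" "\<eta>\<^sup>2"] \<eta> by simp
  have bound: "prob {\<omega>\<in>space M. \<exists>i<k * m. \<bar>b (W i \<omega>)\<bar> > \<eta> * sqrt (real (k * m))}
      \<le> (\<integral>w. (b w)\<^sup>2 * indicator (A m) w \<partial>\<nu>) / \<eta>\<^sup>2" for m
  proof -
    define n where "n = k * m"
    have "{\<omega>\<in>space M. \<exists>i<n. \<bar>b (W i \<omega>)\<bar> > \<eta> * sqrt (real n)} = (\<Union>i<n. W i -` A m \<inter> space M)"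
      by (auto simp: A_def n_def W_in_space)
    then have "prob {\<omega>\<in>space M. \<exists>i<n. \<bar>b (W i \<omega>)\<bar> > \<eta> * sqrt (real n)} \<le> (\<Sum>i<n. prob (W i -` A m \<inter> space M))"
      by (simp only:) (rule finite_measure_subadditive_finite, auto)
    also have "\<dots> = (\<Sum>i<n. nu.prob (A m))"
    proof (rule sum.cong[OF refl])
      fix i
      show "prob (W i -` A m \<inter> space M) = nu.prob (A m)"
        unfolding \<nu>_def W_ident[of i, symmetric] by (rule measure_distr[symmetric]) auto
    qed
    also have "\<dots> = (\<integral>w. real n * indicator (A m) w \<partial>\<nu>)" by simp
    also have "\<dots> \<le> (\<integral>w. (b w)\<^sup>2 * indicator (A m) w / \<eta>\<^sup>2 \<partial>\<nu>)"
    proof (rule integral_mono)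
      show "integrable \<nu> (\<lambda>w. (b w)\<^sup>2 * indicator (A m) w / \<eta>\<^sup>2)"
        using integrable_real_mult_indicator[OF _ b2, of "A m"] by simp
      show "integrable \<nu> (\<lambda>w. real n * indicator (A m) w)"
        by (rule nu.integrable_const_bound[where B="real n"]) (auto simp: indicator_def)
      show "real n * indicator (A m) w \<le> (b w)\<^sup>2 * indicator (A m) w / \<eta>\<^sup>2" for w
      proof (cases "w \<in> A m")
        case True
        then have "\<eta> * sqrt (real n) \<le> \<bar>b w\<bar>" by (simp add: A_def n_def)
        then have "(\<eta> * sqrt (real n))\<^sup>2 \<le> \<bar>b w\<bar>\<^sup>2" using \<eta> by (intro power_mono) auto
        then have "\<eta>\<^sup>2 * real n \<le> (b w)\<^sup>2" by (simp add: power_mult_distrib)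
        then show ?thesis using True \<eta> by (simp add: pos_le_divide_eq mult.commute)
      qed simp
    qed
    finally show ?thesis by (simp add: n_def)
  qed
  show ?thesis
    by (rule tendsto_sandwich[OF _ _ tendsto_const lim]) (use bound in auto)
qed

end

section \<open>Conditional characteristic function\<close>

lemma abs_exp_minus_diff_le:
  fixes x y :: real
  assumes "0 \<le> x" "0 \<le> y"
  shows "\<bar>exp (- x) - exp (- y)\<bar> \<le> \<bar>x - y\<bar>"
proof -
  have *: "exp (- x) - exp (- y) \<le> y - x" if "0 \<le> x" "x \<le> y" for x y :: real
  proof -
    have "exp (- x) - exp (- y) = exp (- x) * (1 - exp (- (y - x)))"
      by (simp add: right_diff_distrib flip: exp_add)
    also have "\<dots> \<le> 1 * (y - x)"
    proof (rule mult_mono)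
      show "1 - exp (- (y - x)) \<le> y - x" using exp_ge_add_one_self[of "- (y - x)"] by linarith
    qed (use that in auto)
    finally show ?thesis by simp
  qed
  show ?thesis
  proof (cases "x \<le> y")
    case True
    then show ?thesis using *[of x y] assms by simp
  next
    case False
    then show ?thesis using *[of y x] assms by simp
  qed
qed

lemma gen_sigma_rv_events: "gen_sigma M (rv_events M N X) = vimage_algebra (space M) X N"
  by (simp add: gen_sigma_def rv_events_def vimage_algebra_def)

context grouped_sample begin

lemma cond_exp_transfer:
  fixes f :: "'w \<Rightarrow> real"
  assumes f[measurable]: "f \<in> borel_measurable MW" and fint: "integrable \<nu> f"
  shows "AE \<omega> in M. real_cond_exp M (gen_sigma M (rv_events M borel (\<lambda>\<omega>. Z (W 0 \<omega>)))) (\<lambda>\<omega>. f (W 0 \<omega>)) \<omega>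
      = real_cond_exp \<nu> (vimage_algebra (space MW) Z borel) f (W 0 \<omega>)"
proof -
  define G where "G = vimage_algebra (space M) (\<lambda>\<omega>. Z (W 0 \<omega>)) borel"
  define N where "N = vimage_algebra (space MW) Z borel"
  have subG: "subalgebra M G" unfolding subalgebra_def G_def by (auto simp: sets_vimage_algebra2)
  have subN: "subalgebra \<nu> N" unfolding subalgebra_def N_def by (auto simp: sets_vimage_algebra2)
  interpret S: finite_measure_subalgebra M G
    using subG by (simp add: finite_measure_subalgebra_def finite_measure_subalgebra_axioms_def finite_measure_axioms)
  interpret T: finite_measure_subalgebra \<nu> N
    using subN by (simp add: finite_measure_subalgebra_def finite_measure_subalgebra_axioms_def nu.finite_measure_axioms)
  define g where "g = real_cond_exp \<nu> N f"
  have gN: "g \<in> borel_measurable N" unfolding g_def by simp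
  have g[measurable]: "g \<in> borel_measurable MW"
    using measurable_from_subalg[OF subN gN] by (simp add: measurable_cong_sets[OF sets_nu refl])
  have gint: "integrable \<nu> g" unfolding g_def using fint by (rule T.real_cond_exp_int)
  have W0: "W 0 \<in> measurable G N"
    unfolding N_def
  proof (rule measurable_vimage_algebra2)
    show "W 0 \<in> space G \<rightarrow> space MW" by (auto simp: G_def W_in_space)
    show "(\<lambda>x. Z (W 0 x)) \<in> borel_measurable G"
      unfolding G_def by (rule measurable_vimage_algebra1) simp
  qed
  have "AE \<omega> in M. real_cond_exp M G (\<lambda>\<omega>. f (W 0 \<omega>)) \<omega> = g (W 0 \<omega>)"
  proof (rule S.real_cond_exp_charact)
    fix A assume "A \<in> sets G"
    then obtain B where B[measurable]: "B \<in> sets borel" and A: "A = (\<lambda>\<omega>. Z (W 0 \<omega>)) -` B \<inter> space M"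
      unfolding G_def by (rule in_sets_vimage_algebra) auto
    define C where "C = Z -` B \<inter> space MW"
    have C: "C \<in> sets N" unfolding C_def N_def by (rule in_vimage_algebra) simp
    have [measurable]: "C \<in> sets MW" unfolding C_def by measurable
    have eq: "(LINT \<omega>:A|M. q (W 0 \<omega>)) = (LINT w:C|\<nu>. q w)" if [measurable]: "q \<in> borel_measurable MW" for q :: "'w \<Rightarrow> real"
    proof -
      have "(LINT \<omega>:A|M. q (W 0 \<omega>)) = (\<integral>\<omega>. indicator C (W 0 \<omega>) *\<^sub>R q (W 0 \<omega>) \<partial>M)"
        unfolding set_lebesgue_integral_def
        by (rule Bochner_Integration.integral_cong) (auto simp: A C_def indicator_def W_in_space)
      also have "\<dots> = (LINT w:C|\<nu>. q w)"
        unfolding set_lebesgue_integral_def by (rule integral_W[of "\<lambda>w. indicator C w *\<^sub>R q w"]) measurable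
      finally show ?thesis .
    qed
    show "(LINT \<omega>:A|M. f (W 0 \<omega>)) = (LINT \<omega>:A|M. g (W 0 \<omega>))"
      unfolding eq[OF f] eq[OF g] unfolding g_def by (rule T.real_cond_exp_intA[OF fint C])
  next
    show "integrable M (\<lambda>\<omega>. f (W 0 \<omega>))" by (rule integrable_W[OF f fint])
    show "integrable M (\<lambda>\<omega>. g (W 0 \<omega>))" by (rule integrable_W[OF g gint])
    show "(\<lambda>\<omega>. g (W 0 \<omega>)) \<in> borel_measurable G" by (rule measurable_compose[OF W0 gN])
  qed
  then show ?thesis unfolding gen_sigma_rv_events G_def g_def N_def .
qed

end

locale stratified_design = grouped_sample +
  fixes D :: "nat \<Rightarrow> nat \<Rightarrow> 'a \<Rightarrow> bool" and l :: nat and F :: "nat \<Rightarrow> 'a measure"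
  assumes lk: "1 \<le> l" "l < k"
    and F_def: "F n = gen_sigma M ((\<Union>i<n. rv_events M MW (W i)) \<union> rv_events M Mp (\<pi> n))"
    and D_meas: "\<And>n i. k dvd n \<Longrightarrow> i < n \<Longrightarrow> D n i \<in> measurable M (count_space UNIV)"
    and D_law: "\<And>n A d. k dvd n \<Longrightarrow> A \<in> sets (F n) \<Longrightarrow>
          measure M (A \<inter> {\<omega>\<in>space M. \<forall>i<n. D n i \<omega> = d i}) =
          (\<integral>\<omega>. indicator A \<omega> *
               (if valid_assignment l (part n \<omega>) d then 1 / real (k choose l) ^ (n div k) else 0) \<partial>M)"
begin

lemma sets_F: "sets (F n) = sigma_sets (space M) ((\<Union>i<n. rv_events M MW (W i)) \<union> rv_events M Mp (\<pi> n))"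
  and space_F[simp]: "space (F n) = space M"
proof -
  have "(\<Union>i<n. rv_events M MW (W i)) \<union> rv_events M Mp (\<pi> n) \<subseteq> Pow (space M)" by (auto simp: rv_events_def)
  then show "sets (F n) = sigma_sets (space M) ((\<Union>i<n. rv_events M MW (W i)) \<union> rv_events M Mp (\<pi> n))"
    "space (F n) = space M"
    by (auto simp: F_def gen_sigma_def space_measure_of_conv)
qed

lemma subalgebra_F: "subalgebra M (F n)"
  unfolding subalgebra_def sets_F by (auto intro!: sets.sigma_sets_subset simp: rv_events_def)

lemma W_meas_F: "i < n \<Longrightarrow> W i \<in> measurable (F n) MW"
  by (rule measurableI) (auto simp: W_in_space sets_F rv_events_def intro!: sigma_sets.Basic)

lemma pi_meas_F: "\<pi> n \<in> measurable (F n) Mp"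
  by (rule measurableI) (auto simp: pi_in_space sets_F rv_events_def intro!: sigma_sets.Basic)

lemma part_meas_F:
  assumes "k dvd n"
  shows "part n \<in> measurable (F n) (count_space (Pow (Pow {..<n})))"
proof (rule part_meas_subalgebra[OF assms space_F])
  fix P
  let ?G = "(\<Union>i<n. rv_events M borel (\<lambda>\<omega>. Z (W i \<omega>))) \<union> rv_events M Mp (\<pi> n)"
  have "(\<lambda>\<omega>. Z (W i \<omega>)) \<in> borel_measurable (F n)" if "i < n" for i
    using measurable_compose[OF W_meas_F[OF that] Z_meas] .
  then have "?G \<subseteq> sets (F n)"
    using pi_meas_F[of n] by (auto simp: rv_events_def measurable_def)
  then have "sigma_sets (space M) ?G \<subseteq> sets (F n)"
    using sets.sigma_sets_subset[of ?G "F n"] by simp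
  moreover have "?G \<subseteq> Pow (space M)" by (auto simp: rv_events_def)
  then have "sets (gen_sigma M ?G) = sigma_sets (space M) ?G" by (simp add: gen_sigma_def)
  ultimately show "{\<omega>\<in>space M. part n \<omega> = P} \<in> sets (F n)" using part_meas[OF assms, of P] by blast
qed

sublocale cond: finite_measure_subalgebra M "F n" for n
  using subalgebra_F by (simp add: finite_measure_subalgebra_def finite_measure_subalgebra_axioms_def finite_measure_axioms)

definition assign_event :: "nat \<Rightarrow> nat set \<Rightarrow> 'a set" where
  "assign_event n T = {\<omega>\<in>space M. \<forall>i<n. D n i \<omega> = (i \<in> T)}"

definition assign_prob :: "nat \<Rightarrow> nat set \<Rightarrow> 'a \<Rightarrow> real" where
  "assign_prob n T \<omega> = (if valid_assignment l (part n \<omega>) (\<lambda>i. i \<in> T) then 1 / real (k choose l) ^ (n div k) else 0)"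

lemma assign_event_meas:
  assumes "k dvd n"
  shows "assign_event n T \<in> sets M"
proof -
  have ev: "{\<omega>\<in>space M. D n i \<omega> = (i \<in> T)} \<in> sets M" if "i < n" for i
  proof -
    have "{\<omega>\<in>space M. D n i \<omega> = (i \<in> T)} = D n i -` {i \<in> T} \<inter> space M" by auto
    then show ?thesis using measurable_sets[OF D_meas[OF assms that], of "{i \<in> T}"] by simp
  qed
  have "{\<omega>\<in>space M. \<forall>i\<in>{..<n}. D n i \<omega> = (i \<in> T)} \<in> sets M"
  proof (rule sets.sets_Collect_finite_All[where P="\<lambda>i \<omega>. D n i \<omega> = (i \<in> T)"])
    show "{\<omega>\<in>space M. D n i \<omega> = (i \<in> T)} \<in> sets M" if "i \<in> {..<n}" for i using ev that by blast
  qed simp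
  then show ?thesis unfolding assign_event_def lessThan_iff Ball_def .
qed

lemma assign_prob_meas: "k dvd n \<Longrightarrow> assign_prob n T \<in> borel_measurable (F n)"
  unfolding assign_prob_def by (rule measurable_part_compose[OF part_meas_F]) auto

lemma cond_assign_prob:
  assumes n: "k dvd n"
  shows "AE \<omega> in M. real_cond_exp M (F n) (indicator (assign_event n T)) \<omega> = assign_prob n T \<omega>"
proof (rule cond.real_cond_exp_charact)
  note [measurable] = assign_event_meas[OF n, of T] measurable_from_subalg[OF subalgebra_F assign_prob_meas[OF n, of T]]
  show "integrable M (indicat_real (assign_event n T))"
    by (rule integrable_const_bound[where B=1]) (auto simp: indicator_def)
  show "integrable M (assign_prob n T)"
    by (rule integrable_const_bound[where B="1 / real (k choose l) ^ (n div k)"]) (auto simp: assign_prob_def)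
  show "assign_prob n T \<in> borel_measurable (F n)" by (rule assign_prob_meas[OF n])
  fix A assume A: "A \<in> sets (F n)"
  then have [measurable]: "A \<in> sets M" using subalgebra_F by (auto simp: subalgebra_def)
  have "(LINT \<omega>:A|M. indicator (assign_event n T) \<omega>) = (\<integral>\<omega>. indicator (A \<inter> assign_event n T) \<omega> \<partial>M :: real)"
    unfolding set_lebesgue_integral_def by (simp add: indicator_inter_arith)
  also have "\<dots> = prob (A \<inter> assign_event n T)" by simp
  also have "\<dots> = (LINT \<omega>:A|M. assign_prob n T \<omega>)"
    unfolding assign_event_def D_law[OF n A] set_lebesgue_integral_def assign_prob_def by simp
  finally show "(LINT \<omega>:A|M. indicator (assign_event n T) \<omega>) = (LINT \<omega>:A|M. assign_prob n T \<omega>)" .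
qed

lemma cond_exp_assignment:
  fixes b :: "'b \<Rightarrow> real" and g :: "real \<Rightarrow> real"
  assumes n: "k dvd n" and b[measurable]: "b \<in> borel_measurable MW"
    and g[measurable]: "g \<in> borel_measurable borel" and g1: "\<And>x. \<bar>g x\<bar> \<le> 1"
  shows "AE \<omega> in M. real_cond_exp M (F n) (\<lambda>\<omega>. g (c * (\<Sum>i<n. Hval l k (D n i \<omega>) * b (W i \<omega>)))) \<omega>
    = (\<Sum>T\<in>Pow {..<n}. g (c * (\<Sum>i<n. Hval l k (i \<in> T) * b (W i \<omega>))) * assign_prob n T \<omega>)"
proof -
  define \<theta> where "\<theta> T \<omega> = g (c * (\<Sum>i<n. Hval l k (i \<in> T) * b (W i \<omega>)))" for T \<omega>
  have \<theta>F: "\<theta> T \<in> borel_measurable (F n)" for T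
  proof -
    have "(\<lambda>\<omega>. b (W i \<omega>)) \<in> borel_measurable (F n)" if "i < n" for i
      using measurable_compose[OF W_meas_F[OF that] b] .
    then have [measurable]: "(\<lambda>\<omega>. \<Sum>i<n. Hval l k (i \<in> T) * b (W i \<omega>)) \<in> borel_measurable (F n)"
      by (intro borel_measurable_sum borel_measurable_times) auto
    show ?thesis unfolding \<theta>_def by measurable
  qed
  note [measurable] = measurable_from_subalg[OF subalgebra_F \<theta>F] assign_event_meas[OF n]
  define f where "f T \<omega> = \<theta> T \<omega> * indicator (assign_event n T) \<omega>" for T \<omega>
  have f_int: "integrable M (f T)" for T
    unfolding f_def by (rule integrable_const_bound[where B=1]) (use g1 in \<open>auto simp: \<theta>_def indicator_def\<close>)
  have split: "g (c * (\<Sum>i<n. Hval l k (D n i \<omega>) * b (W i \<omega>))) = (\<Sum>T\<in>Pow {..<n}. f T \<omega>)" if \<omega>: "\<omega> \<in> space M" for \<omega>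
  proof -
    define T0 where "T0 = {i. i < n \<and> D n i \<omega>}"
    have ev: "\<omega> \<in> assign_event n T \<longleftrightarrow> T = T0" if "T \<subseteq> {..<n}" for T
      using that \<omega> by (auto simp: assign_event_def T0_def)
    have "(\<Sum>T\<in>Pow {..<n}. f T \<omega>) = (\<Sum>T\<in>{T0}. f T \<omega>)"
      by (rule sum.mono_neutral_right) (auto simp: f_def ev T0_def)
    also have "\<dots> = \<theta> T0 \<omega>"
    proof -
      have "T0 \<subseteq> {..<n}" by (auto simp: T0_def)
      from ev[OF this] show ?thesis by (simp add: f_def)
    qed
    also have "\<dots> = g (c * (\<Sum>i<n. Hval l k (D n i \<omega>) * b (W i \<omega>)))"
      unfolding \<theta>_def by (intro arg_cong[where f=g] arg_cong[where f="\<lambda>x. c * x"] sum.cong) (auto simp: T0_def)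
    finally show ?thesis by simp
  qed
  have [measurable]: "(\<lambda>\<omega>. g (c * (\<Sum>i<n. Hval l k (D n i \<omega>) * b (W i \<omega>)))) \<in> borel_measurable M"
  proof (subst measurable_cong[OF split])
    show "(\<lambda>\<omega>. \<Sum>T\<in>Pow {..<n}. f T \<omega>) \<in> borel_measurable M"
      using f_int by (intro borel_measurable_sum) auto
  qed
  have 1: "AE \<omega> in M. real_cond_exp M (F n) (\<lambda>\<omega>. g (c * (\<Sum>i<n. Hval l k (D n i \<omega>) * b (W i \<omega>)))) \<omega>
     = real_cond_exp M (F n) (\<lambda>\<omega>. \<Sum>T\<in>Pow {..<n}. f T \<omega>) \<omega>"
    by (rule cond.real_cond_exp_cong) (use split f_int in auto)
  have 2: "AE \<omega> in M. real_cond_exp M (F n) (\<lambda>\<omega>. \<Sum>T\<in>Pow {..<n}. f T \<omega>) \<omega> = (\<Sum>T\<in>Pow {..<n}. real_cond_exp M (F n) (f T) \<omega>)"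
    by (rule cond.real_cond_exp_sum[OF f_int])
  have 3: "AE \<omega> in M. real_cond_exp M (F n) (f T) \<omega> = \<theta> T \<omega> * assign_prob n T \<omega>" for T
  proof -
    have "AE \<omega> in M. real_cond_exp M (F n) (f T) \<omega> = \<theta> T \<omega> * real_cond_exp M (F n) (indicator (assign_event n T)) \<omega>"
      unfolding f_def by (rule cond.real_cond_exp_mult[OF \<theta>F]) (use f_int[of T] in \<open>auto simp: f_def[abs_def]\<close>)
    then show ?thesis using cond_assign_prob[OF n, of T] by eventually_elim simp
  qed
  have "AE \<omega> in M. \<forall>T\<in>Pow {..<n}. real_cond_exp M (F n) (f T) \<omega> = \<theta> T \<omega> * assign_prob n T \<omega>"
    using 3 by (intro AE_finite_allI) auto
  with 1 2 show ?thesis by eventually_elim (simp add: \<theta>_def)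
qed

lemma cond_chf:
  fixes b :: "'b \<Rightarrow> real"
  assumes n: "k dvd n" and b[measurable]: "b \<in> borel_measurable MW"
  shows "AE \<omega> in M. Complex (real_cond_exp M (F n) (\<lambda>\<omega>. cos (c * (\<Sum>i<n. Hval l k (D n i \<omega>) * b (W i \<omega>)))) \<omega>)
        (real_cond_exp M (F n) (\<lambda>\<omega>. sin (c * (\<Sum>i<n. Hval l k (D n i \<omega>) * b (W i \<omega>)))) \<omega>)
    = (\<Prod>s\<in>part n \<omega>. (\<Sum>T\<in>subsets_of_card l s. cis (c * (\<Sum>i\<in>s. Hval l k (i \<in> T) * b (W i \<omega>)))) / of_nat (k choose l))"
proof -
  have C: "AE \<omega> in M. real_cond_exp M (F n) (\<lambda>\<omega>. cos (c * (\<Sum>i<n. Hval l k (D n i \<omega>) * b (W i \<omega>)))) \<omega>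
    = (\<Sum>T\<in>Pow {..<n}. cos (c * (\<Sum>i<n. Hval l k (i \<in> T) * b (W i \<omega>))) * assign_prob n T \<omega>)"
    by (rule cond_exp_assignment[OF n b]) auto
  have S: "AE \<omega> in M. real_cond_exp M (F n) (\<lambda>\<omega>. sin (c * (\<Sum>i<n. Hval l k (D n i \<omega>) * b (W i \<omega>)))) \<omega>
    = (\<Sum>T\<in>Pow {..<n}. sin (c * (\<Sum>i<n. Hval l k (i \<in> T) * b (W i \<omega>))) * assign_prob n T \<omega>)"
    by (rule cond_exp_assignment[OF n b]) auto
  show ?thesis using C S AE_space
  proof eventually_elim
    case (elim \<omega>)
    define P where "P = part n \<omega>"
    have P: "partition_on {..<n} P" "\<And>s. s \<in> P \<Longrightarrow> card s = k"
      using part_partition[OF n elim(3)] by (auto simp: P_def)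
    have finP: "finite P" using P(1) finite_elements by blast
    have "n = (\<Sum>s\<in>P. \<Sum>i\<in>s. 1)" using sum_partition_on[OF P(1), of "\<lambda>_. 1::nat"] by simp
    also have "\<dots> = k * card P" using P(2) by (simp add: mult.commute)
    finally have card: "n div k = card P" using lk by simp
    define x where "x T = c * (\<Sum>i<n. Hval l k (i \<in> T) * b (W i \<omega>))" for T
    define q where "q = complex_of_real (1 / real (k choose l) ^ card P)"
    have valid: "valid_assignment l P (\<lambda>i. i \<in> T) \<longleftrightarrow> (\<forall>s\<in>P. card (T \<inter> s) = l)" for T
    proof -
      have "{i \<in> s. i \<in> T} = T \<inter> s" for s by auto
      then show ?thesis by (simp add: valid_assignment_def)
    qed
    have "Complex (\<Sum>T\<in>Pow {..<n}. cos (x T) * assign_prob n T \<omega>) (\<Sum>T\<in>Pow {..<n}. sin (x T) * assign_prob n T \<omega>)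
      = (\<Sum>T\<in>Pow {..<n}. cis (x T) * of_real (assign_prob n T \<omega>))"
      by (simp add: complex_eq_iff)
    also have "\<dots> = (\<Sum>T | T \<subseteq> {..<n} \<and> (\<forall>s\<in>P. card (T \<inter> s) = l). cis (x T) * q)"
      by (rule sum.mono_neutral_cong_right) (auto simp: assign_prob_def P_def[symmetric] valid q_def card)
    also have "\<dots> = (\<Sum>T | T \<subseteq> {..<n} \<and> (\<forall>s\<in>P. card (T \<inter> s) = l). cis (x T)) * q"
      by (simp add: sum_distrib_right)
    also have "(\<Sum>T | T \<subseteq> {..<n} \<and> (\<forall>s\<in>P. card (T \<inter> s) = l). cis (x T))
      = (\<Prod>s\<in>P. \<Sum>T\<in>subsets_of_card l s. cis (c * (\<Sum>i\<in>s. Hval l k (i \<in> T) * b (W i \<omega>))))"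
      unfolding x_def by (rule sum_cis_partition[OF P(1)]) simp
    also have "\<dots> * q = (\<Prod>s\<in>P. (\<Sum>T\<in>subsets_of_card l s. cis (c * (\<Sum>i\<in>s. Hval l k (i \<in> T) * b (W i \<omega>)))) / of_nat (k choose l))"
      by (simp add: q_def prod_dividef)
    finally show ?case using elim(1,2) by (simp add: x_def P_def)
  qed
qed

lemma cond_chf_limit:
  fixes b :: "'b \<Rightarrow> real"
  assumes b[measurable]: "b \<in> borel_measurable MW" and b2: "integrable \<nu> (\<lambda>w. (b w)\<^sup>2)"
    and close: "\<And>\<epsilon>. \<epsilon> > 0 \<Longrightarrow> (\<lambda>m. prob {\<omega>\<in>space M.
       dispersion_metric (part (k * m) \<omega>) (\<lambda>i. Z (W i \<omega>)) / real (k * m) > \<epsilon>}) \<longlonglongrightarrow> 0"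
    and \<epsilon>: "\<epsilon> > 0"
  defines "v \<equiv> (\<integral>w. (b w - real_cond_exp \<nu> (vimage_algebra (space MW) Z borel) b w)\<^sup>2 \<partial>\<nu>) / sigD2 l k"
    and "\<Theta> \<equiv> \<lambda>n \<omega>. sqrt (real n) / real n * (\<Sum>i<n. Hval l k (D n i \<omega>) * b (W i \<omega>))"
  shows "(\<lambda>m. prob {\<omega>\<in>space M. cmod (Complex (real_cond_exp M (F (k * m)) (\<lambda>\<omega>. cos (\<Theta> (k * m) \<omega>)) \<omega>)
        (real_cond_exp M (F (k * m)) (\<lambda>\<omega>. sin (\<Theta> (k * m) \<omega>)) \<omega>) - of_real (exp (- v / 2))) > \<epsilon>}) \<longlonglongrightarrow> 0"
proof -
  define v0 where "v0 = (\<integral>w. (b w - real_cond_exp \<nu> (vimage_algebra (space MW) Z borel) b w)\<^sup>2 \<partial>\<nu>)"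
  define \<sigma> where "\<sigma> = sigD2 l k"
  have \<sigma>: "\<sigma> > 0" unfolding \<sigma>_def using lk by (rule sigD2_pos)
  have v: "v = v0 / \<sigma>" by (simp add: v_def v0_def \<sigma>_def)
  have v_nonneg: "v \<ge> 0" unfolding v v0_def using \<sigma> by simp
  define a where "a = 2 * (real k - 1)"
  have a: "a > 0" using k2 by (simp add: a_def)
  define B where "B = min 1 (\<epsilon> / (v + 1))"
  have B: "B > 0" "B \<le> 1" using \<epsilon> v_nonneg by (auto simp: B_def)
  have B\<epsilon>: "B * (v + 1) \<le> \<epsilon>"
    using v_nonneg by (auto simp: B_def min_def pos_le_divide_eq split: if_splits)
  define \<eta> where "\<eta> = B * \<sigma> / real k"
  have k0: "real k > 0" using k2 by simp
  have \<eta>: "\<eta> > 0" using B \<sigma> k0 by (simp add: \<eta>_def)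
  define \<tau> where "\<tau> = a * \<sigma> * min 1 \<epsilon>"
  have \<tau>: "\<tau> > 0" using a \<sigma> \<epsilon> by (simp add: \<tau>_def)
  define E1 where "E1 m = {\<omega>\<in>space M. \<exists>i<k * m. \<bar>b (W i \<omega>)\<bar> > \<eta> * sqrt (real (k * m))}" for m
  define E2 where "E2 m = {\<omega>\<in>space M. \<bar>dispersion (part (k * m) \<omega>) (\<lambda>i. b (W i \<omega>)) / real (k * m) - a * v0\<bar> > \<tau>}" for m
  have c1: "(\<lambda>m. prob (E1 m)) \<longlonglongrightarrow> 0" unfolding E1_def by (rule max_negligible[OF b b2 \<eta>])
  have c2: "(\<lambda>m. prob (E2 m)) \<longlonglongrightarrow> 0" unfolding E2_def a_def v0_def by (rule dispersion_limit[OF b b2 close \<tau>])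
  have E1m: "E1 m \<in> events" for m
  proof -
    have "E1 m = (\<Union>i<k * m. {\<omega>\<in>space M. \<bar>b (W i \<omega>)\<bar> > \<eta> * sqrt (real (k * m))})" by (auto simp: E1_def)
    then show ?thesis by simp
  qed
  have E2m: "E2 m \<in> events" for m
  proof -
    have [measurable]: "(\<lambda>\<omega>. dispersion (part (k * m) \<omega>) (\<lambda>i. b (W i \<omega>))) \<in> borel_measurable M"
      by (rule dispersion_meas) auto
    show ?thesis unfolding E2_def by measurable
  qed
  have bound: "prob {\<omega>\<in>space M. cmod (Complex (real_cond_exp M (F (k * m)) (\<lambda>\<omega>. cos (\<Theta> (k * m) \<omega>)) \<omega>)
        (real_cond_exp M (F (k * m)) (\<lambda>\<omega>. sin (\<Theta> (k * m) \<omega>)) \<omega>) - of_real (exp (- v / 2))) > \<epsilon>}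
     \<le> prob (E1 m) + prob (E2 m)" (is "prob ?A \<le> _") if m: "m > 0" for m
  proof -
    define n where "n = k * m"
    have n: "k dvd n" "real n > 0" using m k2 by (auto simp: n_def)
    define c where "c = sqrt (real n) / real n"
    have c: "c \<ge> 0" "c * sqrt (real n) = 1" "c\<^sup>2 = 1 / real n"
      using n by (auto simp: c_def power_divide power2_eq_square[of "real n"])
    have "AE \<omega> in M. \<omega> \<in> ?A \<longrightarrow> \<omega> \<in> E1 m \<union> E2 m"
      using cond_chf[OF n(1) b, of c] AE_space
    proof eventually_elim
      case (elim \<omega>)
      show ?case
      proof (rule impI, rule ccontr)
        assume A: "\<omega> \<in> ?A" and "\<omega> \<notin> E1 m \<union> E2 m"
        then have na: "\<omega> \<notin> E1 m" "\<omega> \<notin> E2 m" by auto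
        have s1: "\<bar>b (W i \<omega>)\<bar> \<le> \<eta> * sqrt (real n)" if "i < n" for i
          using na(1) elim(2) that unfolding E1_def n_def[symmetric] by (fastforce simp: not_less)
        have s2: "\<bar>dispersion (part n \<omega>) (\<lambda>i. b (W i \<omega>)) / real n - a * v0\<bar> \<le> \<tau>"
          using na(2) elim(2) by (simp add: E2_def n_def not_less)
        define P where "P = part n \<omega>"
        have P: "partition_on {..<n} P" "\<And>s. s \<in> P \<Longrightarrow> card s = k"
          using part_partition[OF n(1) elim(2)] by (auto simp: P_def)
        have finP: "finite P" using P(1) finite_elements by blast
        have sub: "s \<subseteq> {..<n}" if "s \<in> P" for s using partition_onD1[OF P(1)] that by auto
        define w where "w = c\<^sup>2 * (\<Sum>s\<in>P. \<Sum>i\<in>s. \<Sum>j\<in>s. (b (W i \<omega>) - b (W j \<omega>))\<^sup>2) / (2 * sigD2 l k * (real k - 1))"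
        define BB where "BB = c * (real k * (\<eta> * sqrt (real n) / sigD2 l k))"
        define \<phi> where "\<phi> = (\<Prod>s\<in>P. (\<Sum>T\<in>subsets_of_card l s. cis (c * (\<Sum>i\<in>s. Hval l k (i \<in> T) * b (W i \<omega>)))) / of_nat (k choose l))"
        have fins: "finite s \<and> card s = k" if "s \<in> P" for s
          using P(2)[OF that] sub[OF that] finite_subset by auto
        have 1: "cmod (\<phi> - of_real (exp (- w / 2))) \<le> (BB / 6 + BB\<^sup>2 / 8) * w"
          unfolding \<phi>_def w_def BB_def
          by (rule prod_group_cis_bound[OF finP fins lk c(1)]) (use s1 sub \<eta> in auto)
        have "BB = B"
        proof -
          have "BB = (c * sqrt (real n)) * (real k * \<eta> / \<sigma>)" by (simp add: BB_def \<sigma>_def)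
          then show ?thesis unfolding c(2) using \<sigma> k0 by (simp add: \<eta>_def)
        qed
        have w_eq: "w = dispersion P (\<lambda>i. b (W i \<omega>)) / real n / (a * \<sigma>)"
          unfolding w_def c(3) dispersion_def a_def \<sigma>_def by (simp add: mult_ac)
        have w0: "w \<ge> 0" unfolding w_eq using a \<sigma> by (simp add: dispersion_nonneg)
        have "w - v = (dispersion P (\<lambda>i. b (W i \<omega>)) / real n - a * v0) / (a * \<sigma>)"
          unfolding w_eq v using a \<sigma> by (simp add: diff_divide_distrib)
        then have "\<bar>w - v\<bar> \<le> \<tau> / (a * \<sigma>)"
          using s2 a \<sigma> by (simp add: P_def abs_divide divide_right_mono)
        also have "\<dots> = min 1 \<epsilon>" using a \<sigma> by (simp add: \<tau>_def)
        finally have wv: "\<bar>w - v\<bar> \<le> 1" "\<bar>w - v\<bar> \<le> \<epsilon>" by auto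
        have "(BB / 6 + BB\<^sup>2 / 8) * w \<le> B / 2 * (v + 1)"
        proof (rule mult_mono)
          have "B\<^sup>2 \<le> B" using B by (simp add: power2_eq_square mult_left_le)
          then show "BB / 6 + BB\<^sup>2 / 8 \<le> B / 2" using B unfolding \<open>BB = B\<close> by linarith
        qed (use wv w0 B in auto)
        also have "\<dots> \<le> \<epsilon> / 2" using B\<epsilon> by simp
        finally have 2: "(BB / 6 + BB\<^sup>2 / 8) * w \<le> \<epsilon> / 2" .
        have "\<bar>exp (- (w / 2)) - exp (- (v / 2))\<bar> \<le> \<bar>w / 2 - v / 2\<bar>"
          using w0 v_nonneg by (intro abs_exp_minus_diff_le) auto
        also have "\<dots> \<le> \<epsilon> / 2" using wv(2) by (simp flip: diff_divide_distrib)
        finally have "\<bar>exp (- w / 2) - exp (- v / 2)\<bar> \<le> \<epsilon> / 2" by simp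
        then have 3: "cmod (of_real (exp (- w / 2)) - of_real (exp (- v / 2))) \<le> \<epsilon> / 2"
          by (simp only: norm_of_real flip: of_real_diff)
        have "cmod (\<phi> - of_real (exp (- v / 2))) \<le> \<epsilon> / 2 + \<epsilon> / 2"
          using norm_triangle_le[OF add_mono[OF order_trans[OF 1 2] 3]] by simp
        moreover have "cmod (\<phi> - of_real (exp (- v / 2))) > \<epsilon>"
          using A elim(1) by (simp add: \<Theta>_def n_def c_def \<phi>_def P_def)
        ultimately show False by simp
      qed
    qed
    then have "prob ?A \<le> prob (E1 m \<union> E2 m)"
      by (rule finite_measure_mono_AE) (use E1m E2m in auto)
    also have "\<dots> \<le> prob (E1 m) + prob (E2 m)" by (rule measure_Un_le[OF E1m E2m])
    finally show ?thesis .
  qed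
  have lim: "(\<lambda>m. prob (E1 m) + prob (E2 m)) \<longlonglongrightarrow> 0" using tendsto_add[OF c1 c2] by simp
  show ?thesis
    by (rule tendsto_sandwich[OF _ _ tendsto_const lim])
       (use bound in \<open>auto intro!: eventually_mono[OF eventually_gt_at_top[of 0]]\<close>)
qed

end

context grouped_sample begin

lemma exp_cond_var_quadratic:
  fixes a :: "'w \<Rightarrow> real ^ 'd" and t :: "real ^ 'd"
  assumes a[measurable]: "a \<in> borel_measurable MW" and a2: "integrable \<nu> (\<lambda>w. (norm (a w))\<^sup>2)"
  shows "t \<bullet> (exp_cond_var M (gen_sigma M (rv_events M borel (\<lambda>\<omega>. Z (W 0 \<omega>)))) (\<lambda>\<omega>. a (W 0 \<omega>)) *v t)
    = (\<integral>w. (t \<bullet> a w - real_cond_exp \<nu> (vimage_algebra (space MW) Z borel) (\<lambda>w. t \<bullet> a w) w)\<^sup>2 \<partial>\<nu>)"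
proof -
  define G where "G = gen_sigma M (rv_events M borel (\<lambda>\<omega>. Z (W 0 \<omega>)))"
  define N where "N = vimage_algebra (space MW) Z borel"
  have subG: "subalgebra M G"
    unfolding G_def gen_sigma_rv_events subalgebra_def by (auto simp: sets_vimage_algebra2)
  have subN: "subalgebra \<nu> N" unfolding subalgebra_def N_def by (auto simp: sets_vimage_algebra2)
  interpret S: finite_measure_subalgebra M G
    using subG by (simp add: finite_measure_subalgebra_def finite_measure_subalgebra_axioms_def finite_measure_axioms)
  define Y where "Y i \<omega> = a (W 0 \<omega>) $ i" for i \<omega>
  have comp[measurable]: "(\<lambda>w. a w $ i) \<in> borel_measurable MW" for i
    using measurable_compose[OF a, of "\<lambda>x. x $ i" borel] by (simp add: borel_measurable_continuous_onI continuous_on_component)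
  have Ym[measurable]: "Y i \<in> borel_measurable M" for i unfolding Y_def by measurable
  have comp2: "integrable \<nu> (\<lambda>w. (a w $ i)\<^sup>2)" for i
  proof (rule Bochner_Integration.integrable_bound[OF a2])
    show "AE w in \<nu>. norm ((a w $ i)\<^sup>2) \<le> norm ((norm (a w))\<^sup>2)"
      using component_le_norm_cart[of _ i] by (auto intro!: AE_I2 power_mono simp: abs_le_square_iff[symmetric])
  qed simp
  have Y2: "integrable M (\<lambda>\<omega>. (Y i \<omega>)\<^sup>2)" for i
    unfolding Y_def by (rule integrable_W[OF _ comp2]) measurable
  define E where "E i = real_cond_exp M G (Y i)" for i
  note CE = cond_exp_square_le[OF prob_space_axioms subG Ym Y2]
  have Em[measurable]: "E i \<in> borel_measurable M" for i unfolding E_def by simp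
  define e where "e i \<omega> = Y i \<omega> - E i \<omega>" for i \<omega>
  have em[measurable]: "e i \<in> borel_measurable M" for i unfolding e_def by measurable
  have e2: "integrable M (\<lambda>\<omega>. (e i \<omega>)\<^sup>2)" for i
    unfolding e_def by (rule integrable_diff_square) (use Y2 CE in \<open>auto simp: E_def\<close>)
  have ee: "integrable M (\<lambda>\<omega>. e i \<omega> * e j \<omega>)" for i j
    by (rule integrable_mult_of_squares[OF em em e2 e2])
  have V: "exp_cond_var M G (\<lambda>\<omega>. a (W 0 \<omega>)) $ i $ j = (\<integral>\<omega>. e i \<omega> * e j \<omega> \<partial>M)" for i j
    using S.real_cond_exp_int(2)[OF ee[of i j]] by (simp add: exp_cond_var_def e_def E_def Y_def[abs_def])
  have "t \<bullet> (exp_cond_var M G (\<lambda>\<omega>. a (W 0 \<omega>)) *v t) = (\<Sum>i\<in>UNIV. \<Sum>j\<in>UNIV. t $ i * (t $ j * (\<integral>\<omega>. e i \<omega> * e j \<omega> \<partial>M)))"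
    by (simp add: inner_vec_def matrix_vector_mult_def V sum_distrib_left mult_ac)
  also have "\<dots> = (\<integral>\<omega>. (\<Sum>i\<in>UNIV. \<Sum>j\<in>UNIV. t $ i * (t $ j * (e i \<omega> * e j \<omega>))) \<partial>M)"
    using ee by simp
  also have "\<dots> = (\<integral>\<omega>. (\<Sum>i\<in>UNIV. t $ i * e i \<omega>)\<^sup>2 \<partial>M)"
    by (simp add: power2_eq_square sum_product mult_ac)
  also have "\<dots> = (\<integral>\<omega>. (t \<bullet> a (W 0 \<omega>) - real_cond_exp \<nu> N (\<lambda>w. t \<bullet> a w) (W 0 \<omega>))\<^sup>2 \<partial>M)"
  proof (rule integral_cong_AE)
    have Yint: "integrable M (\<lambda>\<omega>. t $ i * Y i \<omega>)" for i using CE(1) by simp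
    have tint: "integrable \<nu> (\<lambda>w. t \<bullet> a w)"
    proof -
      have "integrable \<nu> (\<lambda>w. a w $ i)" for i
        by (rule nu.square_integrable_imp_integrable[OF _ comp2]) simp
      then show ?thesis by (simp add: inner_vec_def)
    qed
    have 1: "AE \<omega> in M. real_cond_exp M G (\<lambda>\<omega>. \<Sum>i\<in>UNIV. t $ i * Y i \<omega>) \<omega> = (\<Sum>i\<in>UNIV. real_cond_exp M G (\<lambda>\<omega>. t $ i * Y i \<omega>) \<omega>)"
      by (rule S.real_cond_exp_sum[OF Yint])
    have 2: "AE \<omega> in M. \<forall>i\<in>UNIV. real_cond_exp M G (\<lambda>\<omega>. t $ i * Y i \<omega>) \<omega> = t $ i * E i \<omega>"
      unfolding E_def using CE(1) by (intro AE_finite_allI) auto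
    have 3: "AE \<omega> in M. real_cond_exp M G (\<lambda>\<omega>. t \<bullet> a (W 0 \<omega>)) \<omega> = real_cond_exp \<nu> N (\<lambda>w. t \<bullet> a w) (W 0 \<omega>)"
      unfolding G_def N_def by (rule cond_exp_transfer[OF _ tint]) measurable
    have eq: "(\<lambda>\<omega>. \<Sum>i\<in>UNIV. t $ i * Y i \<omega>) = (\<lambda>\<omega>. t \<bullet> a (W 0 \<omega>))"
      by (simp add: Y_def inner_vec_def)
    show "AE \<omega> in M. (\<Sum>i\<in>UNIV. t $ i * e i \<omega>)\<^sup>2 = (t \<bullet> a (W 0 \<omega>) - real_cond_exp \<nu> N (\<lambda>w. t \<bullet> a w) (W 0 \<omega>))\<^sup>2"
      using 1 2 3 unfolding eq
    proof eventually_elim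
      case (elim \<omega>)
      have "(\<Sum>i\<in>UNIV. t $ i * e i \<omega>) = t \<bullet> a (W 0 \<omega>) - (\<Sum>i\<in>UNIV. t $ i * E i \<omega>)"
        by (simp add: e_def right_diff_distrib sum_subtractf Y_def inner_vec_def)
      then show ?case using elim by simp
    qed
    have [measurable]: "real_cond_exp \<nu> N (\<lambda>w. t \<bullet> a w) \<in> borel_measurable MW"
      using borel_measurable_cond_exp2[of \<nu> N "\<lambda>w. t \<bullet> a w"] by (simp add: measurable_cong_sets[OF sets_nu refl])
    show "(\<lambda>\<omega>. (t \<bullet> a (W 0 \<omega>) - real_cond_exp \<nu> N (\<lambda>w. t \<bullet> a w) (W 0 \<omega>))\<^sup>2) \<in> borel_measurable M" by measurable
  qed measurable
  also have "\<dots> = (\<integral>w. (t \<bullet> a w - real_cond_exp \<nu> N (\<lambda>w. t \<bullet> a w) w)\<^sup>2 \<partial>\<nu>)"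
  proof (rule integral_W)
    have [measurable]: "real_cond_exp \<nu> N (\<lambda>w. t \<bullet> a w) \<in> borel_measurable MW"
      using borel_measurable_cond_exp2[of \<nu> N "\<lambda>w. t \<bullet> a w"] by (simp add: measurable_cong_sets[OF sets_nu refl])
    show "(\<lambda>w. (t \<bullet> a w - real_cond_exp \<nu> N (\<lambda>w. t \<bullet> a w) w)\<^sup>2) \<in> borel_measurable MW" by measurable
  qed
  finally show ?thesis by (simp add: G_def N_def)
qed

end

theorem mainTheorem18:
  fixes M :: "'m measure"
    and MR :: "'r measure" and MS :: "'s measure"
    and W :: "nat \<Rightarrow> 'm \<Rightarrow> 'r \<times> 's \<times> 's"
    and \<psi> :: "'r \<Rightarrow> real ^ 'dp"
    and Mp :: "'p measure" and \<pi> :: "nat \<Rightarrow> 'm \<Rightarrow> 'p"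
    and part :: "nat \<Rightarrow> 'm \<Rightarrow> nat set set"
    and D :: "nat \<Rightarrow> nat \<Rightarrow> 'm \<Rightarrow> bool"
    and a :: "'r \<times> 's \<times> 's \<Rightarrow> real ^ 'da"
    and l k :: nat
    and t :: "real ^ 'da"
  defines "MW \<equiv> MR \<Otimes>\<^sub>M (MS \<Otimes>\<^sub>M MS)"
  defines "F \<equiv> (\<lambda>n. gen_sigma M ((\<Union>i<n. rv_events M MW (W i)) \<union> rv_events M Mp (\<pi> n)))"
  defines "G\<psi>\<pi> \<equiv> (\<lambda>n. gen_sigma M ((\<Union>i<n. rv_events M borel (\<lambda>\<omega>. \<psi> (fst (W i \<omega>))))
                                     \<union> rv_events M Mp (\<pi> n)))"
  defines "X \<equiv> (\<lambda>n \<omega>. (sqrt (real n) / real n) *\<^sub>R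
                       (\<Sum>i<n. Hval l k (D n i \<omega>) *\<^sub>R a (W i \<omega>)))"
  defines "V \<equiv> (1 / sigD2 l k) *\<^sub>R
                exp_cond_var M (gen_sigma M (rv_events M borel (\<lambda>\<omega>. \<psi> (fst (W 0 \<omega>)))))
                               (\<lambda>\<omega>. a (W 0 \<omega>))"
  assumes M: "prob_space M"
    and lk: "1 \<le> l" "l < k"
    \<comment> \<open>W_i i.i.d.\<close>
    and W_indep: "prob_space.indep_vars M (\<lambda>_. MW) W UNIV"
    and W_ident: "\<And>i. distr M MW (W i) = distr M MW (W 0)"
    and \<psi>_meas: "\<psi> \<in> borel_measurable MR"
    \<comment> \<open>auxiliary randomness pi_n, independent of W_{1:n}\<close>
    and \<pi>_meas: "\<And>n. \<pi> n \<in> measurable M Mp"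
    and \<pi>_indep: "\<And>n. k dvd n \<Longrightarrow> prob_space.indep_set M (rv_events M Mp (\<pi> n))
                                  (rv_events M (\<Pi>\<^sub>M i\<in>{..<n}. MW) (\<lambda>\<omega>. restrict (\<lambda>i. W i \<omega>) {..<n}))"
    \<comment> \<open>step (1): partition into groups of size k, a function of psi_{1:n} and pi_n\<close>
    and part_partition: "\<And>n \<omega>. k dvd n \<Longrightarrow> \<omega> \<in> space M \<Longrightarrow>
                           partition_on {..<n} (part n \<omega>) \<and> (\<forall>s\<in>part n \<omega>. card s = k)"
    and part_meas: "\<And>n P. k dvd n \<Longrightarrow> {\<omega>\<in>space M. part n \<omega> = P} \<in> sets (G\<psi>\<pi> n)"
    and part_close: "\<And>\<epsilon>. \<epsilon> > 0 \<Longrightarrow>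
          (\<lambda>m. measure M {\<omega>\<in>space M.
              \<bar>(1 / real (k * m)) * (\<Sum>s\<in>part (k * m) \<omega>. \<Sum>i\<in>s. \<Sum>j\<in>s.
                   (norm (\<psi> (fst (W i \<omega>)) - \<psi> (fst (W j \<omega>))))\<^sup>2)\<bar> > \<epsilon>}) \<longlonglongrightarrow> 0"
    \<comment> \<open>step (2): given F_n, D_{1:n} is uniform over assignments with exactly l treated per group\<close>
    and D_meas: "\<And>n i. k dvd n \<Longrightarrow> i < n \<Longrightarrow> D n i \<in> measurable M (count_space UNIV)"
    and D_law: "\<And>n A d. k dvd n \<Longrightarrow> A \<in> sets (F n) \<Longrightarrow>
          measure M (A \<inter> {\<omega>\<in>space M. \<forall>i<n. D n i \<omega> = d i}) =
          (\<integral>\<omega>. indicator A \<omega> *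
               (if valid_assignment l (part n \<omega>) d then 1 / real (k choose l) ^ (n div k) else 0) \<partial>M)"
    \<comment> \<open>a measurable with finite second moment\<close>
    and a_meas: "a \<in> borel_measurable MW"
    and a_L2: "integrable M (\<lambda>\<omega>. (norm (a (W 0 \<omega>)))\<^sup>2)"
  shows "\<And>\<epsilon>. \<epsilon> > 0 \<Longrightarrow>
          (\<lambda>m. measure M {\<omega>\<in>space M.
              cmod (Complex (real_cond_exp M (F (k * m)) (\<lambda>\<omega>. cos (t \<bullet> X (k * m) \<omega>)) \<omega>)
                            (real_cond_exp M (F (k * m)) (\<lambda>\<omega>. sin (t \<bullet> X (k * m) \<omega>)) \<omega>)
                    - complex_of_real (exp (- (t \<bullet> (V *v t)) / 2))) > \<epsilon>}) \<longlonglongrightarrow> 0"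
proof -
  interpret prob_space M by (rule M)
  define Z where "Z w = \<psi> (fst w)" for w :: "'r \<times> 's \<times> 's"
  have Zm: "Z \<in> borel_measurable MW"
    unfolding Z_def MW_def using \<psi>_meas by measurable
  interpret stratified_design M MW W Z Mp \<pi> part k D l F
  proof
    show "2 \<le> k" using lk by simp
    show "indep_vars (\<lambda>_. MW) W UNIV" by (rule W_indep)
    show "distr M MW (W i) = distr M MW (W 0)" for i by (rule W_ident)
    show "Z \<in> borel_measurable MW" by (rule Zm)
    show "\<pi> n \<in> measurable M Mp" for n by (rule \<pi>_meas)
    show "indep_set (rv_events M Mp (\<pi> n))
       (rv_events M (\<Pi>\<^sub>M i\<in>{..<n}. MW) (\<lambda>\<omega>. restrict (\<lambda>i. W i \<omega>) {..<n}))" if "k dvd n" for n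
      by (rule \<pi>_indep[OF that])
    show "partition_on {..<n} (part n \<omega>) \<and> (\<forall>s\<in>part n \<omega>. card s = k)" if "k dvd n" "\<omega> \<in> space M" for n \<omega>
      by (rule part_partition[OF that])
    show "{\<omega>\<in>space M. part n \<omega> = P} \<in>
       sets (gen_sigma M ((\<Union>i<n. rv_events M borel (\<lambda>\<omega>. Z (W i \<omega>))) \<union> rv_events M Mp (\<pi> n)))" if "k dvd n" for n P
      using part_meas[OF that, of P] by (simp add: G\<psi>\<pi>_def Z_def)
    show "1 \<le> l" "l < k" using lk by auto
    show "F n = gen_sigma M ((\<Union>i<n. rv_events M MW (W i)) \<union> rv_events M Mp (\<pi> n))" for n
      by (simp add: F_def)
    show "D n i \<in> measurable M (count_space UNIV)" if "k dvd n" "i < n" for n i by (rule D_meas[OF that])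
    show "measure M (A \<inter> {\<omega>\<in>space M. \<forall>i<n. D n i \<omega> = d i}) = (\<integral>\<omega>. indicator A \<omega> *
         (if valid_assignment l (part n \<omega>) d then 1 / real (k choose l) ^ (n div k) else 0) \<partial>M)"
      if "k dvd n" "A \<in> sets (F n)" for n A d by (rule D_law[OF that])
  qed
  fix \<epsilon> :: real assume \<epsilon>: "\<epsilon> > 0"
  define b where "b w = t \<bullet> a w" for w
  have b[measurable]: "b \<in> borel_measurable MW" unfolding b_def using a_meas by measurable
  have a2: "integrable \<nu> (\<lambda>w. (norm (a w))\<^sup>2)"
    unfolding \<nu>_def using a_L2 a_meas by (subst integrable_distr_eq) auto
  have b2: "integrable \<nu> (\<lambda>w. (b w)\<^sup>2)"
  proof (rule Bochner_Integration.integrable_bound)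
    show "integrable \<nu> (\<lambda>w. (norm t)\<^sup>2 * (norm (a w))\<^sup>2)" using a2 by simp
    show "AE w in \<nu>. norm ((b w)\<^sup>2) \<le> norm ((norm t)\<^sup>2 * (norm (a w))\<^sup>2)"
    proof (rule AE_I2)
      fix w
      have "\<bar>b w\<bar>\<^sup>2 \<le> (norm t * norm (a w))\<^sup>2"
        unfolding b_def by (intro power_mono Cauchy_Schwarz_ineq2) simp
      then show "norm ((b w)\<^sup>2) \<le> norm ((norm t)\<^sup>2 * (norm (a w))\<^sup>2)" by (simp add: power_mult_distrib)
    qed
  qed simp
  have close: "(\<lambda>m. prob {\<omega>\<in>space M.
      dispersion_metric (part (k * m) \<omega>) (\<lambda>i. Z (W i \<omega>)) / real (k * m) > \<epsilon>}) \<longlonglongrightarrow> 0" if "\<epsilon> > 0" for \<epsilon>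
  proof -
    have "0 \<le> (\<Sum>s\<in>part (k * m) \<omega>. \<Sum>i\<in>s. \<Sum>j\<in>s. (norm (\<psi> (fst (W i \<omega>)) - \<psi> (fst (W j \<omega>))))\<^sup>2)" for m \<omega>
      by (intro sum_nonneg) auto
    then show ?thesis
      using part_close[OF that] by (simp add: dispersion_metric_def Z_def dist_norm abs_divide)
  qed
  have tX: "t \<bullet> X n \<omega> = sqrt (real n) / real n * (\<Sum>i<n. Hval l k (D n i \<omega>) * b (W i \<omega>))" for n \<omega>
    by (simp add: X_def b_def inner_sum_right)
  have "t \<bullet> (V *v t) = (1 / sigD2 l k) *
      (t \<bullet> (exp_cond_var M (gen_sigma M (rv_events M borel (\<lambda>\<omega>. Z (W 0 \<omega>)))) (\<lambda>\<omega>. a (W 0 \<omega>)) *v t))"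
    by (simp add: V_def Z_def matrix_vector_mult_def inner_vec_def sum_distrib_left mult_ac)
  also have "\<dots> = (\<integral>w. (b w - real_cond_exp \<nu> (vimage_algebra (space MW) Z borel) b w)\<^sup>2 \<partial>\<nu>) / sigD2 l k"
    unfolding exp_cond_var_quadratic[OF a_meas a2] b_def[abs_def] by simp
  finally have V: "t \<bullet> (V *v t) = (\<integral>w. (b w - real_cond_exp \<nu> (vimage_algebra (space MW) Z borel) b w)\<^sup>2 \<partial>\<nu>) / sigD2 l k" .
  show "(\<lambda>m. measure M {\<omega>\<in>space M.
              cmod (Complex (real_cond_exp M (F (k * m)) (\<lambda>\<omega>. cos (t \<bullet> X (k * m) \<omega>)) \<omega>)
                            (real_cond_exp M (F (k * m)) (\<lambda>\<omega>. sin (t \<bullet> X (k * m) \<omega>)) \<omega>)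
                    - complex_of_real (exp (- (t \<bullet> (V *v t)) / 2))) > \<epsilon>}) \<longlonglongrightarrow> 0"
    unfolding V tX by (rule cond_chf_limit[OF b b2 close \<epsilon>])
qed

end
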